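(* Consider the adapt-then-combine diffusion strategy over a weakly-connected network as described in the context, with step-sizes $\mu_k=\tau_k\mu_{\max}$ ($0<\tau_k\le1$ fixed). Assume each $J_k$ is convex (twice differentiable with uniformly bounded Hessian), at least one cost in each sub-network of group $S$ is strongly convex, the gradient noise satisfies the first- and fourth-order moment conditions in the context, and each $J_k$ satisfies the smoothness condition $\|\nabla_w^2J_k(w_k^\star+\Delta w)-\nabla_w^2J_k(w_k^\star)\|\le\kappa_d\|\Delta w\|$ for all $\|\Delta w\|\le\epsilon$, for some $\epsilon>0$, $\kappa_d\ge0$. Then, for sufficiently small step-sizes, for every agent $k$, $$\limsup_{i\to\infty}\|\mathbb{E}(w_k^\star-\boldsymbol{w}_{k,i})\|=O(\mu_{\max}),\qquad \limsup_{i\to\infty}\mathbb{E}\|w_k^\star-\boldsymbol{w}_{k,i}\|^4=O(\mu_{\max}^2).$$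
   Context: Network: $N$ agents partitioned into sub-networks $1,\dots,S+R$; agents of sub-networks $1,\dots,S$ (group $S$, $N_{gS}$ agents) numbered first, then those of $S+1,\dots,S+R$ (group $R$). Combination matrix $A=[a_{\ell k}]$ nonnegative, left-stochastic, $a_{\ell k}=0$ unless $\ell\in\mathcal{N}_k$ (neighborhood of $k$, containing $k$), of block form $A=\begin{bmatrix}T_{SS}&T_{SR}\\0&T_{RR}\end{bmatrix}$ with $T_{SS}=\mathrm{blockdiag}\{A_1,\dots,A_S\}$, each $A_s\in\mathbb{R}^{N_s\times N_s}$ left-stochastic primitive with Perron vector $p_s$ ($A_sp_s=p_s$, $\mathbb{1}^{\mathsf T}p_s=1$, $p_s\succ0$), and $T_{RR}$ block upper triangular with diagonal blocks $A_r$ ($r=S+1,\dots,S+R$), each the nonnegative irreducible matrix of internal weights of a connected sub-network receiving information from outside it (some column of $A_r$ sums to less than one). Let $W=T_{SR}(I-T_{RR})^{-1}$. Algorithm: $\boldsymbol{\psi}_{k,i}=\boldsymbol{w}_{k,i-1}-\mu_k\widehat{\nabla_{w^{\mathsf T}}J_k}(\boldsymbol{w}_{k,i-1})$, $\boldsymbol{w}_{k,i}=\sum_{\ell\in\mathcal{N}_k}a_{\ell k}\boldsymbol{\psi}_{\ell,i}$, with gradient noise $\boldsymbol{s}_{k,i}(\boldsymbol{w}_{k,i-1})=\widehat{\nabla_{w^{\mathsf T}}J_k}(\boldsymbol{w}_{k,i-1})-\nabla_{w^{\mathsf T}}J_k(\boldsymbol{w}_{k,i-1})$ and filtration $\mathcal{F}_{i-1}$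 generated by $\{\boldsymbol{w}_{\ell,j}:j\le i-1,\ \ell=1,\dots,N\}$. Limit points: for sub-network $s\le S$ with agents' step-sizes $\mu_{s,k}$ and costs $J_{s,k}$, $q_{s,k}=\mu_{s,k}p_{s,k}$ and $w_s^\star$ is the unique solution of $\sum_kq_{s,k}\nabla_{w^{\mathsf T}}J_{s,k}(w_s^\star)=0$; agents of sub-network $s$ have $w_k^\star=w_s^\star$. With $\omega^\star=\mathrm{col}\{\mathbb{1}_{N_1}\otimes w_1^\star,\dots,\mathbb{1}_{N_S}\otimes w_S^\star\}$, the group-$R$ limit points $w_k^\star$ (in agent order) are the $M$-blocks of $(W\otimes I_M)^{\mathsf T}\omega^\star$. Gradient noise conditions: $\mathbb{E}[\boldsymbol{s}_{k,i}\mid\mathcal{F}_{i-1}]=0$, noises of distinct agents conditionally uncorrelated given $\mathcal{F}_{i-1}$, $\mathbb{E}[\|\boldsymbol{s}_{k,i}\|^2\mid\mathcal{F}_{i-1}]\le\beta_k^2\|w_k^\star-\boldsymbol{w}_{k,i-1}\|^2+\sigma_k^2$ and $\mathbb{E}[\|\boldsymbol{s}_{k,i}\|^4\mid\mathcal{F}_{i-1}]\le\beta_{4,k}^2\|w_k^\star-\boldsymbol{w}_{k,i-1}\|^4+\sigma_{4,k}^2$ for constants $\beta_k,\sigma_k,\beta_{4,k},\sigma_{4,k}\ge0$. "For sufficiently small step-sizes, $X=O(\mu_{\max}^a)$" means $X\le c\mu_{\max}^a$ for all $\mu_{\max}<\bar\mu$ with $c,\bar\mu>0$ independent of $\mu_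{\max}$.
   Formalization: The initial iterates are additionally assumed to be measurable with finite fourth moment; without this the fourth-moment bound fails (one agent, quadratic cost, no noise, initial iterate with infinite fourth moment). *)

theory Defs
  imports "HOL-Probability.Probability" "Jordan_Normal_Form.Gauss_Jordan_Elimination"
begin

text \<open>Agents are 0,...,N-1; sub k in 1..S+R is the sub-network of agent k.\<close>

definition subnet :: "(nat \<Rightarrow> nat) \<Rightarrow> nat \<Rightarrow> nat \<Rightarrow> nat set" where
  "subnet sub N s = {k. k < N \<and> sub k = s}"

text \<open>Index of the first agent of sub-network s (agents are numbered by sub-network).\<close>
definition subnet_off :: "(nat \<Rightarrow> nat) \<Rightarrow> nat \<Rightarrow> nat \<Rightarrow> nat" where
  "subnet_off sub N s = card {k. k < N \<and> sub k < s}"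

definition blk :: "real mat \<Rightarrow> (nat \<Rightarrow> nat) \<Rightarrow> nat \<Rightarrow> nat \<Rightarrow> real mat" where
  "blk A sub N s = (let n = card (subnet sub N s); d = subnet_off sub N s
     in mat n n (\<lambda>(i,j). A $$ (d + i, d + j)))"

definition primitive_mat :: "real mat \<Rightarrow> bool" where
  "primitive_mat B = (\<exists>m. \<forall>i < dim_row B. \<forall>j < dim_col B. (B ^\<^sub>m m) $$ (i,j) > 0)"

definition irreducible_mat :: "real mat \<Rightarrow> bool" where
  "irreducible_mat B = (\<forall>i < dim_row B. \<forall>j < dim_col B. \<exists>m. (B ^\<^sub>m m) $$ (i,j) > 0)"

definition perron_vec :: "real mat \<Rightarrow> real vec" where
  "perron_vec B = (THE p. p \<in> carrier_vec (dim_row B) \<and> B *\<^sub>v p = p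
      \<and> (\<Sum>i<dim_row B. p $ i) = 1 \<and> (\<forall>i<dim_row B. p $ i > 0))"

definition wS :: "real mat \<Rightarrow> (nat \<Rightarrow> nat) \<Rightarrow> nat \<Rightarrow> (nat \<Rightarrow> real)
     \<Rightarrow> (nat \<Rightarrow> 'a::euclidean_space \<Rightarrow> 'a) \<Rightarrow> nat \<Rightarrow> 'a" where
  "wS A sub N \<mu> grad s = (THE w. (\<Sum>k\<in>subnet sub N s.
      (\<mu> k * perron_vec (blk A sub N s) $ (k - subnet_off sub N s)) *\<^sub>R grad k w) = 0)"

definition Wmat :: "real mat \<Rightarrow> nat \<Rightarrow> nat \<Rightarrow> real mat" where
  "Wmat A N NgS = (let NgR = N - NgS;
      TSR = mat NgS NgR (\<lambda>(i,j). A $$ (i, NgS + j));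
      TRR = mat NgR NgR (\<lambda>(i,j). A $$ (NgS + i, NgS + j))
    in TSR * the (mat_inverse (1\<^sub>m NgR - TRR)))"

definition lim_pt :: "real mat \<Rightarrow> (nat \<Rightarrow> nat) \<Rightarrow> nat \<Rightarrow> nat \<Rightarrow> (nat \<Rightarrow> real)
     \<Rightarrow> (nat \<Rightarrow> 'a::euclidean_space \<Rightarrow> 'a) \<Rightarrow> nat \<Rightarrow> 'a" where
  "lim_pt A sub N S \<mu> grad k = (let NgS = card {l. l < N \<and> sub l \<le> S} in
     if k < NgS then wS A sub N \<mu> grad (sub k)
     else (\<Sum>l<NgS. (Wmat A N NgS $$ (l, k - NgS)) *\<^sub>R wS A sub N \<mu> grad (sub l)))"

definition strongly_convex :: "('a::real_normed_vector \<Rightarrow> real) \<Rightarrow> bool" where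
  "strongly_convex f = (\<exists>\<nu>>0. \<forall>x y. \<forall>t\<in>{0..1}.
     f (t *\<^sub>R x + (1 - t) *\<^sub>R y) \<le> t * f x + (1 - t) * f y - \<nu> / 2 * t * (1 - t) * (norm (x - y))\<^sup>2)"

definition hist :: "'w measure \<Rightarrow> (nat \<Rightarrow> nat \<Rightarrow> 'w \<Rightarrow> 'a::topological_space) \<Rightarrow> nat \<Rightarrow> nat \<Rightarrow> 'w measure" where
  "hist M w N i = sigma (space M)
     {w l j -` B \<inter> space M | l j B. l < N \<and> j \<le> i \<and> B \<in> sets borel}"

text \<open>w k 0 is the initial iterate; w k (Suc i) is produced from w (.) i using the
  stochastic gradients gh l i = estimate of grad J_l at w l i. The gradient noise at
  step i is gh l i - grad l (w l i), conditioned on hist M w N i.\<close>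
definition atc_run :: "nat \<Rightarrow> real mat \<Rightarrow> (nat \<Rightarrow> real) \<Rightarrow> (nat \<Rightarrow> 'a::euclidean_space \<Rightarrow> 'a)
   \<Rightarrow> (nat \<Rightarrow> 'a) \<Rightarrow> (nat \<Rightarrow> real) \<Rightarrow> (nat \<Rightarrow> real) \<Rightarrow> (nat \<Rightarrow> real) \<Rightarrow> (nat \<Rightarrow> real)
   \<Rightarrow> 'w measure \<Rightarrow> (nat \<Rightarrow> nat \<Rightarrow> 'w \<Rightarrow> 'a) \<Rightarrow> (nat \<Rightarrow> nat \<Rightarrow> 'w \<Rightarrow> 'a) \<Rightarrow> bool" where
  "atc_run N A \<mu> grad wst \<beta> \<sigma> \<beta>4 \<sigma>4 M w gh \<longleftrightarrow>
     prob_space M \<and>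
     (\<forall>l<N. w l 0 \<in> borel_measurable M \<and> (\<integral>\<^sup>+\<omega>. ennreal (norm (w l 0 \<omega>) ^ 4) \<partial>M) < \<infinity>) \<and>
     (\<forall>l<N. \<forall>i. gh l i \<in> borel_measurable M) \<and>
     (\<forall>k<N. \<forall>i. \<forall>\<omega>\<in>space M.
        w k (Suc i) \<omega> = (\<Sum>l<N. A $$ (l,k) *\<^sub>R (w l i \<omega> - \<mu> l *\<^sub>R gh l i \<omega>))) \<and>
     (\<forall>l<N. \<forall>i. integrable M (\<lambda>\<omega>. gh l i \<omega> - grad l (w l i \<omega>)) \<and>
        (\<forall>b\<in>Basis. AE \<omega> in M.
           real_cond_exp M (hist M w N i) (\<lambda>\<omega>. (gh l i \<omega> - grad l (w l i \<omega>)) \<bullet> b) \<omega> = 0)) \<and>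
     (\<forall>l<N. \<forall>l'<N. l \<noteq> l' \<longrightarrow> (\<forall>i. \<forall>b\<in>Basis. \<forall>b'\<in>Basis.
        integrable M (\<lambda>\<omega>. ((gh l i \<omega> - grad l (w l i \<omega>)) \<bullet> b) * ((gh l' i \<omega> - grad l' (w l' i \<omega>)) \<bullet> b')) \<and>
        (AE \<omega> in M. real_cond_exp M (hist M w N i)
           (\<lambda>\<omega>. ((gh l i \<omega> - grad l (w l i \<omega>)) \<bullet> b) * ((gh l' i \<omega> - grad l' (w l' i \<omega>)) \<bullet> b')) \<omega> = 0))) \<and>
     (\<forall>l<N. \<forall>i. AE \<omega> in M.
        nn_cond_exp M (hist M w N i) (\<lambda>\<omega>. ennreal ((norm (gh l i \<omega> - grad l (w l i \<omega>)))\<^sup>2)) \<omega>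
          \<le> ennreal ((\<beta> l)\<^sup>2 * (norm (wst l - w l i \<omega>))\<^sup>2 + (\<sigma> l)\<^sup>2)) \<and>
     (\<forall>l<N. \<forall>i. AE \<omega> in M.
        nn_cond_exp M (hist M w N i) (\<lambda>\<omega>. ennreal (norm (gh l i \<omega> - grad l (w l i \<omega>)) ^ 4)) \<omega>
          \<le> ennreal ((\<beta>4 l)\<^sup>2 * norm (wst l - w l i \<omega>) ^ 4 + (\<sigma>4 l)\<^sup>2))"

end

theory Submission
  imports Defs "Jordan_Normal_Form.Determinant"
begin

text \<open>
  Since \<open>\<mu>\<^sub>k = \<tau>\<^sub>k \<mu>\<^sub>m\<^sub>a\<^sub>x\<close>, the limit points do not depend on \<open>\<mu>\<^sub>m\<^sub>a\<^sub>x\<close>. In a sub-network of group S the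
  iterates split into the Perron-weighted centroid error \<open>c\<close> and the disagreement, measured by a
  seminorm \<open>D\<close> that the combination step contracts by a factor \<open>r < 1\<close>. Convexity of \<open>t\<^sup>4\<close> gives
  \<open>E D'\<^sup>4 \<le> r E D\<^sup>4 + O(\<mu>\<^sup>4)\<close>, while the centroid performs a gradient step for a strongly monotone
  field plus a martingale difference, so that \<open>E \<bar>c'\<bar>\<^sup>4 \<le> (1 - a \<mu>) E \<bar>c\<bar>\<^sup>4 + O(\<mu>) E D\<^sup>4 + O(\<mu>\<^sup>3)\<close>.
  Hence \<open>E \<bar>c\<bar>\<^sup>4 = O(\<mu>\<^sup>2)\<close> and \<open>E D\<^sup>4 = O(\<mu>\<^sup>4)\<close>. In the mean the field is linear up to \<open>O(E \<bar>c\<bar>\<^sup>2)\<close>,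
  which is \<open>O(\<mu>)\<close>, and this yields the bias bound. Group R only averages what it receives: the
  internal weights contract a weighted \<open>\<ell>\<^sub>1\<close> norm because every agent leaks mass upstream, so its errors
  inherit the order of those of group S.
\<close>

section \<open>Recursions\<close>

text \<open>The constants must be chosen before the step-size, the probability space and the run.
  Hence the one-step inequalities are proved pathwise with constants of the network alone, and a run
  enters only through the integrals that \<open>noisy_agent\<close> controls. The contractions come
  without spectral decomposition. In group S the powers of a primitive block dominate a positive
  rank-one kernel that annihilates deviations from the Perron mean. In group R columns may still sum
  to one, so no standard norm contracts in one step; a truncated Neumann series supplies weights for
  which one does. The noise adds to the fourth moment of the centroid a term of order
  \<open>\<mu> ^ 2\<close> times a second moment of the drift. Young's inequality charges it to half
  of the contraction and leaves order \<open>\<mu> ^ 3\<close>, so no second-moment recursion is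
  run; lower moments are recovered from the fourth one at scale \<open>\<mu>\<close>. The noise is
  averaged out only in the centroid: the disagreement and group R contract at a fixed rate, where
  the triangle inequality loses no order in \<open>\<mu>\<close>.\<close>

lemma perturbed_contraction_power4:
  fixes x y r :: real
  assumes "0 \<le> r" "r < 1"
  shows "(r * x + y) ^ 4 \<le> r * x ^ 4 + y ^ 4 / (1 - r) ^ 3"
proof -
  have "convex_on UNIV (\<lambda>x::real. x ^ 4)"
    by (rule convex_power_even) simp
  \<comment> \<open>\<open>r * x + y\<close> is the convex combination of \<open>x\<close> and
    \<open>y / (1 - r)\<close> with weights \<open>r\<close> and \<open>1 - r\<close>; dividing
    \<open>y\<close> by its weight produces the cube.\<close>
  from convex_onD[OF this, of "1 - r" x "y / (1 - r)"] assms
  have "(r * x + (1 - r) * (y / (1 - r))) ^ 4 \<le> r * x ^ 4 + (1 - r) * (y / (1 - r)) ^ 4"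
    by (simp add: algebra_simps)
  also have "(1 - r) * (y / (1 - r)) ^ 4 = y ^ 4 / (1 - r) ^ 3"
    using assms by (simp add: power_divide eval_nat_numeral)
  finally show ?thesis using assms by simp
qed

text \<open>Cauchy-Schwarz used twice, on \<open>f\<close> and on its squares.\<close>

lemma sum_power4_le:
  fixes f :: "'i \<Rightarrow> real"
  shows "(\<Sum>i\<in>I. f i) ^ 4 \<le> real (card I) ^ 3 * (\<Sum>i\<in>I. f i ^ 4)"
proof -
  have "(\<Sum>i\<in>I. f i) ^ 4 = ((\<Sum>i\<in>I. f i)\<^sup>2)\<^sup>2" by simp
  also have "\<dots> \<le> (card I * (\<Sum>i\<in>I. (f i)\<^sup>2))\<^sup>2"
    using sum_squared_le_sum_of_squares[of f I] by (intro power_mono) (auto simp: mult.commute)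
  also have "\<dots> = (real (card I))\<^sup>2 * (\<Sum>i\<in>I. (f i)\<^sup>2)\<^sup>2"
    by (simp add: power_mult_distrib)
  also have "\<dots> \<le> (real (card I))\<^sup>2 * (card I * (\<Sum>i\<in>I. ((f i)\<^sup>2)\<^sup>2))"
    using sum_squared_le_sum_of_squares[of "\<lambda>i. (f i)\<^sup>2" I]
    by (intro mult_left_mono) (auto simp: mult.commute)
  finally show ?thesis by (simp add: eval_nat_numeral ac_simps)
qed

lemma add_power4_le:
  fixes x y :: real shows "(x + y) ^ 4 \<le> 8 * (x ^ 4 + y ^ 4)"
  using sum_power4_le[of "\<lambda>b. if b then x else y" UNIV] by (simp add: UNIV_bool add.commute)

text \<open>The affine map has fixed point \<open>b / (1 - r)\<close> and the transient decays
  geometrically, so twice the fixed point is eventually an upper bound whatever the start. The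
  recursion is assumed only eventually, so that it can rest on quantities that must settle
  beforehand.\<close>

lemma affine_recursion_eventually:
  fixes x :: "nat \<Rightarrow> real"
  assumes "0 \<le> r" "r < 1" "0 < b"
    and rec: "eventually (\<lambda>i. x (Suc i) \<le> r * x i + b) sequentially"
  shows "eventually (\<lambda>i. x i \<le> 2 * b / (1 - r)) sequentially"
proof -
  define L where "L = b / (1 - r)"
  have L: "L = r * L + b" using assms by (simp add: L_def field_simps)
  have Lpos: "L > 0" using assms by (simp add: L_def)
  obtain i0 where i0: "\<And>i. i \<ge> i0 \<Longrightarrow> x (Suc i) \<le> r * x i + b"
    using rec by (auto simp: eventually_sequentially)
  have bd: "x (i0 + j) \<le> L + r ^ j * \<bar>x i0\<bar>" for j
  proof (induction j)
    case 0 show ?case using Lpos by simp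
  next
    case (Suc j)
    have "x (i0 + Suc j) \<le> r * x (i0 + j) + b" using i0[of "i0 + j"] by simp
    also have "\<dots> \<le> r * (L + r ^ j * \<bar>x i0\<bar>) + b"
      using Suc assms by (intro add_right_mono mult_left_mono) auto
    also have "\<dots> = L + r ^ Suc j * \<bar>x i0\<bar>" using L by (simp add: algebra_simps)
    finally show ?case .
  qed
  have "(\<lambda>j. r ^ j * \<bar>x i0\<bar>) \<longlonglongrightarrow> 0 * \<bar>x i0\<bar>"
    using assms by (intro tendsto_mult LIMSEQ_realpow_zero tendsto_const) auto
  then have "eventually (\<lambda>j. r ^ j * \<bar>x i0\<bar> < L) sequentially"
    using Lpos order_tendstoD(2) by fastforce
  then have "eventually (\<lambda>j. x (j + i0) \<le> 2 * L) sequentially"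
  proof eventually_elim
    case (elim j) then show ?case using bd[of j] by (simp add: add.commute)
  qed
  then have "eventually (\<lambda>i. x i \<le> 2 * L) sequentially"
    by (subst (asm) eventually_sequentially_seg[where P = "\<lambda>i. x i \<le> 2 * L"])
  then show ?thesis by (simp add: L_def)
qed

text \<open>The Lyapunov function \<open>X + H * \<mu> * Y\<close>, with \<open>H\<close> large enough to absorb the coupling
  term \<open>K * \<mu> * Y\<close>, contracts at rate \<open>1 - a * \<mu> / 2\<close>.\<close>

lemma coupled_recursion_eventually:
  fixes a K r :: real
  assumes a: "0 < a" and K: "0 < K" and r: "0 \<le> r" "r < 1"
  shows "\<exists>C \<mu>0. 0 < C \<and> 0 < \<mu>0 \<and> \<mu>0 \<le> 1 \<and> (\<forall>\<mu> (X :: nat \<Rightarrow> real) Y. 0 < \<mu> \<and> \<mu> < \<mu>0 \<and>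
     (\<forall>i. 0 \<le> X i \<and> 0 \<le> Y i \<and>
        X (Suc i) \<le> (1 - a * \<mu>) * X i + K * \<mu> * Y i + K * \<mu>\<^sup>2 * (X i + Y i) + K * \<mu> ^ 3 \<and>
        Y (Suc i) \<le> r * Y i + K * \<mu> ^ 4 * (1 + X i + Y i)) \<longrightarrow>
     eventually (\<lambda>i. X i \<le> C * \<mu>\<^sup>2 \<and> Y i \<le> C * \<mu> ^ 4) sequentially)"
proof -
  \<comment> \<open>Of the gap \<open>H * (1 - r) = 4 * K\<close>, one half pays for the coupling
    \<open>K\<close> and for the \<open>\<mu> ^ 2\<close> terms, which cost at most another
    \<open>K\<close>; the other half pays for the loss \<open>a * \<mu> / 2\<close> that the rate
    demands.\<close>
  define H where "H = 4 * K / (1 - r)"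
  have H: "H > 0" "H * (1 - r) = 4 * K" using K r by (auto simp: H_def)
  define C1 where "C1 = 4 * (K + H * K) / a"
  have C1: "C1 > 0" unfolding C1_def using a K H by (intro divide_pos_pos mult_pos_pos add_pos_pos) auto
  define C where "C = max C1 (4 * K * (1 + C1) / (1 - r))"
  \<comment> \<open>Each entry serves one absorption: the second keeps the quadratic terms in
    \<open>X\<close> below half the contraction, the third makes the feedback of \<open>Y\<close> on
    itself at most half its gap, the fourth lets \<open>Y\<close> decay no slower than the Lyapunov
    rate, the fifth keeps that rate nonnegative, and the last bounds the quadratic terms in
    \<open>Y\<close> by \<open>K\<close>.\<close>
  define \<mu>0 where "\<mu>0 = Min {1, a / (2 * (K + H * K)), (1 - r) / (2 * K), (1 - r) / a, 1 / a, K / (K + H * K)}"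
  have pos: "\<mu>0 > 0" using a K r H by (auto simp: \<mu>0_def add_pos_pos)
  have le1: "\<mu>0 \<le> 1" by (simp add: \<mu>0_def)
  have "eventually (\<lambda>i. X i \<le> C * \<mu>\<^sup>2 \<and> Y i \<le> C * \<mu> ^ 4) sequentially"
    if \<mu>: "0 < \<mu>" "\<mu> < \<mu>0" and nn: "\<And>i. 0 \<le> X i" "\<And>i. 0 \<le> Y i"
      and X: "\<And>i. X (Suc i) \<le> (1 - a * \<mu>) * X i + K * \<mu> * Y i + K * \<mu>\<^sup>2 * (X i + Y i) + K * \<mu> ^ 3"
      and Y: "\<And>i. Y (Suc i) \<le> r * Y i + K * \<mu> ^ 4 * (1 + X i + Y i)"
    for \<mu> and X Y :: "nat \<Rightarrow> real"
  proof -
    have m1: "\<mu> \<le> 1" using \<mu> le1 by simp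
    have KH: "K + H * K > 0" using K H by (simp add: add_pos_pos)
    have "\<mu> < a / (2 * (K + H * K))" using \<mu> by (simp add: \<mu>0_def)
    then have ma: "\<mu> * (K + H * K) \<le> a / 2"
      using KH by (simp add: pos_less_divide_eq algebra_simps)
    have "\<mu> < (1 - r) / (2 * K)" "\<mu> < (1 - r) / a" "\<mu> < 1 / a" "\<mu> < K / (K + H * K)"
      using \<mu> by (simp_all add: \<mu>0_def)
    then have mr: "K * \<mu> \<le> (1 - r) / 2" "a * \<mu> \<le> 1 - r" "a * \<mu> \<le> 1"
      and mK: "\<mu> * (K + H * K) \<le> K"
      using K a KH by (simp_all add: pos_less_divide_eq algebra_simps)
    define V where "V i = X i + H * \<mu> * Y i" for i
    have p: "\<mu> ^ 5 \<le> \<mu>\<^sup>2" "\<mu> ^ 5 \<le> \<mu> ^ 3" "\<mu> ^ 4 \<le> \<mu>"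
      using power_decreasing[of 2 5 \<mu>] power_decreasing[of 3 5 \<mu>] power_decreasing[of 1 4 \<mu>] \<mu> m1
      by auto
    have V: "V (Suc i) \<le> (1 - a * \<mu> / 2) * V i + (K + H * K) * \<mu> ^ 3" for i
    proof -
      have "H * \<mu> * Y (Suc i) \<le> H * \<mu> * (r * Y i + K * \<mu> ^ 4 * (1 + X i + Y i))"
        using H \<mu> Y by (intro mult_left_mono) auto
      also have "\<dots> = H * \<mu> * r * Y i + H * K * (\<mu> ^ 5 * (X i + Y i)) + H * K * \<mu> ^ 5"
        by (simp add: algebra_simps eval_nat_numeral)
      also have "\<dots> \<le> H * \<mu> * r * Y i + H * K * (\<mu>\<^sup>2 * (X i + Y i)) + H * K * \<mu> ^ 3"
        using H K p nn by (intro add_mono mult_left_mono mult_right_mono order_refl) auto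
      finally have "V (Suc i) \<le> (1 - a * \<mu>) * X i + K * \<mu> * Y i + H * \<mu> * r * Y i
          + (\<mu> * (K + H * K)) * (\<mu> * X i) + (\<mu> * (K + H * K)) * (\<mu> * Y i) + (K + H * K) * \<mu> ^ 3"
        unfolding V_def using X[of i] by (simp add: algebra_simps power2_eq_square)
      also have "\<dots> \<le> (1 - a * \<mu>) * X i + K * \<mu> * Y i + H * \<mu> * r * Y i
          + a / 2 * (\<mu> * X i) + K * (\<mu> * Y i) + (K + H * K) * \<mu> ^ 3"
        using ma mK \<mu> nn[of i] by (intro add_mono mult_right_mono order_refl) auto
      also have "\<dots> = (1 - a * \<mu> / 2) * X i + (2 * K + H * r) * (\<mu> * Y i) + (K + H * K) * \<mu> ^ 3"
        by (simp add: algebra_simps)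
      also have "2 * K + H * r \<le> (1 - a * \<mu> / 2) * H"
      proof -
        have "2 * K = H * (1 - r) / 2" using H by simp
        moreover have "H * (a * \<mu> / 2) \<le> H * ((1 - r) / 2)"
          using H mr by (intro mult_left_mono) auto
        ultimately show ?thesis by (simp add: algebra_simps)
      qed
      also have "(1 - a * \<mu> / 2) * X i + (1 - a * \<mu> / 2) * H * (\<mu> * Y i) = (1 - a * \<mu> / 2) * V i"
        by (simp add: V_def algebra_simps)
      finally show ?thesis using \<mu> nn by (simp add: mult_right_mono)
    qed
    have "eventually (\<lambda>i. V i \<le> 2 * ((K + H * K) * \<mu> ^ 3) / (1 - (1 - a * \<mu> / 2))) sequentially"
      using a \<mu> KH mr V by (intro affine_recursion_eventually) auto
    moreover have "2 * ((K + H * K) * \<mu> ^ 3) / (1 - (1 - a * \<mu> / 2)) = C1 * \<mu>\<^sup>2"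
      using a \<mu> by (simp add: C1_def field_simps eval_nat_numeral)
    ultimately have ev: "eventually (\<lambda>i. V i \<le> C1 * \<mu>\<^sup>2) sequentially" by simp
    have XV: "X i \<le> V i" for i using H \<mu> nn by (simp add: V_def)
    have evX: "eventually (\<lambda>i. X i \<le> C1 * \<mu>\<^sup>2) sequentially"
      using ev by eventually_elim (use XV order_trans in blast)
    \<comment> \<open>The Lyapunov bound alone would give \<open>Y\<close> only at order
      \<open>\<mu>\<close>. Once \<open>X\<close> has settled, the forcing in the recursion of
      \<open>Y\<close> is of order \<open>\<mu> ^ 4\<close>, and a second pass recovers that order
      at the rate \<open>(1 + r) / 2\<close>.\<close>
    have evY: "eventually (\<lambda>i. Y i \<le> 2 * (K * (1 + C1) * \<mu> ^ 4) / (1 - (1 + r) / 2)) sequentially"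
    proof (rule affine_recursion_eventually)
      show "\<forall>\<^sub>F i in sequentially. Y (Suc i) \<le> (1 + r) / 2 * Y i + K * (1 + C1) * \<mu> ^ 4"
        using evX
      proof eventually_elim
        case (elim i)
        have m2: "\<mu>\<^sup>2 \<le> 1" using \<mu> m1 by (simp add: power_le_one)
        have "X i \<le> C1 * 1" using elim mult_left_mono[OF m2, of C1] C1 by linarith
        then have "K * \<mu> ^ 4 * X i \<le> K * \<mu> ^ 4 * C1" using K by (intro mult_left_mono) auto
        moreover have "K * \<mu> ^ 4 * Y i \<le> (1 - r) / 2 * Y i"
        proof (intro mult_right_mono nn)
          have "K * \<mu> ^ 4 \<le> K * \<mu>" using p K by simp
          then show "K * \<mu> ^ 4 \<le> (1 - r) / 2" using mr by simp
        qed
        ultimately show ?case using Y[of i] by (simp add: algebra_simps add_divide_distrib diff_divide_distrib)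
      qed
    qed (use r K C1 \<mu> in auto)
    have "2 * (K * (1 + C1) * \<mu> ^ 4) / (1 - (1 + r) / 2) = 4 * K * (1 + C1) / (1 - r) * \<mu> ^ 4"
      using r by (simp add: field_simps)
    also have "\<dots> \<le> C * \<mu> ^ 4" by (intro mult_right_mono) (auto simp: C_def)
    finally have Yb: "2 * (K * (1 + C1) * \<mu> ^ 4) / (1 - (1 + r) / 2) \<le> C * \<mu> ^ 4" .
    have C1C: "C1 * \<mu>\<^sup>2 \<le> C * \<mu>\<^sup>2" by (intro mult_right_mono) (auto simp: C_def)
    show ?thesis using evX evY
    proof eventually_elim
      case (elim i)
      show ?case using order_trans[OF elim(1) C1C] order_trans[OF elim(2) Yb] by blast
    qed
  qed
  note main = this
  have "C > 0" using C1 by (simp add: C_def)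
  then show ?thesis using pos le1
    by (intro exI[of _ C] exI[of _ \<mu>0] conjI allI impI main) simp_all
qed

section \<open>Stochastic and leaky nonnegative matrices\<close>

text \<open>Matrix powers for a kernel given as a function, so that a diagonal block of
  \<open>A\<close> is obtained by shifting indices instead of building a submatrix.\<close>

fun kpow :: "nat \<Rightarrow> (nat \<Rightarrow> nat \<Rightarrow> real) \<Rightarrow> nat \<Rightarrow> nat \<Rightarrow> nat \<Rightarrow> real" where
  "kpow n a 0 l k = (if l = k then 1 else 0)"
| "kpow n a (Suc j) l k = (\<Sum>i<n. kpow n a j l i * a i k)"

lemma pow_mat_eq_kpow:
  assumes "B \<in> carrier_mat n n" "l < n" "k < n"
  shows "(B ^\<^sub>m j) $$ (l, k) = kpow n (\<lambda>i j. B $$ (i, j)) j l k"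
  using assms(2,3)
proof (induction j arbitrary: l k)
  case 0 then show ?case using assms(1) by simp
next
  case (Suc j)
  have "B ^\<^sub>m j \<in> carrier_mat n n" using assms(1) by simp
  with Suc assms(1) show ?case
    by (auto simp: scalar_prod_def lessThan_atLeast0 intro!: sum.cong)
qed

lemma kpow_Suc_left:
  assumes "l < n" "k < n"
  shows "kpow n a (Suc j) l k = (\<Sum>i<n. a l i * kpow n a j i k)"
  using assms(2)
proof (induction j arbitrary: k)
  case 0
  then show ?case using assms(1) by (simp add: mult_delta_left mult_delta_right)
next
  case (Suc j)
  have "kpow n a (Suc (Suc j)) l k = (\<Sum>i<n. (\<Sum>h<n. a l h * kpow n a j h i) * a i k)"
    unfolding kpow.simps(2)[of n a "Suc j"]
    by (intro sum.cong refl arg_cong2[where f = "(*)"] Suc.IH) auto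
  also have "\<dots> = (\<Sum>h<n. a l h * kpow n a (Suc j) h k)"
    unfolding kpow.simps(2) sum_distrib_left sum_distrib_right
    by (subst sum.swap) (simp add: ac_simps)
  finally show ?case .
qed

lemma kpow_nonneg:
  assumes "\<And>l k. l < n \<Longrightarrow> k < n \<Longrightarrow> 0 \<le> a l k" "k < n"
  shows "0 \<le> kpow n a j l k"
  using assms(2) by (induction j arbitrary: k) (auto intro!: sum_nonneg mult_nonneg_nonneg assms(1))

lemma kpow_left_fixed:
  assumes "\<And>k. k < n \<Longrightarrow> (\<Sum>l<n. v l * a l k) = v k" "k < n"
  shows "(\<Sum>l<n. v l * kpow n a j l k) = v k"
  using assms(2)
proof (induction j arbitrary: k)
  case 0
  then show ?case by (simp add: mult_delta_right)
next
  case (Suc j)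
  have "(\<Sum>l<n. v l * kpow n a (Suc j) l k) = (\<Sum>i<n. (\<Sum>l<n. v l * kpow n a j l i) * a i k)"
    unfolding kpow.simps(2) sum_distrib_left sum_distrib_right
    by (subst sum.swap) (simp add: ac_simps)
  also have "\<dots> = (\<Sum>i<n. v i * a i k)" using Suc.IH by simp
  finally show ?case using assms(1) Suc.prems by simp
qed

lemma kpow_right_fixed:
  assumes "\<And>l. l < n \<Longrightarrow> (\<Sum>k<n. a l k * v k) = v l" "l < n"
  shows "(\<Sum>k<n. kpow n a j l k * v k) = v l"
proof (induction j)
  case 0
  show ?case using assms(2) by (simp add: mult_delta_left)
next
  case (Suc j)
  have "(\<Sum>k<n. kpow n a (Suc j) l k * v k) = (\<Sum>i<n. kpow n a j l i * (\<Sum>k<n. a i k * v k))"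
    unfolding kpow.simps(2) sum_distrib_left sum_distrib_right
    by (subst sum.swap) (simp add: ac_simps)
  also have "\<dots> = (\<Sum>i<n. kpow n a j l i * v i)" using assms(1) by simp
  finally show ?case using Suc.IH by simp
qed

text \<open>A column that sums to one has a positive entry, so a positive power stays positive when
  one more factor is appended.\<close>

lemma kpow_pos_Suc:
  assumes nn: "\<And>l k. l < n \<Longrightarrow> k < n \<Longrightarrow> 0 \<le> a l k" and "\<And>k. k < n \<Longrightarrow> (\<Sum>l<n. a l k) = 1"
    and pos: "\<And>l k. l < n \<Longrightarrow> k < n \<Longrightarrow> 0 < kpow n a m l k" and "l < n" "k < n"
  shows "0 < kpow n a (Suc m) l k"
proof -
  have "\<exists>i<n. a i k \<noteq> 0"
    using assms(2)[OF assms(5)] by (metis (no_types, lifting) lessThan_iff sum.neutral zero_neq_one)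
  then obtain i where i: "i < n" "a i k > 0" using nn assms(5) by force
  have "0 < kpow n a m l i * a i k" using i pos assms by simp
  also have "\<dots> \<le> (\<Sum>i<n. kpow n a m l i * a i k)"
    using i nn pos assms(4,5)
    by (intro member_le_sum[where f = "\<lambda>i. kpow n a m l i * a i k"])
      (auto intro!: mult_nonneg_nonneg intro: less_imp_le)
  finally show ?thesis by simp
qed

text \<open>The constant \<open>c\<close> bounds the powers from below by a positive rank-one kernel; subtracting
  it loses nothing on vectors \<open>y\<close> of total mass zero.\<close>

lemma kpow_fixed_massless_zero:
  fixes y :: "nat \<Rightarrow> real"
  assumes fix_p: "\<And>l. l < n \<Longrightarrow> (\<Sum>k<n. a l k * y k) = y l" and y0: "(\<Sum>k<n. y k) = 0"
    and colsum: "\<And>k. k < n \<Longrightarrow> (\<Sum>l<n. a l k) = 1"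
    and pos: "\<And>l k. l < n \<Longrightarrow> k < n \<Longrightarrow> 0 < kpow n a m l k" and "l < n"
  shows "y l = 0"
proof -
  have n: "n > 0" using \<open>l < n\<close> by simp
  define c where "c = Min ((\<lambda>(l, k). kpow n a m l k) ` ({..<n} \<times> {..<n}))"
  have c: "c > 0" using pos n unfolding c_def by (subst Min_gr_iff) auto
  have cle: "c \<le> kpow n a m l k" if "l < n" "k < n" for l k
    unfolding c_def using that by (intro Min_le) auto
  have y: "\<bar>y l\<bar> \<le> (\<Sum>k<n. (kpow n a m l k - c) * \<bar>y k\<bar>)" if "l < n" for l
  proof -
    have "y l = (\<Sum>k<n. kpow n a m l k * y k)" using kpow_right_fixed[OF fix_p that] by simp
    also have "\<dots> = (\<Sum>k<n. (kpow n a m l k - c) * y k)"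
      using y0 by (simp add: algebra_simps sum_subtractf flip: sum_distrib_left)
    finally have "\<bar>y l\<bar> \<le> (\<Sum>k<n. \<bar>(kpow n a m l k - c) * y k\<bar>)" by (simp add: sum_abs)
    also have "\<dots> = (\<Sum>k<n. (kpow n a m l k - c) * \<bar>y k\<bar>)"
      using cle that by (intro sum.cong) (auto simp: abs_mult)
    finally show ?thesis .
  qed
  have one: "(\<Sum>l<n. kpow n a m l k) = 1" if "k < n" for k
    using kpow_left_fixed[of n "\<lambda>_. 1" a k m] colsum that by simp
  \<comment> \<open>The columns of the reduced kernel sum to \<open>1 - n * c\<close>, so the l1
    norm of the fixed vector \<open>y\<close> would have to shrink by that factor.\<close>
  have "(\<Sum>l<n. \<bar>y l\<bar>) \<le> (\<Sum>l<n. \<Sum>k<n. (kpow n a m l k - c) * \<bar>y k\<bar>)"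
    by (intro sum_mono y) auto
  also have "\<dots> = (\<Sum>k<n. (\<Sum>l<n. kpow n a m l k - c) * \<bar>y k\<bar>)"
    by (subst sum.swap) (simp add: sum_distrib_right)
  also have "\<dots> = (\<Sum>k<n. (1 - n * c) * \<bar>y k\<bar>)"
    by (intro sum.cong refl) (simp add: sum_subtractf one)
  finally have "n * c * (\<Sum>l<n. \<bar>y l\<bar>) \<le> 0" by (simp add: left_diff_distrib sum_subtractf mult.assoc flip: sum_distrib_left)
  then have "(\<Sum>l<n. \<bar>y l\<bar>) \<le> 0" using n c by (simp add: mult_le_0_iff)
  moreover have "\<bar>y l\<bar> \<le> (\<Sum>l<n. \<bar>y l\<bar>)" using \<open>l < n\<close> by (intro member_le_sum) auto
  ultimately show ?thesis by simp
qed

text \<open>\<open>perron_vec\<close> is a definite description, so both existence and uniqueness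
  are at stake. The all-ones vector lies in the kernel of the transpose of \<open>B - 1\<close>,
  hence \<open>B - 1\<close> is singular and \<open>B\<close> fixes some \<open>v\<close>; the
  normalised absolute values of \<open>v\<close> are the Perron vector. The difference of two
  candidates is fixed and has total mass zero, hence vanishes.\<close>

lemma perron_vec_left_stochastic:
  fixes B :: "real mat"
  assumes B: "B \<in> carrier_mat n n" and n: "0 < n"
    and nn: "\<And>l k. l < n \<Longrightarrow> k < n \<Longrightarrow> 0 \<le> B $$ (l, k)"
    and colsum: "\<And>k. k < n \<Longrightarrow> (\<Sum>l<n. B $$ (l, k)) = 1"
    and pos: "\<And>l k. l < n \<Longrightarrow> k < n \<Longrightarrow> 0 < kpow n (\<lambda>i j. B $$ (i, j)) m l k"
  shows "(\<Sum>k<n. perron_vec B $ k) = 1" "\<And>k. k < n \<Longrightarrow> 0 < perron_vec B $ k"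
    "\<And>l. l < n \<Longrightarrow> (\<Sum>k<n. B $$ (l, k) * perron_vec B $ k) = perron_vec B $ l"
proof -
  let ?a = "\<lambda>i j. B $$ (i, j)"
  let ?P = "\<lambda>p. p \<in> carrier_vec (dim_row B) \<and> B *\<^sub>v p = p
      \<and> (\<Sum>i<dim_row B. p $ i) = 1 \<and> (\<forall>i<dim_row B. p $ i > 0)"
  have mv: "(B *\<^sub>v p) $ l = (\<Sum>k<n. B $$ (l, k) * p $ k)" if "p \<in> carrier_vec n" "l < n" for p l
    using B that by (auto simp: scalar_prod_def lessThan_atLeast0 intro!: sum.cong)
  define C where "C = B - 1\<^sub>m n"
  have C: "C \<in> carrier_mat n n" unfolding C_def by (rule minus_carrier_mat) simp
  have "C\<^sup>T *\<^sub>v vec n (\<lambda>_. 1) = 0\<^sub>v n"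
  proof (rule eq_vecI)
    fix k assume "k < dim_vec (0\<^sub>v n)"
    then have k: "k < n" by simp
    have "(C\<^sup>T *\<^sub>v vec n (\<lambda>_. 1)) $ k = (\<Sum>l<n. B $$ (l, k) - (if l = k then 1 else 0))"
      using B C k by (auto simp: scalar_prod_def lessThan_atLeast0 C_def intro!: sum.cong)
    then show "(C\<^sup>T *\<^sub>v vec n (\<lambda>_. 1)) $ k = 0\<^sub>v n $ k" using k colsum by (simp add: sum_subtractf)
  qed (use C in simp)
  moreover have "vec n (\<lambda>_. 1) \<noteq> (0\<^sub>v n :: real vec)"
    using n by (metis index_vec index_zero_vec(1) zero_neq_one)
  ultimately have "Determinant.det C\<^sup>T = 0"
    using det_0_iff_vec_prod_zero[of "C\<^sup>T" n] C by (metis transpose_carrier_mat vec_carrier)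
  then have "Determinant.det C = 0" using det_transpose[OF C] by simp
  then obtain v where v: "v \<in> carrier_vec n" "v \<noteq> 0\<^sub>v n" "C *\<^sub>v v = 0\<^sub>v n"
    using det_0_iff_vec_prod_zero[OF C] by auto
  have fix_v: "(\<Sum>k<n. B $$ (l, k) * v $ k) = v $ l" if "l < n" for l
  proof -
    have "B *\<^sub>v v - v = 0\<^sub>v n"
      using v B by (simp add: C_def minus_mult_distrib_mat_vec)
    then have "(B *\<^sub>v v - v) $ l = 0" using that by simp
    then show ?thesis using mv[OF v(1) that] v(1) that by simp
  qed
  text \<open>The columns sum to one, so the termwise inequality \<open>\<bar>v\<bar> \<le> B \<bar>v\<bar>\<close> must be an equality.\<close>
  have abs_le: "\<bar>v $ l\<bar> \<le> (\<Sum>k<n. B $$ (l, k) * \<bar>v $ k\<bar>)" if "l < n" for l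
  proof -
    have "\<bar>v $ l\<bar> \<le> (\<Sum>k<n. \<bar>B $$ (l, k) * v $ k\<bar>)" using fix_v[OF that] by (metis sum_abs)
    also have "\<dots> = (\<Sum>k<n. B $$ (l, k) * \<bar>v $ k\<bar>)"
      using nn that by (intro sum.cong) (auto simp: abs_mult)
    finally show ?thesis .
  qed
  have "(\<Sum>l<n. \<Sum>k<n. B $$ (l, k) * \<bar>v $ k\<bar>) = (\<Sum>k<n. (\<Sum>l<n. B $$ (l, k)) * \<bar>v $ k\<bar>)"
    by (subst sum.swap) (simp add: sum_distrib_right)
  also have "\<dots> = (\<Sum>l<n. \<bar>v $ l\<bar>)" using colsum by simp
  finally have "(\<Sum>l<n. (\<Sum>k<n. B $$ (l, k) * \<bar>v $ k\<bar>) - \<bar>v $ l\<bar>) = 0"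
    by (simp add: sum_subtractf)
  then have fix_abs: "(\<Sum>k<n. B $$ (l, k) * \<bar>v $ k\<bar>) = \<bar>v $ l\<bar>" if "l < n" for l
    using abs_le that by (subst (asm) sum_nonneg_eq_0_iff) auto
  obtain k0 where k0: "k0 < n" "v $ k0 \<noteq> 0" using v by (metis carrier_vecD eq_vecI index_zero_vec)
  \<comment> \<open>The vector of absolute values is fixed by every power, and the positive power
    carries the nonzero entry at \<open>k0\<close> to every index.\<close>
  have abs_pos: "\<bar>v $ l\<bar> > 0" if l: "l < n" for l
  proof -
    have "0 < kpow n ?a m l k0 * \<bar>v $ k0\<bar>" using pos k0 l by simp
    also have "\<dots> \<le> (\<Sum>k<n. kpow n ?a m l k * \<bar>v $ k\<bar>)"
      using k0 l pos by (intro member_le_sum[where f = "\<lambda>k. kpow n ?a m l k * \<bar>v $ k\<bar>"])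
        (auto intro!: mult_nonneg_nonneg intro: less_imp_le)
    also have "\<dots> = \<bar>v $ l\<bar>" by (rule kpow_right_fixed[OF fix_abs l])
    finally show ?thesis .
  qed
  define s where "s = (\<Sum>k<n. \<bar>v $ k\<bar>)"
  have s: "s > 0" unfolding s_def using n abs_pos by (intro sum_pos) auto
  define q where "q = vec n (\<lambda>k. \<bar>v $ k\<bar> / s)"
  have "?P q"
  proof (intro conjI allI impI)
    show "B *\<^sub>v q = q"
    proof (rule eq_vecI)
      fix l assume "l < dim_vec q"
      then have l: "l < n" by (simp add: q_def)
      have "(B *\<^sub>v q) $ l = (\<Sum>k<n. B $$ (l, k) * (\<bar>v $ k\<bar> / s))"
        using l by (subst mv) (auto simp: q_def)
      also have "\<dots> = (\<Sum>k<n. B $$ (l, k) * \<bar>v $ k\<bar>) / s" by (simp add: sum_divide_distrib)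
      finally show "(B *\<^sub>v q) $ l = q $ l" using l fix_abs by (simp add: q_def)
    qed (use B in \<open>simp add: q_def\<close>)
    show "(\<Sum>i<dim_row B. q $ i) = 1"
      using B s by (simp add: q_def flip: sum_divide_distrib) (simp add: s_def)
  qed (use B s abs_pos in \<open>auto simp: q_def\<close>)
  moreover have "p = q" if "?P p" for p
  proof -
    have "p $ l - q $ l = 0" if "l < n" for l
    proof (rule kpow_fixed_massless_zero[where a = ?a and m = m and n = n and y = "\<lambda>l. p $ l - q $ l"])
      fix l assume l: "l < n"
      have "(\<Sum>k<n. B $$ (l, k) * p $ k) = p $ l" "(\<Sum>k<n. B $$ (l, k) * q $ k) = q $ l"
        using mv[of p l] mv[of q l] B l \<open>?P p\<close> \<open>?P q\<close> by simp_all
      then show "(\<Sum>k<n. B $$ (l, k) * (p $ k - q $ k)) = p $ l - q $ l"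
        by (simp add: right_diff_distrib sum_subtractf)
    qed (use colsum pos that \<open>?P p\<close> \<open>?P q\<close> B in \<open>auto simp: sum_subtractf\<close>)
    then show ?thesis using \<open>?P p\<close> \<open>?P q\<close> B by (intro eq_vecI) auto
  qed
  ultimately have "?P (perron_vec B)" unfolding perron_vec_def by (rule theI)
  then have P: "?P (perron_vec B)" .
  then show "(\<Sum>k<n. perron_vec B $ k) = 1" "\<And>k. k < n \<Longrightarrow> 0 < perron_vec B $ k" using B by auto
  fix l assume "l < n"
  then show "(\<Sum>k<n. B $$ (l, k) * perron_vec B $ k) = perron_vec B $ l"
    using P mv[of "perron_vec B" l] B by simp
qed

section \<open>Contraction of the disagreement by averaging\<close>

text \<open>The seminorm sums the \<open>p\<close>-weighted deviations from the \<open>p\<close>-mean along \<open>m\<close> consecutive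
  applications of the averaging map, so that one application trades the first summand for the last.\<close>

lemma consensus_seminorm:
  fixes a :: "nat \<Rightarrow> nat \<Rightarrow> real" and p :: "nat \<Rightarrow> real"
  assumes nn: "\<And>l k. l < n \<Longrightarrow> k < n \<Longrightarrow> 0 \<le> a l k"
    and colsum: "\<And>k. k < n \<Longrightarrow> (\<Sum>l<n. a l k) = 1"
    and p_pos: "\<And>k. k < n \<Longrightarrow> 0 < p k" and p_sum: "(\<Sum>k<n. p k) = 1"
    and p_fix: "\<And>l. l < n \<Longrightarrow> (\<Sum>k<n. a l k * p k) = p l"
    and m: "0 < m" and pos: "\<And>l k. l < n \<Longrightarrow> k < n \<Longrightarrow> 0 < kpow n a m l k"
  obtains D :: "(nat \<Rightarrow> 'a::euclidean_space) \<Rightarrow> real" and K r :: real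
  where "0 \<le> r" "r < 1" "1 \<le> K" "\<And>x. 0 \<le> D x"
    "\<And>x. D (\<lambda>k. \<Sum>l<n. a l k *\<^sub>R x l) \<le> r * D x"
    "\<And>x y. D (\<lambda>k. x k + y k) \<le> D x + D y"
    "\<And>x k. k < n \<Longrightarrow> norm (x k - (\<Sum>l<n. p l *\<^sub>R x l)) \<le> K * D x"
    "\<And>x. D x \<le> K * (\<Sum>l<n. norm (x l))"
    "\<And>x (N :: 'w measure). (\<And>l. l < n \<Longrightarrow> x l \<in> borel_measurable N) \<Longrightarrow>
       (\<lambda>\<omega>. D (\<lambda>l. x l \<omega>)) \<in> borel_measurable N"
proof -
  have n: "n > 0" using p_sum by (cases n) auto
  have p1: "p k \<le> 1" if "k < n" for k
    using member_le_sum[of k "{..<n}" p] that p_pos p_sum by (auto intro: less_imp_le)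
  define z where "z x = (\<Sum>l<n. p l *\<^sub>R x l)" for x :: "nat \<Rightarrow> 'a"
  \<comment> \<open>The mean deviation after \<open>j\<close> averagings. Weighting by
    \<open>p\<close>, which the kernel fixes from the right, makes it non-increasing in
    \<open>j\<close>.\<close>
  define E where "E j x = (\<Sum>k<n. p k * norm (\<Sum>l<n. kpow n a j l k *\<^sub>R (x l - z x)))"
    for j and x :: "nat \<Rightarrow> 'a"
  define D where "D x = (\<Sum>j<m. E j x)" for x :: "nat \<Rightarrow> 'a"
  have knn: "0 \<le> kpow n a j l k" if "k < n" for j l k using kpow_nonneg[of n a k] nn that by blast
  have E_nonneg: "0 \<le> E j x" for j x
    unfolding E_def using p_pos by (intro sum_nonneg mult_nonneg_nonneg) (auto intro: less_imp_le)
  have E0: "E 0 x = (\<Sum>k<n. p k * norm (x k - z x))" for x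
    unfolding E_def by (intro sum.cong) (auto simp: if_distrib[where f = "\<lambda>c. c *\<^sub>R _"] cong: if_cong)
  have dev0: "(\<Sum>l<n. p l *\<^sub>R (x l - z x)) = 0" for x
    using p_sum by (simp add: scaleR_diff_right sum_subtractf z_def flip: scaleR_sum_left)
  have z_avg: "z (\<lambda>k. \<Sum>l<n. a l k *\<^sub>R x l) = z x" for x
  proof -
    have "z (\<lambda>k. \<Sum>l<n. a l k *\<^sub>R x l) = (\<Sum>l<n. (\<Sum>k<n. a l k * p k) *\<^sub>R x l)"
      unfolding z_def scaleR_sum_right scaleR_sum_left by (subst sum.swap) (simp add: ac_simps)
    then show ?thesis using p_fix by (simp add: z_def)
  qed
  have E_avg: "E j (\<lambda>k. \<Sum>l<n. a l k *\<^sub>R x l) = E (Suc j) x" for j x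
  proof -
    have "(\<Sum>l<n. kpow n a j l k *\<^sub>R ((\<Sum>i<n. a i l *\<^sub>R x i) - z x))
        = (\<Sum>l<n. kpow n a (Suc j) l k *\<^sub>R (x l - z x))" if k: "k < n" for k
    proof -
      have "(\<Sum>i<n. a i l *\<^sub>R x i) - z x = (\<Sum>i<n. a i l *\<^sub>R (x i - z x))" if "l < n" for l
        using colsum[OF that] by (simp add: scaleR_diff_right sum_subtractf flip: scaleR_sum_left)
      then have "(\<Sum>l<n. kpow n a j l k *\<^sub>R ((\<Sum>i<n. a i l *\<^sub>R x i) - z x))
          = (\<Sum>l<n. \<Sum>i<n. (a i l * kpow n a j l k) *\<^sub>R (x i - z x))"
        by (simp add: scaleR_sum_right ac_simps)
      also have "\<dots> = (\<Sum>i<n. (\<Sum>l<n. a i l * kpow n a j l k) *\<^sub>R (x i - z x))"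
        by (subst sum.swap) (simp add: scaleR_sum_left)
      also have "\<dots> = (\<Sum>i<n. kpow n a (Suc j) i k *\<^sub>R (x i - z x))"
        using k by (intro sum.cong refl) (simp only: kpow_Suc_left lessThan_iff)
      finally show ?thesis .
    qed
    then show ?thesis unfolding E_def z_avg by simp
  qed
  \<comment> \<open>Doeblin's argument: the deviations have \<open>p\<close>-mean zero, so the
    kernel \<open>t * p l\<close> can be subtracted at no cost, and what remains is nonnegative with
    mass reduced by the factor \<open>1 - t\<close>. The value \<open>t = 0\<close> gives
    monotonicity, and a positive \<open>t\<close> is available at the power
    \<open>m\<close>.\<close>
  have E_contract: "E j x \<le> (1 - t) * E 0 x"
    if t: "\<And>l k. l < n \<Longrightarrow> k < n \<Longrightarrow> t * p l \<le> kpow n a j l k" for j t x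
  proof -
    have "norm (\<Sum>l<n. kpow n a j l k *\<^sub>R (x l - z x))
        \<le> (\<Sum>l<n. (kpow n a j l k - t * p l) * norm (x l - z x))" if k: "k < n" for k
    proof -
      have "(\<Sum>l<n. (kpow n a j l k - t * p l) *\<^sub>R (x l - z x))
          = (\<Sum>l<n. kpow n a j l k *\<^sub>R (x l - z x)) - t *\<^sub>R (\<Sum>l<n. p l *\<^sub>R (x l - z x))"
        by (simp add: scaleR_diff_left sum_subtractf scaleR_sum_right)
      then have "(\<Sum>l<n. kpow n a j l k *\<^sub>R (x l - z x))
          = (\<Sum>l<n. (kpow n a j l k - t * p l) *\<^sub>R (x l - z x))" using dev0 by simp
      also have "norm \<dots> \<le> (\<Sum>l<n. norm ((kpow n a j l k - t * p l) *\<^sub>R (x l - z x)))"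
        by (rule norm_sum)
      also have "\<dots> = (\<Sum>l<n. (kpow n a j l k - t * p l) * norm (x l - z x))"
        using t k by (intro sum.cong) auto
      finally show ?thesis .
    qed
    then have "E j x \<le> (\<Sum>k<n. p k * (\<Sum>l<n. (kpow n a j l k - t * p l) * norm (x l - z x)))"
      unfolding E_def using p_pos by (intro sum_mono mult_left_mono) (auto intro: less_imp_le)
    also have "\<dots> = (\<Sum>l<n. ((\<Sum>k<n. kpow n a j l k * p k) - t * p l * (\<Sum>k<n. p k)) * norm (x l - z x))"
      unfolding sum_distrib_left sum_distrib_right left_diff_distrib right_diff_distrib sum_subtractf
      by (subst (1 2) sum.swap) (simp add: ac_simps)
    also have "\<dots> = (\<Sum>l<n. (1 - t) * (p l * norm (x l - z x)))"
      using kpow_right_fixed[OF p_fix] p_sum by (intro sum.cong) (auto simp: algebra_simps)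
    finally show ?thesis by (simp add: E0 flip: sum_distrib_left)
  qed
  have E_le: "E j x \<le> E 0 x" for j x using E_contract[of 0 j x] knn by simp
  have D_le: "D x \<le> m * E 0 x" for x
    unfolding D_def using sum_bounded_above[of "{..<m}" "\<lambda>j. E j x"] E_le by simp
  \<comment> \<open>The cap at 1 keeps \<open>1 - c\<close> nonnegative; since
    \<open>p l \<le> 1\<close>, the uniform lower bound \<open>c\<close> also dominates
    \<open>c * p l\<close>.\<close>
  define c where "c = Min (insert 1 ((\<lambda>(l, k). kpow n a m l k) ` ({..<n} \<times> {..<n})))"
  have c: "c > 0" "c \<le> 1" using pos n unfolding c_def by (auto simp: Min_gr_iff)
  have "c * p l \<le> kpow n a m l k" if "l < n" "k < n" for l k
  proof -
    have "c \<le> kpow n a m l k" unfolding c_def using that by (intro Min_le) auto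
    moreover have "c * p l \<le> c * 1" using c p1 that by (intro mult_left_mono) auto
    ultimately show ?thesis by simp
  qed
  then have E_m: "E m x \<le> (1 - c) * E 0 x" for x by (rule E_contract)
  have D_avg: "D (\<lambda>k. \<Sum>l<n. a l k *\<^sub>R x l) \<le> (1 - c / m) * D x" for x
  proof -
    have "D (\<lambda>k. \<Sum>l<n. a l k *\<^sub>R x l) = (\<Sum>j<m. E (Suc j) x)" by (simp add: D_def E_avg)
    also have "\<dots> = D x - E 0 x + E m x"
      unfolding D_def using sum.lessThan_Suc_shift[of "\<lambda>j. E j x" m] by simp
    also have "\<dots> \<le> D x - c * E 0 x" using E_m[of x] by (simp add: algebra_simps)
    \<comment> \<open>The step loses \<open>c * E 0 x\<close>. As no summand exceeds
      \<open>E 0 x\<close>, this is at least the fraction \<open>c / m\<close> of the whole, which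
      fixes the rate.\<close>
    also have "\<dots> \<le> D x - c * (D x / m)"
      using D_le[of x] c m by (intro diff_left_mono mult_left_mono) (auto simp: field_simps)
    finally show ?thesis by (simp add: algebra_simps)
  qed
  \<comment> \<open>The first summand undoes the weights when a single deviation is read off from
    \<open>D\<close>; the second bounds the \<open>m\<close> summands of \<open>D\<close>, each at
    most twice the sum of the norms.\<close>
  define K where "K = (\<Sum>k<n. 1 / p k) + 2 * m"
  have K0: "0 \<le> (\<Sum>k<n. 1 / p k)" using p_pos by (intro sum_nonneg) (auto intro: less_imp_le)
  have D_nonneg: "0 \<le> D x" for x unfolding D_def by (intro sum_nonneg E_nonneg)
  have E0_D: "E 0 x \<le> D x" for x
    unfolding D_def using m E_nonneg by (intro member_le_sum) auto
  have dev: "norm (x k - z x) \<le> K * D x" if k: "k < n" for x k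
  proof -
    have "p k * norm (x k - z x) \<le> E 0 x"
      unfolding E0 using k p_pos by (intro member_le_sum[where f = "\<lambda>k. p k * norm (x k - z x)"])
        (auto intro!: mult_nonneg_nonneg intro: less_imp_le)
    also note E0_D
    finally have "norm (x k - z x) \<le> 1 / p k * D x" using p_pos[OF k] by (simp add: field_simps)
    also have "1 / p k \<le> (\<Sum>k<n. 1 / p k)"
      using k p_pos by (intro member_le_sum[where f = "\<lambda>k. 1 / p k"]) (auto intro: less_imp_le)
    then have "1 / p k * D x \<le> K * D x" using D_nonneg by (intro mult_right_mono) (auto simp: K_def)
    finally show ?thesis .
  qed
  have bound: "D x \<le> K * (\<Sum>l<n. norm (x l))" for x
  proof -
    have zb: "norm (z x) \<le> (\<Sum>l<n. norm (x l))"
      unfolding z_def using p_pos p1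
      by (intro sum_norm_le) (simp add: abs_of_pos mult_left_le_one_le less_imp_le del: mult_le_cancel_right1 mult_le_cancel_right2)
    have "E 0 x \<le> (\<Sum>k<n. norm (x k) + p k * norm (z x))"
      unfolding E0
    proof (intro sum_mono)
      fix k assume k: "k \<in> {..<n}"
      have "p k * norm (x k - z x) \<le> p k * (norm (x k) + norm (z x))"
        using k p_pos by (intro mult_left_mono norm_triangle_ineq4) (auto intro: less_imp_le)
      moreover have "p k * norm (x k) \<le> norm (x k)"
        using k p_pos p1 by (intro mult_left_le_one_le) (auto intro: less_imp_le)
      ultimately show "p k * norm (x k - z x) \<le> norm (x k) + p k * norm (z x)"
        by (simp add: distrib_left)
    qed
    also have "\<dots> = (\<Sum>l<n. norm (x l)) + norm (z x)"
      using p_sum by (simp add: sum.distrib flip: sum_distrib_right)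
    finally have "E 0 x \<le> 2 * (\<Sum>l<n. norm (x l))" using zb by simp
    then have "m * E 0 x \<le> m * (2 * (\<Sum>l<n. norm (x l)))" by (intro mult_left_mono) auto
    also have "\<dots> \<le> K * (\<Sum>l<n. norm (x l))"
      using K0 by (simp add: K_def distrib_right sum_nonneg)
    finally show ?thesis using D_le[of x] by simp
  qed
  have triangle: "D (\<lambda>k. x k + y k) \<le> D x + D y" for x y
  proof -
    have "E j (\<lambda>k. x k + y k) \<le> E j x + E j y" for j
    proof -
      have z: "z (\<lambda>k. x k + y k) = z x + z y"
        by (simp add: z_def scaleR_add_right sum.distrib)
      show ?thesis unfolding E_def z sum.distrib[symmetric] distrib_left[symmetric]
      proof (intro sum_mono mult_left_mono)
        fix k
        have "(\<Sum>l<n. kpow n a j l k *\<^sub>R (x l + y l - (z x + z y)))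
          = (\<Sum>l<n. kpow n a j l k *\<^sub>R (x l - z x)) + (\<Sum>l<n. kpow n a j l k *\<^sub>R (y l - z y))"
          by (simp add: algebra_simps flip: sum.distrib)
        then show "norm (\<Sum>l<n. kpow n a j l k *\<^sub>R (x l + y l - (z x + z y)))
          \<le> norm (\<Sum>l<n. kpow n a j l k *\<^sub>R (x l - z x)) + norm (\<Sum>l<n. kpow n a j l k *\<^sub>R (y l - z y))"
          by (simp add: norm_triangle_ineq)
      qed (use p_pos in \<open>auto intro: less_imp_le\<close>)
    qed
    then show ?thesis unfolding D_def sum.distrib[symmetric] by (intro sum_mono)
  qed
  have meas: "(\<lambda>\<omega>. D (\<lambda>l. x l \<omega>)) \<in> borel_measurable N"
    if x: "\<And>l. l < n \<Longrightarrow> x l \<in> borel_measurable N" for x and N :: "'w measure"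
  proof -
    have z: "(\<lambda>\<omega>. z (\<lambda>l. x l \<omega>)) \<in> borel_measurable N"
      unfolding z_def using x
      by (intro borel_measurable_sum borel_measurable_scaleR borel_measurable_const) auto
    show ?thesis unfolding D_def E_def using x z
      by (intro borel_measurable_sum borel_measurable_times borel_measurable_norm
          borel_measurable_scaleR borel_measurable_const borel_measurable_diff
          measurable_compose[OF _ borel_measurable_norm]) auto
  qed
  have "1 \<le> K" using K0 m by (simp add: K_def)
  moreover have "0 \<le> 1 - c / m" "1 - c / m < 1" using c m by (auto simp: field_simps)
  ultimately show thesis
    using that[of "1 - c / m" K D] D_nonneg D_avg triangle dev bound meas by (simp add: z_def)
qed

section \<open>Weights under which a leaky kernel contracts\<close>

lemma pos_margin_imp_contraction:
  fixes f v :: "nat \<Rightarrow> real"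
  assumes t: "0 < t" and v: "\<And>k. k < n \<Longrightarrow> 1 \<le> v k" and f: "\<And>k. k < n \<Longrightarrow> f k \<le> v k - t"
  shows "\<exists>r. 0 \<le> r \<and> r < 1 \<and> (\<forall>k<n. f k \<le> r * v k)"
proof -
  \<comment> \<open>An upper bound of all \<open>v k\<close>, against which the additive margin
    \<open>t\<close> becomes the factor \<open>1 - t / V\<close>; the added \<open>t + 1\<close>
    keeps \<open>V\<close> positive and at least \<open>t\<close> even for an empty index
    set.\<close>
  define V where "V = (\<Sum>k<n. v k) + t + 1"
  have sv: "0 \<le> (\<Sum>k<n. v k)" using v by (intro sum_nonneg) fastforce
  have V: "V > 0" "t \<le> V" using t sv by (auto simp: V_def)
  have "f k \<le> (1 - t / V) * v k" if "k < n" for k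
  proof -
    have "v k \<le> (\<Sum>k<n. v k)" using that v by (intro member_le_sum) fastforce+
    then have "v k \<le> V" using t by (simp add: V_def)
    then have "t / V * v k \<le> t / V * V" using t V by (intro mult_left_mono) auto
    then show ?thesis using f[OF that] V by (simp add: algebra_simps)
  qed
  moreover have "0 \<le> 1 - t / V" "1 - t / V < 1" using V t by auto
  ultimately show ?thesis by blast
qed

text \<open>The weights are a truncated Neumann series: \<open>v k\<close> adds the column masses of
  the first \<open>J\<close> powers. Applying the kernel shifts this sum by one and so trades the
  initial mass 1 for the mass of the power \<open>J\<close>, which is below 1.\<close>

lemma leaky_column_weights:
  fixes a :: "nat \<Rightarrow> nat \<Rightarrow> real"
  assumes nn: "\<And>l k. l < n \<Longrightarrow> k < n \<Longrightarrow> 0 \<le> a l k"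
    and colsum: "\<And>k. k < n \<Longrightarrow> (\<Sum>l<n. a l k) \<le> 1"
    and leak: "\<And>k. k < n \<Longrightarrow> \<exists>j. (\<Sum>l<n. kpow n a j l k) < 1"
  shows "\<exists>v r. (\<forall>k<n. 1 \<le> v k) \<and> 0 \<le> r \<and> r < 1 \<and> (\<forall>k<n. (\<Sum>l<n. v l * a l k) \<le> r * v k)"
proof -
  define u where "u j k = (\<Sum>l<n. kpow n a j l k)" for j k
  have u0: "u 0 k = 1" if "k < n" for k using that by (simp add: u_def)
  have uSuc: "u (Suc j) k = (\<Sum>i<n. u j i * a i k)" for j k
    unfolding u_def kpow.simps(2) sum_distrib_right by (rule sum.swap)
  have unn: "0 \<le> u j k" if "k < n" for j k
    unfolding u_def by (intro sum_nonneg kpow_nonneg nn that)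
  have dec1: "u (Suc j) k \<le> u j k" if "k < n" for j k
    using that
  proof (induction j arbitrary: k)
    case 0 then show ?case using colsum u0 by (simp add: uSuc)
  next
    case (Suc j)
    show ?case by (subst uSuc, subst (2) uSuc, intro sum_mono mult_right_mono) (use Suc nn in auto)
  qed
  have dec: "u j' k \<le> u j k" if "j \<le> j'" "k < n" for j j' k
    using that(1) by (induction j' rule: dec_induct) (use dec1[OF that(2)] order_trans in auto)
  obtain jj where jj: "\<And>k. k < n \<Longrightarrow> u (jj k) k < 1" using leak unfolding u_def by metis
  \<comment> \<open>Columns may start to leak at different powers, but column masses never grow, so
    one exponent beyond all of them works for every column. The successor makes the sum defining
    \<open>v\<close> contain the initial mass 1.\<close>
  define J where "J = Suc (\<Sum>k<n. jj k)"
  have uJ: "u J k < 1" if "k < n" for k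
  proof -
    have "jj k \<le> J" using member_le_sum[of k "{..<n}" jj] that by (simp add: J_def)
    then show ?thesis using dec[of "jj k" J k] jj that by fastforce
  qed
  define t where "t = Min (insert 1 ((\<lambda>k. 1 - u J k) ` {..<n}))"
  have t: "t > 0" using uJ by (auto simp: t_def)
  have tle: "t \<le> 1 - u J k" if "k < n" for k unfolding t_def using that by (intro Min_le) auto
  define v where "v k = (\<Sum>j<J. u j k)" for k
  have v1: "1 \<le> v k" if "k < n" for k
  proof -
    have "u 0 k \<le> v k" unfolding v_def using unn that by (intro member_le_sum) (auto simp: J_def)
    then show ?thesis using u0 that by simp
  qed
  have va: "(\<Sum>l<n. v l * a l k) \<le> v k - t" if "k < n" for k
  proof -
    have "(\<Sum>l<n. v l * a l k) = (\<Sum>j<J. u (Suc j) k)"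
      unfolding v_def uSuc sum_distrib_right by (rule sum.swap)
    also have "\<dots> = v k - u 0 k + u J k"
      unfolding v_def using sum.lessThan_Suc_shift[of "\<lambda>j. u j k" J] by simp
    finally show ?thesis using u0 tle that by fastforce
  qed
  obtain r where "0 \<le> r" "r < 1" "\<forall>k<n. (\<Sum>l<n. v l * a l k) \<le> r * v k"
    using pos_margin_imp_contraction[where f = "\<lambda>k. \<Sum>l<n. v l * a l k", OF t v1 va] by auto
  then show ?thesis using v1 by (intro exI[of _ v] exI[of _ r]) simp
qed

text \<open>The l1 norm weighted by \<open>v\<close> shrinks by the factor \<open>r\<close> on a
  fixed vector. This is the injectivity behind the invertibility of \<open>1 - TRR\<close>.\<close>

lemma leaky_fixed_zero:
  fixes a :: "nat \<Rightarrow> nat \<Rightarrow> real"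
  assumes nn: "\<And>l k. l < n \<Longrightarrow> k < n \<Longrightarrow> 0 \<le> a l k"
    and v: "\<And>k. k < n \<Longrightarrow> 1 \<le> v k" and r: "r < 1"
    and va: "\<And>k. k < n \<Longrightarrow> (\<Sum>l<n. v l * a l k) \<le> r * v k"
    and x: "\<And>l. l < n \<Longrightarrow> (\<Sum>k<n. a l k * x k) = x l" and "l < n"
  shows "x l = 0"
proof -
  have v0: "0 \<le> v k" if "k < n" for k using v[OF that] by simp
  have "\<bar>x l\<bar> \<le> (\<Sum>k<n. a l k * \<bar>x k\<bar>)" if "l < n" for l
  proof -
    have "\<bar>x l\<bar> \<le> (\<Sum>k<n. \<bar>a l k * x k\<bar>)" using x[OF that] by (metis sum_abs)
    also have "\<dots> = (\<Sum>k<n. a l k * \<bar>x k\<bar>)"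
      using nn that by (intro sum.cong) (auto simp: abs_mult)
    finally show ?thesis .
  qed
  then have "(\<Sum>l<n. v l * \<bar>x l\<bar>) \<le> (\<Sum>l<n. v l * (\<Sum>k<n. a l k * \<bar>x k\<bar>))"
    using v by (intro sum_mono mult_left_mono) fastforce+
  also have "\<dots> = (\<Sum>k<n. (\<Sum>l<n. v l * a l k) * \<bar>x k\<bar>)"
    unfolding sum_distrib_left sum_distrib_right by (subst sum.swap) (simp add: ac_simps)
  also have "\<dots> \<le> (\<Sum>k<n. r * v k * \<bar>x k\<bar>)" by (intro sum_mono mult_right_mono va) auto
  finally have "(1 - r) * (\<Sum>l<n. v l * \<bar>x l\<bar>) \<le> 0"
    by (simp add: algebra_simps flip: sum_distrib_left)
  then have "(\<Sum>l<n. v l * \<bar>x l\<bar>) \<le> 0" using r by (simp add: mult_le_0_iff)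
  moreover have "v l * \<bar>x l\<bar> \<le> (\<Sum>l<n. v l * \<bar>x l\<bar>)"
    using \<open>l < n\<close> v by (intro member_le_sum[where f = "\<lambda>l. v l * \<bar>x l\<bar>"]) (auto intro!: mult_nonneg_nonneg v0)
  moreover have "\<bar>x l\<bar> \<le> v l * \<bar>x l\<bar>" using v[OF \<open>l < n\<close>] by (simp add: mult_le_cancel_right1)
  ultimately show ?thesis by simp
qed

text \<open>Row sums carry no bound by one, so the argument for columns cannot simply be transposed.
  The column weights force all powers to decay geometrically; a high power has row masses at most
  1/2, and the truncated series over row masses gives the weights. Row weights are what an update
  needs in which agent \<open>k\<close> averages over \<open>l\<close>.\<close>

lemma leaky_row_weights:
  fixes a :: "nat \<Rightarrow> nat \<Rightarrow> real"
  assumes nn: "\<And>l k. l < n \<Longrightarrow> k < n \<Longrightarrow> 0 \<le> a l k"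
    and v: "\<And>k. k < n \<Longrightarrow> 1 \<le> v k" and r: "0 \<le> r" "r < 1"
    and va: "\<And>k. k < n \<Longrightarrow> (\<Sum>l<n. v l * a l k) \<le> r * v k"
  shows "\<exists>u r. (\<forall>k<n. 1 \<le> u k) \<and> 0 \<le> r \<and> r < 1 \<and> (\<forall>l<n. (\<Sum>k<n. a l k * u k) \<le> r * u l)"
proof -
  define U where "U j l = (\<Sum>k<n. kpow n a j l k)" for j l
  have U0: "U 0 l = 1" if "l < n" for l using that by (simp add: U_def)
  have Unn: "0 \<le> U j l" for j l
    unfolding U_def by (intro sum_nonneg kpow_nonneg nn) auto
  have USuc: "U (Suc j) l = (\<Sum>i<n. a l i * U j i)" if "l < n" for j l
  proof -
    have "U (Suc j) l = (\<Sum>k<n. \<Sum>i<n. a l i * kpow n a j i k)"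
      unfolding U_def by (intro sum.cong refl kpow_Suc_left that) auto
    then show ?thesis unfolding U_def sum_distrib_left by (subst (asm) sum.swap)
  qed
  have v0: "0 \<le> v k" if "k < n" for k using v[OF that] by simp
  have vU: "(\<Sum>l<n. v l * U j l) \<le> r ^ j * (\<Sum>l<n. v l)" for j
  proof (induction j)
    case 0 then show ?case using U0 by simp
  next
    case (Suc j)
    have "(\<Sum>l<n. v l * U (Suc j) l) = (\<Sum>l<n. v l * (\<Sum>i<n. a l i * U j i))" by (simp add: USuc)
    also have "\<dots> = (\<Sum>i<n. (\<Sum>l<n. v l * a l i) * U j i)"
      unfolding sum_distrib_left sum_distrib_right by (subst sum.swap) (simp add: ac_simps)
    also have "\<dots> \<le> (\<Sum>i<n. r * v i * U j i)" using va Unn by (intro sum_mono mult_right_mono) auto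
    also have "\<dots> = r * (\<Sum>i<n. v i * U j i)" by (simp add: sum_distrib_left ac_simps)
    also have "\<dots> \<le> r * (r ^ j * (\<Sum>l<n. v l))" using Suc r by (intro mult_left_mono)
    finally show ?case by simp
  qed
  have "(\<lambda>j. r ^ j * (\<Sum>l<n. v l)) \<longlonglongrightarrow> 0 * (\<Sum>l<n. v l)"
    using r by (intro tendsto_mult LIMSEQ_realpow_zero tendsto_const) auto
  then have "eventually (\<lambda>j. r ^ j * (\<Sum>l<n. v l) < 1 / 2) sequentially"
    by (rule order_tendstoD(2)) simp
  then obtain J0 where "\<And>j. j \<ge> J0 \<Longrightarrow> r ^ j * (\<Sum>l<n. v l) < 1 / 2"
    by (auto simp: eventually_sequentially)
  then obtain J where J: "J > 0" "r ^ J * (\<Sum>l<n. v l) < 1 / 2" by (metis le_SucI order_refl zero_less_Suc)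
  have UJ: "U J l \<le> 1 / 2" if "l < n" for l
  proof -
    have "1 * U J l \<le> v l * U J l" using v that Unn by (intro mult_right_mono) auto
    also have "\<dots> \<le> (\<Sum>l<n. v l * U J l)"
      using that v Unn by (intro member_le_sum[where f = "\<lambda>l. v l * U J l"])
        (auto intro!: mult_nonneg_nonneg v0)
    finally show ?thesis using vU[of J] J by simp
  qed
  define u where "u l = (\<Sum>j<J. U j l)" for l
  have u1: "1 \<le> u k" if "k < n" for k
  proof -
    have "U 0 k \<le> u k" unfolding u_def using Unn J by (intro member_le_sum) auto
    then show ?thesis using U0 that by simp
  qed
  have au: "(\<Sum>k<n. a l k * u k) \<le> u l - 1 / 2" if "l < n" for l
  proof -
    have "(\<Sum>k<n. a l k * u k) = (\<Sum>j<J. U (Suc j) l)"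
      unfolding u_def USuc[OF that] sum_distrib_left by (rule sum.swap)
    also have "\<dots> = u l - U 0 l + U J l"
      unfolding u_def using sum.lessThan_Suc_shift[of "\<lambda>j. U j l" J] by simp
    finally show ?thesis using U0 UJ that by fastforce
  qed
  obtain r where "0 \<le> r" "r < 1" "\<forall>l<n. (\<Sum>k<n. a l k * u k) \<le> r * u l"
    using pos_margin_imp_contraction[where f = "\<lambda>l. \<Sum>k<n. a l k * u k", OF _ u1 au] by auto
  then show ?thesis using u1 by (intro exI[of _ u] exI[of _ r]) simp
qed

section \<open>Pathwise bounds for a single sub-network\<close>

text \<open>The convexity inequality on a segment, divided by \<open>t\<close> and taken to the
  limit at 0 from the right, is the first-order inequality with a quadratic gain; adding it to its
  mirror image gives monotonicity. With \<open>\<nu> = 0\<close> this also serves the merely convex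
  costs.\<close>

lemma gradient_strongly_monotone:
  fixes f :: "'a::euclidean_space \<Rightarrow> real"
  assumes deriv: "\<And>x. (f has_derivative (\<lambda>h. g x \<bullet> h)) (at x)"
    and conv: "\<And>x y t. t \<in> {0..1} \<Longrightarrow> f (t *\<^sub>R x + (1 - t) *\<^sub>R y)
      \<le> t * f x + (1 - t) * f y - \<nu> / 2 * t * (1 - t) * (norm (x - y))\<^sup>2"
  shows "\<nu> * (norm (x - y))\<^sup>2 \<le> (g x - g y) \<bullet> (x - y)"
proof -
  have first_order: "g y \<bullet> (x - y) \<le> f x - f y - \<nu> / 2 * (norm (x - y))\<^sup>2" for x y
  proof -
    have "((\<lambda>t. f (y + t *\<^sub>R (x - y))) has_derivative (\<lambda>t. g y \<bullet> (t *\<^sub>R (x - y)))) (at 0)"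
      by (rule has_derivative_compose[where g = f and f = "\<lambda>t. y + t *\<^sub>R (x - y)"])
        (auto intro!: derivative_eq_intros deriv)
    then have "((\<lambda>t. f (y + t *\<^sub>R (x - y))) has_real_derivative (g y \<bullet> (x - y))) (at 0)"
      by (simp add: has_field_derivative_def mult.commute[of _ "g y \<bullet> (x - y)"])
    then have "((\<lambda>t. (f (y + t *\<^sub>R (x - y)) - f y) / t) \<longlongrightarrow> g y \<bullet> (x - y)) (at_right 0)"
      by (auto simp: has_field_derivative_iff intro: tendsto_within_subset)
    moreover have "((\<lambda>t. f x - f y - \<nu> / 2 * (1 - t) * (norm (x - y))\<^sup>2)
        \<longlongrightarrow> f x - f y - \<nu> / 2 * (1 - 0) * (norm (x - y))\<^sup>2) (at_right 0)"
      by (intro tendsto_intros)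
    moreover have "eventually (\<lambda>t::real. t \<in> {0<..<1}) (at_right 0)"
      by (rule eventually_at_right_real) simp
    then have "eventually (\<lambda>t. (f (y + t *\<^sub>R (x - y)) - f y) / t
        \<le> f x - f y - \<nu> / 2 * (1 - t) * (norm (x - y))\<^sup>2) (at_right 0)"
    proof eventually_elim
      case (elim t)
      have "y + t *\<^sub>R (x - y) = t *\<^sub>R x + (1 - t) *\<^sub>R y" by (simp add: algebra_simps)
      then have "f (y + t *\<^sub>R (x - y)) - f y
          \<le> (f x - f y - \<nu> / 2 * (1 - t) * (norm (x - y))\<^sup>2) * t"
        using conv[of t x y] elim by (simp add: algebra_simps)
      then show ?case using elim by (simp add: pos_divide_le_eq)
    qed
    ultimately show ?thesis by (auto intro: tendsto_le[OF trivial_limit_at_right_real])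
  qed
  show ?thesis using first_order[of y x] first_order[of x y]
    by (simp add: norm_minus_commute inner_diff_left inner_diff_right algebra_simps)
qed

lemma bounded_derivative_lipschitz:
  fixes g :: "'a::euclidean_space \<Rightarrow> 'a"
  assumes deriv: "\<And>x. (g has_derivative blinfun_apply (h x)) (at x)"
    and bound: "\<And>x. norm (h x) \<le> \<delta>"
  shows "norm (g x - g y) \<le> \<delta> * norm (x - y)"
  using assms by (intro differentiable_bound[of UNIV g "\<lambda>x. blinfun_apply (h x)"])
    (auto simp flip: norm_blinfun.rep_eq)

text \<open>Smoothness is local, the estimate is global. Within radius \<open>\<epsilon>\<close> the
  mean value inequality for \<open>g\<close> minus its linearisation gives \<open>\<kappa>\<close>;
  outside, the bounded derivative gives a linear error \<open>2 * \<delta> * norm \<Delta>\<close>,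
  which is at most \<open>2 * \<delta> / \<epsilon>\<close> times the square.\<close>

lemma quadratic_remainder:
  fixes g :: "'a::euclidean_space \<Rightarrow> 'a"
  assumes deriv: "\<And>x. (g has_derivative blinfun_apply (h x)) (at x)"
    and bound: "\<And>x. norm (h x) \<le> \<delta>" and "0 < \<epsilon>" "0 \<le> \<kappa>"
    and lip: "\<And>\<Delta>. norm \<Delta> \<le> \<epsilon> \<Longrightarrow> norm (h (w + \<Delta>) - h w) \<le> \<kappa> * norm \<Delta>"
  shows "norm (g (w + \<Delta>) - g w - h w \<Delta>) \<le> (\<kappa> + 2 * \<delta> / \<epsilon>) * (norm \<Delta>)\<^sup>2"
proof (cases "norm \<Delta> \<le> \<epsilon>")
  case True
  have d0: "0 \<le> \<delta>" using bound norm_ge_zero order_trans by blast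
  let ?S = "cball w (norm \<Delta>)"
  have "norm ((g (w + \<Delta>) - h w (w + \<Delta>)) - (g w - h w w))
      \<le> (\<kappa> * norm \<Delta>) * norm ((w + \<Delta>) - w)"
  proof (rule differentiable_bound[where S = ?S and f' = "\<lambda>x. blinfun_apply (h x - h w)"])
    fix x assume x: "x \<in> ?S"
    show "((\<lambda>x. g x - blinfun_apply (h w) x) has_derivative blinfun_apply (h x - h w)) (at x within ?S)"
      using has_derivative_diff[OF has_derivative_at_withinI[OF deriv[of x]]
          bounded_linear_imp_has_derivative[OF blinfun.bounded_linear_right[of "h w"]]]
      by (simp add: blinfun.diff_left[abs_def])
    have nx: "norm (x - w) \<le> norm \<Delta>" using x by (simp add: dist_norm norm_minus_commute)
    have "norm (h (w + (x - w)) - h w) \<le> \<kappa> * norm (x - w)" using nx True by (intro lip) simp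
    also have "\<dots> \<le> \<kappa> * norm \<Delta>" using nx assms by (intro mult_left_mono)
    finally show "onorm (blinfun_apply (h x - h w)) \<le> \<kappa> * norm \<Delta>"
      by (simp add: norm_blinfun.rep_eq)
  qed (auto simp: dist_norm)
  then have "norm (g (w + \<Delta>) - g w - h w \<Delta>) \<le> \<kappa> * (norm \<Delta>)\<^sup>2"
    by (simp add: blinfun.add_right algebra_simps power2_eq_square)
  also have "\<dots> \<le> (\<kappa> + 2 * \<delta> / \<epsilon>) * (norm \<Delta>)\<^sup>2"
    using d0 assms by (intro mult_right_mono) auto
  finally show ?thesis .
next
  case False
  have d0: "0 \<le> \<delta>" using bound norm_ge_zero order_trans by blast
  have "norm (g (w + \<Delta>) - g w - h w \<Delta>) \<le> norm (g (w + \<Delta>) - g w) + norm (h w \<Delta>)"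
    by (rule norm_triangle_ineq4)
  also have "norm (g (w + \<Delta>) - g w) \<le> \<delta> * norm ((w + \<Delta>) - w)"
    by (rule bounded_derivative_lipschitz[OF deriv bound])
  also have "norm (h w \<Delta>) \<le> norm (h w) * norm \<Delta>" by (rule norm_blinfun)
  also have "\<dots> \<le> \<delta> * norm \<Delta>" using bound by (intro mult_right_mono) auto
  finally have "norm (g (w + \<Delta>) - g w - h w \<Delta>) \<le> 2 * \<delta> * norm \<Delta>" by simp
  also have "\<dots> = 2 * \<delta> / \<epsilon> * (\<epsilon> * norm \<Delta>)" using assms by simp
  also have "\<dots> \<le> 2 * \<delta> / \<epsilon> * (norm \<Delta> * norm \<Delta>)"
    using False d0 assms by (intro mult_left_mono mult_right_mono) auto
  also have "\<dots> \<le> (\<kappa> + 2 * \<delta> / \<epsilon>) * (norm \<Delta>)\<^sup>2"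
    using assms by (simp add: power2_eq_square distrib_right)
  finally show ?thesis .
qed

text \<open>In the expanded square monotonicity gains \<open>2 * \<mu> * \<nu>\<close> and the
  Lipschitz term costs at most \<open>\<mu> * \<nu>\<close>, which leaves
  \<open>1 - \<mu> * \<nu>\<close>, below the square of the claimed factor. The bound
  \<open>\<mu> * \<nu> \<le> 2\<close> keeps that factor nonnegative.\<close>

lemma gradient_step_contraction:
  fixes g :: "'a::real_inner \<Rightarrow> 'a"
  assumes mono: "\<nu> * (norm (x - y))\<^sup>2 \<le> (g x - g y) \<bullet> (x - y)"
    and lip: "norm (g x - g y) \<le> L * norm (x - y)" and "0 < \<nu>" "0 < \<mu>"
    and "\<mu> * L\<^sup>2 \<le> \<nu>" "\<mu> * \<nu> \<le> 2"
  shows "norm ((x - \<mu> *\<^sub>R g x) - (y - \<mu> *\<^sub>R g y)) \<le> (1 - \<nu> / 2 * \<mu>) * norm (x - y)"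
proof (rule power2_le_imp_le)
  have "(norm (g x - g y))\<^sup>2 \<le> L\<^sup>2 * (norm (x - y))\<^sup>2"
    using power_mono[OF lip, of 2] by (simp add: power_mult_distrib)
  then have "\<mu>\<^sup>2 * (norm (g x - g y))\<^sup>2 \<le> \<mu>\<^sup>2 * (L\<^sup>2 * (norm (x - y))\<^sup>2)"
    by (intro mult_left_mono) auto
  also have "\<dots> = \<mu> * (\<mu> * L\<^sup>2) * (norm (x - y))\<^sup>2" by (simp add: power2_eq_square)
  also have "\<dots> \<le> \<mu> * \<nu> * (norm (x - y))\<^sup>2"
    using assms by (intro mult_right_mono mult_left_mono) auto
  finally have sq: "\<mu>\<^sup>2 * (norm (g x - g y))\<^sup>2 \<le> \<mu> * \<nu> * (norm (x - y))\<^sup>2" .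
  have "\<mu> * (\<nu> * (norm (x - y))\<^sup>2) \<le> \<mu> * ((g x - g y) \<bullet> (x - y))"
    using mono assms by (intro mult_left_mono) auto
  moreover have "(norm ((x - \<mu> *\<^sub>R g x) - (y - \<mu> *\<^sub>R g y)))\<^sup>2
      = (norm (x - y))\<^sup>2 - 2 * (\<mu> * ((g x - g y) \<bullet> (x - y))) + \<mu>\<^sup>2 * (norm (g x - g y))\<^sup>2"
  proof -
    have "(norm (u - \<mu> *\<^sub>R v))\<^sup>2 = (norm u)\<^sup>2 - 2 * (\<mu> * (v \<bullet> u)) + \<mu>\<^sup>2 * (norm v)\<^sup>2" for u v :: 'a
      unfolding power2_norm_eq_inner
      by (simp add: inner_diff_left inner_diff_right inner_commute power2_eq_square)
    from this[of "x - y" "g x - g y"] show ?thesis by (simp add: algebra_simps)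
  qed
  ultimately have "(norm ((x - \<mu> *\<^sub>R g x) - (y - \<mu> *\<^sub>R g y)))\<^sup>2 \<le> (1 - \<mu> * \<nu>) * (norm (x - y))\<^sup>2"
    using sq by (simp add: algebra_simps)
  also have "\<dots> \<le> (1 - \<nu> / 2 * \<mu>)\<^sup>2 * (norm (x - y))\<^sup>2"
    using assms by (intro mult_right_mono) (auto simp: power2_eq_square algebra_simps)
  finally show "(norm ((x - \<mu> *\<^sub>R g x) - (y - \<mu> *\<^sub>R g y)))\<^sup>2 \<le> ((1 - \<nu> / 2 * \<mu>) * norm (x - y))\<^sup>2"
    by (simp add: power_mult_distrib)
  show "0 \<le> (1 - \<nu> / 2 * \<mu>) * norm (x - y)"
    using assms by (intro mult_nonneg_nonneg) (auto simp: mult.commute)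
qed

text \<open>The zeros of \<open>g\<close> are the fixed points of a gradient step, so Banach's
  theorem applies once the step is short enough to contract.\<close>

lemma strongly_monotone_zero:
  fixes g :: "'a::euclidean_space \<Rightarrow> 'a"
  assumes mono: "\<And>x y. \<nu> * (norm (x - y))\<^sup>2 \<le> (g x - g y) \<bullet> (x - y)"
    and lip: "\<And>x y. norm (g x - g y) \<le> L * norm (x - y)" and "0 < \<nu>"
  shows "\<exists>!x. g x = 0"
proof -
  \<comment> \<open>The two entries are the step-size conditions of
    \<open>gradient_step_contraction\<close>; the added 1 avoids a zero denominator.\<close>
  define h where "h = min (1 / \<nu>) (\<nu> / (L\<^sup>2 + 1))"
  have h: "h > 0" using \<open>0 < \<nu>\<close> by (simp add: h_def add_nonneg_pos)
  have "h \<le> 1 / \<nu>" "h \<le> \<nu> / (L\<^sup>2 + 1)" by (simp_all add: h_def)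
  then have b: "h * \<nu> \<le> 1" "h * (L\<^sup>2 + 1) \<le> \<nu>"
    using \<open>0 < \<nu>\<close> by (simp_all add: pos_le_divide_eq add_nonneg_pos)
  then have "h * L\<^sup>2 \<le> \<nu>" using h by (simp add: distrib_left)
  then have "dist (x - h *\<^sub>R g x) (y - h *\<^sub>R g y) \<le> (1 - \<nu> / 2 * h) * dist x y" for x y
    unfolding dist_norm using b h \<open>0 < \<nu>\<close>
    by (intro gradient_step_contraction[OF mono lip]) auto
  moreover have "0 \<le> 1 - \<nu> / 2 * h" "1 - \<nu> / 2 * h < 1"
    using b h \<open>0 < \<nu>\<close> by (auto simp: mult.commute)
  ultimately have "\<exists>!x. x - h *\<^sub>R g x = x" by (intro banach_fix_type[of "1 - \<nu> / 2 * h"]) auto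
  then show ?thesis using h by simp
qed

section \<open>One sub-network of group S as a pathwise recursion\<close>

text \<open>The type \<open>'w\<close> of outcomes is fixed by the argument \<open>dummy\<close>, because \<open>D_meas\<close> refers to measures on it.\<close>

locale diffusion_block =
  fixes n :: nat and a :: "nat \<Rightarrow> nat \<Rightarrow> real" and p \<tau> :: "nat \<Rightarrow> real"
    and grad :: "nat \<Rightarrow> 'a::euclidean_space \<Rightarrow> 'a" and ws :: 'a
    and D :: "(nat \<Rightarrow> 'a) \<Rightarrow> real" and K r \<nu> :: real and H :: "'a \<Rightarrow> 'a"
    and dummy :: "'w itself"
  assumes r: "0 \<le> r" "r < 1" and K: "1 \<le> K" and \<nu>: "0 < \<nu>"
    and D_nonneg: "0 \<le> D x"
    and D_avg: "D (\<lambda>k. \<Sum>l<n. a l k *\<^sub>R x l) \<le> r * D x"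
    and D_add: "D (\<lambda>k. x k + y k) \<le> D x + D y"
    and D_dev: "k < n \<Longrightarrow> norm (x k - (\<Sum>l<n. p l *\<^sub>R x l)) \<le> K * D x"
    and D_bound: "D x \<le> K * (\<Sum>l<n. norm (x l))"
    and D_meas: "(\<And>l. l < n \<Longrightarrow> f l \<in> borel_measurable (N :: 'w measure)) \<Longrightarrow>
       (\<lambda>\<omega>. D (\<lambda>l. f l \<omega>)) \<in> borel_measurable N"
    and p: "k < n \<Longrightarrow> 0 \<le> p k" "(\<Sum>k<n. p k) = 1"
    and p_fix: "l < n \<Longrightarrow> (\<Sum>k<n. a l k * p k) = p l"
    and \<tau>: "k < n \<Longrightarrow> 0 \<le> \<tau> k" "k < n \<Longrightarrow> \<tau> k \<le> 1"
    and grad_lip: "k < n \<Longrightarrow> norm (grad k u - grad k v) \<le> K * norm (u - v)"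
    and grad_ws: "k < n \<Longrightarrow> norm (grad k ws) \<le> K"
    and avg_mono: "\<nu> * (norm (u - v))\<^sup>2 \<le>
      ((\<Sum>k<n. (p k * \<tau> k) *\<^sub>R grad k u) - (\<Sum>k<n. (p k * \<tau> k) *\<^sub>R grad k v)) \<bullet> (u - v)"
    and avg_ws: "(\<Sum>k<n. (p k * \<tau> k) *\<^sub>R grad k ws) = 0"
    and H: "bounded_linear H"
    and avg_quad: "norm ((\<Sum>k<n. (p k * \<tau> k) *\<^sub>R grad k (ws + u)) - H u) \<le> K * (norm u)\<^sup>2"
begin

definition cen :: "(nat \<Rightarrow> 'a) \<Rightarrow> 'a" where
  "cen x = (\<Sum>l<n. p l *\<^sub>R x l) - ws"

definition avg_grad :: "'a \<Rightarrow> 'a" where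
  "avg_grad u = (\<Sum>k<n. (p k * \<tau> k) *\<^sub>R grad k u)"

text \<open>The centroid error after a noise-free step. It depends on the current iterates only, so
  the noise of that step is centred relative to it.\<close>

definition drift :: "real \<Rightarrow> (nat \<Rightarrow> 'a) \<Rightarrow> 'a" where
  "drift \<mu> x = cen x - \<mu> *\<^sub>R (\<Sum>k<n. (p k * \<tau> k) *\<^sub>R grad k (x k))"

definition avg_noise :: "(nat \<Rightarrow> 'a) \<Rightarrow> 'a" where
  "avg_noise s = (\<Sum>k<n. (p k * \<tau> k) *\<^sub>R s k)"

definition step :: "real \<Rightarrow> (nat \<Rightarrow> 'a) \<Rightarrow> (nat \<Rightarrow> 'a) \<Rightarrow> nat \<Rightarrow> 'a" where
  "step \<mu> s x k = (\<Sum>l<n. a l k *\<^sub>R (x l - (\<mu> * \<tau> l) *\<^sub>R (grad l (x l) + s l)))"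

lemma p_le_1: "k < n \<Longrightarrow> p k \<le> 1"
  using member_le_sum[of k "{..<n}" p] p by auto

lemma weight: "k < n \<Longrightarrow> 0 \<le> p k * \<tau> k" "k < n \<Longrightarrow> p k * \<tau> k \<le> p k" "k < n \<Longrightarrow> p k * \<tau> k \<le> 1"
proof -
  assume k: "k < n"
  show "0 \<le> p k * \<tau> k" "p k * \<tau> k \<le> p k" using p \<tau> k by (auto intro: mult_left_le)
  then show "p k * \<tau> k \<le> 1" using p_le_1[OF k] by simp
qed

lemma weight_sum: "(\<Sum>k<n. p k * \<tau> k) \<le> 1"
  using sum_mono[of "{..<n}" "\<lambda>k. p k * \<tau> k" p] weight p by simp

text \<open>The Perron vector is fixed by the combination weights, so combining leaves the centroid
  where adaptation put it.\<close>

lemma cen_step: "cen (step \<mu> s x) = drift \<mu> x - \<mu> *\<^sub>R avg_noise s"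
proof -
  have "(\<Sum>k<n. p k *\<^sub>R step \<mu> s x k)
      = (\<Sum>l<n. (\<Sum>k<n. a l k * p k) *\<^sub>R (x l - (\<mu> * \<tau> l) *\<^sub>R (grad l (x l) + s l)))"
    unfolding step_def scaleR_sum_right scaleR_sum_left by (subst sum.swap) (simp add: ac_simps)
  also have "\<dots> = (\<Sum>l<n. p l *\<^sub>R (x l - (\<mu> * \<tau> l) *\<^sub>R (grad l (x l) + s l)))"
    using p_fix by simp
  finally show ?thesis
    unfolding cen_def drift_def avg_noise_def
    by (simp add: scaleR_diff_right scaleR_add_right sum_subtractf sum.distrib scaleR_sum_right ac_simps)
qed

lemma error_le: "k < n \<Longrightarrow> norm (x k - ws) \<le> norm (cen x) + K * D x"
  using D_dev[of k x] norm_triangle_ineq[of "x k - (\<Sum>l<n. p l *\<^sub>R x l)" "cen x"]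
  by (simp add: cen_def)

lemma avg_grad_lip: "norm (avg_grad u - avg_grad v) \<le> K * norm (u - v)"
proof -
  have "norm (avg_grad u - avg_grad v) \<le> (\<Sum>k<n. (p k * \<tau> k) * (K * norm (u - v)))"
    unfolding avg_grad_def sum_subtractf[symmetric] scaleR_diff_right[symmetric]
    using weight grad_lip by (intro sum_norm_le) (auto intro: mult_left_mono)
  also have "\<dots> = (\<Sum>k<n. p k * \<tau> k) * (K * norm (u - v))" by (simp only: sum_distrib_right)
  also have "\<dots> \<le> 1 * (K * norm (u - v))" using weight_sum K by (intro mult_right_mono) auto
  finally show ?thesis by simp
qed

lemma mean_step_contraction:
  assumes "0 < \<mu>" "\<mu> * K\<^sup>2 \<le> \<nu>" "\<mu> * \<nu> \<le> 2"
  shows "norm (u - \<mu> *\<^sub>R avg_grad (ws + u)) \<le> (1 - \<nu> / 2 * \<mu>) * norm u"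
  using gradient_step_contraction[of \<nu> "ws + u" ws avg_grad K \<mu>]
    avg_mono[of "ws + u" ws] avg_grad_lip[of "ws + u" ws] avg_ws \<nu> assms
  unfolding avg_grad_def[symmetric] by (simp add: algebra_simps)

lemma grad_deviation:
  "norm ((\<Sum>k<n. (p k * \<tau> k) *\<^sub>R grad k (x k)) - avg_grad (ws + cen x)) \<le> K\<^sup>2 * D x"
proof -
  have "norm ((\<Sum>k<n. (p k * \<tau> k) *\<^sub>R grad k (x k)) - avg_grad (ws + cen x))
      \<le> (\<Sum>k<n. (p k * \<tau> k) * (K * (K * D x)))"
    unfolding avg_grad_def sum_subtractf[symmetric] scaleR_diff_right[symmetric]
  proof (intro sum_norm_le)
    fix k assume "k \<in> {..<n}"
    then have k: "k < n" by simp
    have "norm (grad k (x k) - grad k (ws + cen x)) \<le> K * norm (x k - (ws + cen x))"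
      by (rule grad_lip[OF k])
    also have "\<dots> \<le> K * (K * D x)" using D_dev[OF k] K by (intro mult_left_mono) (auto simp: cen_def)
    finally show "norm ((p k * \<tau> k) *\<^sub>R (grad k (x k) - grad k (ws + cen x)))
        \<le> (p k * \<tau> k) * (K * (K * D x))"
      using weight(1)[OF k] by (simp add: mult_left_mono)
  qed
  also have "\<dots> = (\<Sum>k<n. p k * \<tau> k) * (K * (K * D x))" by (simp only: sum_distrib_right)
  also have "\<dots> \<le> 1 * (K * (K * D x))" using weight_sum K D_nonneg by (intro mult_right_mono) auto
  finally show ?thesis by (simp add: power2_eq_square)
qed

text \<open>Evaluating the gradients at the agents instead of the centroid costs
  \<open>\<mu> * K\<^sup>2 * D x\<close>. Its fourth power is divided by the cube of
  \<open>\<nu> / 2 * \<mu>\<close>, the gap of the gradient step, and a single power of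
  \<open>\<mu>\<close> survives.\<close>

lemma drift_power4:
  assumes "0 < \<mu>" "\<mu> * K\<^sup>2 \<le> \<nu>" "\<mu> * \<nu> \<le> 2"
  shows "norm (drift \<mu> x) ^ 4 \<le> (1 - \<nu> / 2 * \<mu>) * norm (cen x) ^ 4 + K ^ 8 / (\<nu> / 2) ^ 3 * \<mu> * D x ^ 4"
proof -
  let ?r = "1 - \<nu> / 2 * \<mu>"
  have "drift \<mu> x = (cen x - \<mu> *\<^sub>R avg_grad (ws + cen x))
      - \<mu> *\<^sub>R ((\<Sum>k<n. (p k * \<tau> k) *\<^sub>R grad k (x k)) - avg_grad (ws + cen x))"
    by (simp add: drift_def algebra_simps)
  then have "norm (drift \<mu> x) \<le> norm (cen x - \<mu> *\<^sub>R avg_grad (ws + cen x))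
      + \<mu> * norm ((\<Sum>k<n. (p k * \<tau> k) *\<^sub>R grad k (x k)) - avg_grad (ws + cen x))"
    using norm_triangle_ineq4 assms(1) by (metis abs_of_pos norm_scaleR)
  also have "\<dots> \<le> ?r * norm (cen x) + \<mu> * (K\<^sup>2 * D x)"
    using assms by (intro add_mono mean_step_contraction mult_left_mono grad_deviation) auto
  finally have "norm (drift \<mu> x) ^ 4 \<le> (?r * norm (cen x) + \<mu> * (K\<^sup>2 * D x)) ^ 4"
    by (intro power_mono) auto
  also have "\<dots> \<le> ?r * norm (cen x) ^ 4 + (\<mu> * (K\<^sup>2 * D x)) ^ 4 / (1 - ?r) ^ 3"
    using assms \<nu> by (intro perturbed_contraction_power4) (auto simp: mult.commute)
  also have "(\<mu> * (K\<^sup>2 * D x)) ^ 4 / (1 - ?r) ^ 3 = K ^ 8 / (\<nu> / 2) ^ 3 * \<mu> * D x ^ 4"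
    using assms \<nu> by (simp add: power_mult_distrib field_simps eval_nat_numeral)
  finally show ?thesis .
qed

text \<open>Gradients and noise enter through the triangle inequality alone. As \<open>D\<close>
  contracts at a rate independent of \<open>\<mu>\<close>, their contribution keeps the full order
  \<open>\<mu> ^ 4\<close>.\<close>

lemma D_step_power4:
  "\<exists>C>0. \<forall>\<mu> s x. 0 < \<mu> \<longrightarrow> D (step \<mu> s x) ^ 4
     \<le> r * D x ^ 4 + C * \<mu> ^ 4 * (1 + norm (cen x) ^ 4 + D x ^ 4 + (\<Sum>l<n. norm (s l) ^ 4))"
proof -
  \<comment> \<open>\<open>64\<close> comes from splitting a sum of four terms by two rounds of
    \<open>add_power4_le\<close>, \<open>K ^ 12\<close> is the fourth power of the factor
    \<open>K ^ 3\<close> in front of the forcing, and \<open>real n ^ 4 + 1\<close> dominates both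
    \<open>n ^ 3\<close> and \<open>n ^ 4\<close>.\<close>
  define C where "C = 64 * K ^ 12 * (real n ^ 4 + 1) / (1 - r) ^ 3"
  have C: "C > 0" using K r unfolding C_def
    by (intro divide_pos_pos mult_pos_pos zero_less_power add_nonneg_pos) auto
  have "D (step \<mu> s x) ^ 4 \<le> r * D x ^ 4 + C * \<mu> ^ 4 * (1 + norm (cen x) ^ 4 + D x ^ 4 + (\<Sum>l<n. norm (s l) ^ 4))"
    if \<mu>: "0 < \<mu>" for \<mu> s x
  proof -
    define b where "b l = 1 + norm (cen x) + D x + norm (s l)" for l
    have b0: "0 \<le> b l" for l using D_nonneg by (simp add: b_def)
    have gb: "norm (- ((\<mu> * \<tau> l) *\<^sub>R (grad l (x l) + s l))) \<le> \<mu> * (K\<^sup>2 * b l)" if l: "l < n" for l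
    proof -
      have "norm (grad l (x l) + s l) \<le> norm (grad l (x l) - grad l ws) + norm (grad l ws) + norm (s l)"
        by norm
      also have "\<dots> \<le> K * (norm (cen x) + K * D x) + K + norm (s l)"
        using grad_lip[OF l, of "x l" ws] error_le[OF l, of x] K grad_ws[OF l]
        by (intro add_mono order_refl) (auto intro: order_trans mult_left_mono)
      also have "\<dots> \<le> K\<^sup>2 * norm (cen x) + K\<^sup>2 * D x + K\<^sup>2 * 1 + K\<^sup>2 * norm (s l)"
      proof -
        have "K \<le> K\<^sup>2" "1 \<le> K\<^sup>2" using K by (simp_all add: self_le_power)
        then have "K * norm (cen x) \<le> K\<^sup>2 * norm (cen x)" "1 * norm (s l) \<le> K\<^sup>2 * norm (s l)"
          using mult_right_mono[OF \<open>1 \<le> K\<^sup>2\<close>, of "norm (s l)"] by (auto intro!: mult_right_mono)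
        then show ?thesis using \<open>K \<le> K\<^sup>2\<close> by (simp add: distrib_left power2_eq_square)
      qed
      also have "\<dots> = K\<^sup>2 * b l" by (simp add: b_def algebra_simps)
      finally have g: "norm (grad l (x l) + s l) \<le> K\<^sup>2 * b l" .
      have "\<mu> * \<tau> l * norm (grad l (x l) + s l) \<le> \<mu> * 1 * (K\<^sup>2 * b l)"
        using g \<tau>[OF l] \<mu> by (intro mult_mono) auto
      then show ?thesis using \<mu> \<tau>[OF l] by (simp add: abs_mult)
    qed
    define y where "y l = - ((\<mu> * \<tau> l) *\<^sub>R (grad l (x l) + s l))" for l
    have "D (step \<mu> s x) \<le> r * D (\<lambda>l. x l + y l)"
      using D_avg unfolding step_def y_def by simp
    also have "\<dots> \<le> r * (D x + D y)" using r by (intro mult_left_mono D_add)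
    also have "\<dots> \<le> r * D x + D y" using r D_nonneg[of y] by (simp add: distrib_left mult_left_le_one_le)
    also have "D y \<le> K * (\<Sum>l<n. norm (y l))" by (rule D_bound)
    also have "\<dots> \<le> K * (\<Sum>l<n. \<mu> * (K\<^sup>2 * b l))"
      using K gb unfolding y_def by (intro mult_left_mono sum_mono) auto
    also have "K * (\<Sum>l<n. \<mu> * (K\<^sup>2 * b l)) = \<mu> * K ^ 3 * (\<Sum>l<n. b l)"
      by (simp add: sum_distrib_left eval_nat_numeral ac_simps)
    finally have "D (step \<mu> s x) ^ 4 \<le> (r * D x + \<mu> * K ^ 3 * (\<Sum>l<n. b l)) ^ 4"
      using D_nonneg by (intro power_mono) auto
    also have "\<dots> \<le> r * D x ^ 4 + (\<mu> * K ^ 3 * (\<Sum>l<n. b l)) ^ 4 / (1 - r) ^ 3"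
      by (rule perturbed_contraction_power4[OF r])
    also have "(\<mu> * K ^ 3 * (\<Sum>l<n. b l)) ^ 4 = \<mu> ^ 4 * K ^ 12 * (\<Sum>l<n. b l) ^ 4"
      by (simp add: power_mult_distrib flip: power_mult)
    also have "(\<Sum>l<n. b l) ^ 4 \<le> 64 * (real n ^ 4 + 1) * (1 + norm (cen x) ^ 4 + D x ^ 4 + (\<Sum>l<n. norm (s l) ^ 4))"
    proof -
      have "b l ^ 4 \<le> 64 * ((1 + norm (cen x) ^ 4 + D x ^ 4) + norm (s l) ^ 4)" for l
      proof -
        have "b l ^ 4 = ((1 + norm (cen x)) + (D x + norm (s l))) ^ 4" by (simp add: b_def add.assoc)
        also note add_power4_le
        also have "8 * ((1 + norm (cen x)) ^ 4 + (D x + norm (s l)) ^ 4)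
            \<le> 8 * (8 * (1 ^ 4 + norm (cen x) ^ 4) + 8 * (D x ^ 4 + norm (s l) ^ 4))"
          by (intro mult_left_mono add_mono add_power4_le) auto
        finally show ?thesis by simp
      qed
      then have "(\<Sum>l<n. b l ^ 4) \<le> (\<Sum>l<n. 64 * ((1 + norm (cen x) ^ 4 + D x ^ 4) + norm (s l) ^ 4))"
        by (intro sum_mono)
      also have "\<dots> = 64 * (n * (1 + norm (cen x) ^ 4 + D x ^ 4) + (\<Sum>l<n. norm (s l) ^ 4))"
        by (simp add: sum.distrib flip: sum_distrib_left)
      finally have "real n ^ 3 * (\<Sum>l<n. b l ^ 4)
          \<le> real n ^ 3 * (64 * (n * (1 + norm (cen x) ^ 4 + D x ^ 4) + (\<Sum>l<n. norm (s l) ^ 4)))"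
        by (intro mult_left_mono) auto
      also have "\<dots> = 64 * (real n ^ 4 * (1 + norm (cen x) ^ 4 + D x ^ 4) + real n ^ 3 * (\<Sum>l<n. norm (s l) ^ 4))"
        by (simp add: algebra_simps eval_nat_numeral)
      also have "\<dots> \<le> 64 * ((real n ^ 4 + 1) * (1 + norm (cen x) ^ 4 + D x ^ 4) + (real n ^ 4 + 1) * (\<Sum>l<n. norm (s l) ^ 4))"
      proof -
        have "real n ^ 3 \<le> real n ^ 4 + 1"
          by (cases "n = 0") (auto intro: order_trans[OF power_increasing[of 3 4]])
        then show ?thesis
          by (intro mult_left_mono add_mono mult_right_mono) (auto intro!: sum_nonneg add_nonneg_nonneg)
      qed
      also have "\<dots> = 64 * (real n ^ 4 + 1) * (1 + norm (cen x) ^ 4 + D x ^ 4 + (\<Sum>l<n. norm (s l) ^ 4))"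
        by (simp add: algebra_simps)
      finally show ?thesis using sum_power4_le[of b "{..<n}"] by simp
    qed
    finally show ?thesis using \<mu> K r
      by (simp add: C_def divide_right_mono mult_left_mono ac_simps)
  qed
  with C show ?thesis by blast
qed

end

section \<open>Fourth moments\<close>

definition fourth_moment :: "'w measure \<Rightarrow> ('w \<Rightarrow> 'b::euclidean_space) \<Rightarrow> bool" where
  "fourth_moment M f \<longleftrightarrow> f \<in> borel_measurable M \<and> integrable M (\<lambda>\<omega>. norm (f \<omega>) ^ 4)"

lemma fourth_momentD:
  assumes "fourth_moment M f"
  shows "f \<in> borel_measurable M" "integrable M (\<lambda>\<omega>. norm (f \<omega>) ^ 4)"
  using assms by (auto simp: fourth_moment_def)

lemma fourth_moment_bound:
  assumes "f \<in> borel_measurable M" "fourth_moment M g" "\<And>\<omega>. \<omega> \<in> space M \<Longrightarrow> norm (f \<omega>) \<le> norm (g \<omega>)"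
  shows "fourth_moment M f"
  unfolding fourth_moment_def
proof
  show "integrable M (\<lambda>\<omega>. norm (f \<omega>) ^ 4)"
    using assms by (intro Bochner_Integration.integrable_bound[OF fourth_momentD(2)[OF assms(2)]])
      (auto intro!: AE_I2 power_mono borel_measurable_power)
qed fact

lemma fourth_moment_scaleR: "fourth_moment M f \<Longrightarrow> fourth_moment M (\<lambda>\<omega>. c *\<^sub>R f \<omega>)"
  by (auto simp: fourth_moment_def power_mult_distrib)

lemma fourth_moment_norm: "fourth_moment M f \<Longrightarrow> fourth_moment M (\<lambda>\<omega>. norm (f \<omega>))"
  by (auto simp: fourth_moment_def)

lemma fourth_moment_add:
  assumes "fourth_moment M f" "fourth_moment M g"
  shows "fourth_moment M (\<lambda>\<omega>. f \<omega> + g \<omega>)"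
  unfolding fourth_moment_def
proof
  have "integrable M (\<lambda>\<omega>. 8 * (norm (f \<omega>) ^ 4 + norm (g \<omega>) ^ 4))"
    using assms by (auto simp: fourth_moment_def)
  moreover have "norm (f \<omega> + g \<omega>) ^ 4 \<le> 8 * (norm (f \<omega>) ^ 4 + norm (g \<omega>) ^ 4)" for \<omega>
    using power_mono[OF norm_triangle_ineq[of "f \<omega>" "g \<omega>"] norm_ge_zero, of 4]
      add_power4_le[of "norm (f \<omega>)" "norm (g \<omega>)"] by linarith
  ultimately show "integrable M (\<lambda>\<omega>. norm (f \<omega> + g \<omega>) ^ 4)"
    using assms by (elim Bochner_Integration.integrable_bound)
      (auto simp: fourth_moment_def intro!: AE_I2 borel_measurable_power)
qed (use assms in \<open>auto simp: fourth_moment_def\<close>)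

lemma fourth_moment_diff:
  "fourth_moment M f \<Longrightarrow> fourth_moment M g \<Longrightarrow> fourth_moment M (\<lambda>\<omega>. f \<omega> - g \<omega>)"
  using fourth_moment_add[of M f "\<lambda>\<omega>. (-1) *\<^sub>R g \<omega>"] fourth_moment_scaleR[of M g "-1"] by simp

lemma fourth_moment_const: "prob_space M \<Longrightarrow> fourth_moment M (\<lambda>\<omega>. c)"
  using prob_space.finite_measure finite_measure.integrable_const
  by (auto simp: fourth_moment_def prob_space_def)

lemma fourth_moment_sum:
  assumes "prob_space M" "\<And>i. i \<in> I \<Longrightarrow> fourth_moment M (f i)"
  shows "fourth_moment M (\<lambda>\<omega>. \<Sum>i\<in>I. f i \<omega>)"
  using assms(2)
  by (induction I rule: infinite_finite_induct)
    (simp_all add: fourth_moment_const[OF assms(1)] fourth_moment_add)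

text \<open>Arithmetic-geometric mean inequality, applied in pairs. Filling slots with the constant
  1 yields all lower moments.\<close>

lemma fourth_moment_prod4:
  fixes a b c d :: "'w \<Rightarrow> real"
  assumes "fourth_moment M a" "fourth_moment M b" "fourth_moment M c" "fourth_moment M d"
  shows "integrable M (\<lambda>\<omega>. a \<omega> * b \<omega> * c \<omega> * d \<omega>)"
proof (rule Bochner_Integration.integrable_bound)
  show "integrable M (\<lambda>\<omega>. norm (a \<omega>) ^ 4 + norm (b \<omega>) ^ 4 + norm (c \<omega>) ^ 4 + norm (d \<omega>) ^ 4)"
    using assms by (auto simp: fourth_moment_def)
  have amgm: "\<bar>x * y\<bar> \<le> x\<^sup>2 + y\<^sup>2" for x y :: real
  proof -
    have "2 * \<bar>x * y\<bar> \<le> x\<^sup>2 + y\<^sup>2"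
      using sum_squares_bound[of "\<bar>x\<bar>" "\<bar>y\<bar>"] by (simp add: abs_mult)
    then show ?thesis using abs_ge_zero[of "x * y"] by linarith
  qed
  have "\<bar>x * y * u * v\<bar> \<le> x ^ 4 + y ^ 4 + u ^ 4 + v ^ 4" for x y u v :: real
  proof -
    have sq: "(x * y)\<^sup>2 \<le> x ^ 4 + y ^ 4" for x y :: real
      using amgm[of "x\<^sup>2" "y\<^sup>2"] by (simp add: power_mult_distrib)
    have "\<bar>x * y * u * v\<bar> \<le> (x * y)\<^sup>2 + (u * v)\<^sup>2" using amgm[of "x * y" "u * v"] by (simp add: mult.assoc)
    then show ?thesis using sq[of x y] sq[of u v] by linarith
  qed
  then show "AE \<omega> in M. norm (a \<omega> * b \<omega> * c \<omega> * d \<omega>)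
      \<le> norm (norm (a \<omega>) ^ 4 + norm (b \<omega>) ^ 4 + norm (c \<omega>) ^ 4 + norm (d \<omega>) ^ 4)"
    by (intro AE_I2) (simp add: abs_of_nonneg)
qed (use assms in \<open>auto simp: fourth_moment_def\<close>)

lemma fourth_moment_integrable:
  assumes "prob_space M" "fourth_moment M f"
  shows "integrable M f" "integrable M (\<lambda>\<omega>. norm (f \<omega>))" "integrable M (\<lambda>\<omega>. (norm (f \<omega>))\<^sup>2)"
proof -
  note c = fourth_moment_const[OF assms(1), of "1 :: real"]
  show "integrable M (\<lambda>\<omega>. (norm (f \<omega>))\<^sup>2)"
    using fourth_moment_prod4[OF fourth_moment_norm fourth_moment_norm c c, OF assms(2,2)]
    by (simp add: power2_eq_square)
  show i: "integrable M (\<lambda>\<omega>. norm (f \<omega>))"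
    using fourth_moment_prod4[OF fourth_moment_norm c c c, OF assms(2)] by simp
  show "integrable M f"
    using i fourth_momentD[OF assms(2)] by (simp add: integrable_norm_iff)
qed

lemma fourth_moment_lipschitz:
  fixes g :: "'a::euclidean_space \<Rightarrow> 'a"
  assumes M: "prob_space M" and f: "fourth_moment M f" and lip: "\<And>u v. norm (g u - g v) \<le> K * norm (u - v)"
  shows "fourth_moment M (\<lambda>\<omega>. g (f \<omega>))"
proof -
  have K: "norm (g u - g v) \<le> \<bar>K\<bar> * norm (u - v)" for u v
    using lip[of u v] by (intro order_trans[OF lip] mult_right_mono) auto
  have "continuous_on UNIV g"
    using K by (intro lipschitz_on_continuous_on[of "\<bar>K\<bar>"] lipschitz_onI) (auto simp: dist_norm)
  then have m: "(\<lambda>\<omega>. g (f \<omega>)) \<in> borel_measurable M"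
    using fourth_momentD(1)[OF f] borel_measurable_continuous_onI by (intro measurable_compose[of f M borel g])
  have b: "fourth_moment M (\<lambda>\<omega>. \<bar>K\<bar> *\<^sub>R norm (f \<omega>) + norm (g 0))"
    by (intro fourth_moment_add fourth_moment_scaleR fourth_moment_norm f fourth_moment_const M)
  show ?thesis
  proof (rule fourth_moment_bound[OF m b])
    fix \<omega>
    have "norm (g (f \<omega>)) \<le> norm (g (f \<omega>) - g 0) + norm (g 0)" by norm
    also have "\<dots> \<le> \<bar>K\<bar> * norm (f \<omega>) + norm (g 0)" using K[of "f \<omega>" 0] by simp
    finally show "norm (g (f \<omega>)) \<le> norm (\<bar>K\<bar> *\<^sub>R norm (f \<omega>) + norm (g 0))" by simp
  qed
qed

text \<open>The term of first order in \<open>\<mu>\<close> is kept exactly, since it vanishes in conditional expectation.\<close>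

lemma norm_diff_power4_le:
  fixes y v :: "'a::real_inner"
  assumes "0 \<le> \<mu>"
  shows "norm (y - \<mu> *\<^sub>R v) ^ 4 \<le> norm y ^ 4 - 4 * \<mu> * ((norm y)\<^sup>2 * (y \<bullet> v))
    + 8 * \<mu>\<^sup>2 * ((norm y)\<^sup>2 * (norm v)\<^sup>2) + 3 * \<mu> ^ 4 * norm v ^ 4"
proof -
  define Q where "Q = (norm y)\<^sup>2"
  define b where "b = y \<bullet> v"
  define N where "N = (norm v)\<^sup>2"
  have cs: "b\<^sup>2 \<le> Q * N"
    using Cauchy_Schwarz_ineq[of y v] by (simp add: b_def Q_def N_def power2_norm_eq_inner)
  have "(norm (y - \<mu> *\<^sub>R v))\<^sup>2 = Q - 2 * \<mu> * b + \<mu>\<^sup>2 * N"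
    unfolding Q_def b_def N_def power2_norm_eq_inner
    by (simp add: inner_diff_left inner_diff_right inner_commute power2_eq_square)
  then have "norm (y - \<mu> *\<^sub>R v) ^ 4 = (Q - 2 * \<mu> * b + \<mu>\<^sup>2 * N)\<^sup>2"
    by (metis power2_eq_square power4_eq_xxxx mult.assoc)
  also have "\<dots> = Q\<^sup>2 - 4 * \<mu> * (Q * b) + 4 * \<mu>\<^sup>2 * b\<^sup>2 + 2 * \<mu>\<^sup>2 * (Q * N) + \<mu> ^ 4 * N\<^sup>2
      - 4 * \<mu> ^ 3 * b * N"
    by (simp add: eval_nat_numeral algebra_simps)
  \<comment> \<open>The term of odd order has no sign; a completed square moves it into the
    neighbouring even ones. This raises their coefficients from 4 to 6 and from 1 to 3, and
    Cauchy-Schwarz turns the 6 into part of the final 8.\<close>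
  also have "- (4 * \<mu> ^ 3 * b * N) \<le> 2 * \<mu>\<^sup>2 * b\<^sup>2 + 2 * \<mu> ^ 4 * N\<^sup>2"
  proof -
    have "0 \<le> 2 * (\<mu> * b + \<mu>\<^sup>2 * N)\<^sup>2" by simp
    also have "\<dots> = 2 * \<mu>\<^sup>2 * b\<^sup>2 + 2 * \<mu> ^ 4 * N\<^sup>2 + 4 * \<mu> ^ 3 * b * N"
      by (simp add: eval_nat_numeral algebra_simps)
    finally show ?thesis by linarith
  qed
  then have "Q\<^sup>2 - 4 * \<mu> * (Q * b) + 4 * \<mu>\<^sup>2 * b\<^sup>2 + 2 * \<mu>\<^sup>2 * (Q * N) + \<mu> ^ 4 * N\<^sup>2 - 4 * \<mu> ^ 3 * b * N
      \<le> Q\<^sup>2 - 4 * \<mu> * (Q * b) + 6 * \<mu>\<^sup>2 * b\<^sup>2 + 2 * \<mu>\<^sup>2 * (Q * N) + 3 * \<mu> ^ 4 * N\<^sup>2" by linarith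
  also have "6 * \<mu>\<^sup>2 * b\<^sup>2 \<le> 6 * \<mu>\<^sup>2 * (Q * N)" using cs by (intro mult_left_mono) auto
  finally show ?thesis by (simp add: Q_def b_def N_def algebra_simps)
qed

text \<open>The conditional moment bounds on the noise, tested against \<open>F i\<close>-measurable functions; \<open>B\<close> is
  a common bound for the noise parameters.\<close>

definition noisy_agent :: "'w measure \<Rightarrow> (nat \<Rightarrow> 'w measure) \<Rightarrow> 'a::euclidean_space \<Rightarrow> real
    \<Rightarrow> (nat \<Rightarrow> 'w \<Rightarrow> 'a) \<Rightarrow> (nat \<Rightarrow> 'w \<Rightarrow> 'a) \<Rightarrow> bool" where
  "noisy_agent M F ws B w s \<longleftrightarrow>
    (\<forall>i. fourth_moment M (w i) \<and> fourth_moment M (s i) \<and> w i \<in> borel_measurable (F i) \<and>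
      (\<forall>b\<in>Basis. \<forall>f\<in>borel_measurable (F i). integrable M (\<lambda>\<omega>. f \<omega> * (s i \<omega> \<bullet> b)) \<longrightarrow>
        (\<integral>\<omega>. f \<omega> * (s i \<omega> \<bullet> b) \<partial>M) = 0) \<and>
      (\<forall>f\<in>borel_measurable (F i). (\<forall>\<omega>. 0 \<le> f \<omega>) \<longrightarrow> integrable M f \<longrightarrow>
        integrable M (\<lambda>\<omega>. f \<omega> * (norm (ws - w i \<omega>))\<^sup>2) \<longrightarrow>
        (\<integral>\<omega>. f \<omega> * (norm (s i \<omega>))\<^sup>2 \<partial>M) \<le> B * (\<integral>\<omega>. f \<omega> * (1 + (norm (ws - w i \<omega>))\<^sup>2) \<partial>M)) \<and>
      (\<integral>\<omega>. norm (s i \<omega>) ^ 4 \<partial>M) \<le> B * (1 + (\<integral>\<omega>. norm (ws - w i \<omega>) ^ 4 \<partial>M)))"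

definition noisy_run :: "'w measure \<Rightarrow> (nat \<Rightarrow> 'w measure) \<Rightarrow> nat \<Rightarrow> (nat \<Rightarrow> 'a::euclidean_space) \<Rightarrow> real
    \<Rightarrow> (nat \<Rightarrow> nat \<Rightarrow> 'w \<Rightarrow> 'a) \<Rightarrow> (nat \<Rightarrow> nat \<Rightarrow> 'w \<Rightarrow> 'a) \<Rightarrow> bool" where
  "noisy_run M F n ws B w s \<longleftrightarrow> prob_space M \<and> (\<forall>k<n. noisy_agent M F (ws k) B (w k) (s k))"

section \<open>Moment recursions along a run of one sub-network\<close>

context diffusion_block
begin

text \<open>\<open>D\<close> is an abstract function on all of \<open>nat\<close>; that it sees only
  the indices below \<open>n\<close> follows because \<open>D_bound\<close> makes it vanish on
  differences that are zero there.\<close>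

lemma D_cong:
  assumes "\<And>l. l < n \<Longrightarrow> x l = y l" shows "D x = D y"
proof -
  have "D x \<le> D y" if "\<And>l. l < n \<Longrightarrow> x l = y l" for x y
    using D_add[of y "\<lambda>l. x l - y l"] D_bound[of "\<lambda>l. x l - y l"] that by simp
  from this[of x y] this[of y x] show ?thesis using assms by fastforce
qed

text \<open>Fixed before a run is considered, so that the final bounds are uniform in the run and in \<open>\<mu>\<close>.\<close>

definition D_const :: real where
  "D_const = (SOME C. C > 0 \<and> (\<forall>\<mu> s x. 0 < \<mu> \<longrightarrow> D (step \<mu> s x) ^ 4
     \<le> r * D x ^ 4 + C * \<mu> ^ 4 * (1 + norm (cen x) ^ 4 + D x ^ 4 + (\<Sum>l<n. norm (s l) ^ 4))))"

lemma D_const: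
  "D_const > 0"
  "0 < \<mu> \<Longrightarrow> D (step \<mu> s x) ^ 4
     \<le> r * D x ^ 4 + D_const * \<mu> ^ 4 * (1 + norm (cen x) ^ 4 + D x ^ 4 + (\<Sum>l<n. norm (s l) ^ 4))"
  using someI_ex[OF D_step_power4[unfolded Bex_def]] unfolding D_const_def by blast+

end

locale block_run = diffusion_block n a p \<tau> grad ws D K r \<nu> H dummy + prob_space M
  for n a p \<tau> and grad :: "nat \<Rightarrow> 'a::euclidean_space \<Rightarrow> 'a" and ws D K r \<nu> H
    and dummy :: "'w itself" and M :: "'w measure" +
  fixes F :: "nat \<Rightarrow> 'w measure" and w s :: "nat \<Rightarrow> nat \<Rightarrow> 'w \<Rightarrow> 'a" and B \<mu> :: real
  assumes noisy: "noisy_run M F n (\<lambda>_. ws) B w s" and B: "0 \<le> B"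
    and \<mu>: "0 < \<mu>" "\<mu> \<le> 1" "\<mu> * K\<^sup>2 \<le> \<nu>" "\<mu> * \<nu> \<le> 2"
    and rec: "k < n \<Longrightarrow> \<omega> \<in> space M \<Longrightarrow>
      w k (Suc i) \<omega> = step \<mu> (\<lambda>l. s l i \<omega>) (\<lambda>l. w l i \<omega>) k"
begin

definition W :: "nat \<Rightarrow> 'w \<Rightarrow> nat \<Rightarrow> 'a" where "W i \<omega> l = w l i \<omega>"
definition Z :: "nat \<Rightarrow> 'w \<Rightarrow> nat \<Rightarrow> 'a" where "Z i \<omega> l = s l i \<omega>"
definition X :: "nat \<Rightarrow> real" where "X i = (\<integral>\<omega>. norm (cen (W i \<omega>)) ^ 4 \<partial>M)"
definition Y :: "nat \<Rightarrow> real" where "Y i = (\<integral>\<omega>. D (W i \<omega>) ^ 4 \<partial>M)"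

lemma noisyD:
  assumes "k < n"
  shows "fourth_moment M (w k i)" "fourth_moment M (s k i)" "w k i \<in> borel_measurable (F i)"
    "b \<in> Basis \<Longrightarrow> f \<in> borel_measurable (F i) \<Longrightarrow> integrable M (\<lambda>\<omega>. f \<omega> * (s k i \<omega> \<bullet> b)) \<Longrightarrow>
        (\<integral>\<omega>. f \<omega> * (s k i \<omega> \<bullet> b) \<partial>M) = 0"
    "f \<in> borel_measurable (F i) \<Longrightarrow> (\<And>\<omega>. 0 \<le> f \<omega>) \<Longrightarrow> integrable M f \<Longrightarrow>
        integrable M (\<lambda>\<omega>. f \<omega> * (norm (ws - w k i \<omega>))\<^sup>2) \<Longrightarrow>
        (\<integral>\<omega>. f \<omega> * (norm (s k i \<omega>))\<^sup>2 \<partial>M) \<le> B * (\<integral>\<omega>. f \<omega> * (1 + (norm (ws - w k i \<omega>))\<^sup>2) \<partial>M)"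
    "(\<integral>\<omega>. norm (s k i \<omega>) ^ 4 \<partial>M) \<le> B * (1 + (\<integral>\<omega>. norm (ws - w k i \<omega>) ^ 4 \<partial>M))"
  using noisy assms unfolding noisy_run_def noisy_agent_def by auto

lemma ps: "prob_space M" by unfold_locales

lemma W_Suc: "\<omega> \<in> space M \<Longrightarrow> k < n \<Longrightarrow> W (Suc i) \<omega> k = step \<mu> (Z i \<omega>) (W i \<omega>) k"
  using rec by (simp add: W_def[abs_def] Z_def[abs_def])

lemma cen_Suc: "\<omega> \<in> space M \<Longrightarrow> cen (W (Suc i) \<omega>) = drift \<mu> (W i \<omega>) - \<mu> *\<^sub>R avg_noise (Z i \<omega>)"
  using cen_step[of \<mu> "Z i \<omega>" "W i \<omega>"] by (simp add: cen_def W_Suc)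

lemma D_Suc: "\<omega> \<in> space M \<Longrightarrow> D (W (Suc i) \<omega>) = D (step \<mu> (Z i \<omega>) (W i \<omega>))"
  by (intro D_cong W_Suc)

lemma fm_cen: "fourth_moment M (\<lambda>\<omega>. cen (W i \<omega>))"
  unfolding cen_def W_def
  by (intro fourth_moment_diff fourth_moment_sum fourth_moment_scaleR fourth_moment_const ps noisyD) auto

lemma fm_grad: "k < n \<Longrightarrow> fourth_moment M (\<lambda>\<omega>. grad k (W i \<omega> k))"
  unfolding W_def by (rule fourth_moment_lipschitz[OF ps noisyD(1) grad_lip])

lemma fm_drift: "fourth_moment M (\<lambda>\<omega>. drift \<mu> (W i \<omega>))"
  unfolding drift_def
  by (intro fourth_moment_diff fourth_moment_sum fourth_moment_scaleR ps fm_grad fm_cen) auto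

lemma fm_noise: "fourth_moment M (\<lambda>\<omega>. avg_noise (Z i \<omega>))"
  unfolding avg_noise_def Z_def
  by (intro fourth_moment_sum fourth_moment_scaleR ps noisyD) auto

lemma fm_err: "k < n \<Longrightarrow> fourth_moment M (\<lambda>\<omega>. ws - w k i \<omega>)"
  by (intro fourth_moment_diff fourth_moment_const ps noisyD)

lemma fm_D: "fourth_moment M (\<lambda>\<omega>. D (W i \<omega>))"
proof (rule fourth_moment_bound)
  show "(\<lambda>\<omega>. D (W i \<omega>)) \<in> borel_measurable M"
    unfolding W_def[abs_def] using fourth_momentD(1)[OF noisyD(1)] by (intro D_meas)
  show "fourth_moment M (\<lambda>\<omega>. K *\<^sub>R (\<Sum>l<n. norm (w l i \<omega>)))"
    by (intro fourth_moment_scaleR fourth_moment_sum fourth_moment_norm noisyD ps) auto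
  show "norm (D (W i \<omega>)) \<le> norm (K *\<^sub>R (\<Sum>l<n. norm (w l i \<omega>)))" for \<omega>
    using D_bound[of "W i \<omega>"] D_nonneg[of "W i \<omega>"] by (simp add: W_def)
qed

text \<open>This admits powers of the drift as test functions for the noise of step
  \<open>i\<close>.\<close>

lemma drift_F: "(\<lambda>\<omega>. drift \<mu> (W i \<omega>)) \<in> borel_measurable (F i)"
proof -
  have "continuous_on UNIV (grad k)" if "k < n" for k
    using grad_lip[OF that] K
    by (intro lipschitz_on_continuous_on[of K] lipschitz_onI) (auto simp: dist_norm)
  then have "(\<lambda>\<omega>. grad k (w k i \<omega>)) \<in> borel_measurable (F i)" if "k < n" for k
    using that noisyD(3) borel_measurable_continuous_onI by (intro measurable_compose[of "w k i" "F i" borel "grad k"]) auto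
  then show ?thesis unfolding drift_def cen_def W_def using noisyD(3)
    by (intro borel_measurable_diff borel_measurable_scaleR borel_measurable_sum borel_measurable_const) auto
qed

text \<open>The noise is centred coordinate by coordinate, so a vector-valued test function is
  expanded over \<open>Basis\<close>.\<close>

lemma noise_test_zero:
  fixes f :: "'w \<Rightarrow> 'a"
  assumes "f \<in> borel_measurable (F i)" "\<And>k b. k < n \<Longrightarrow> b \<in> Basis \<Longrightarrow> integrable M (\<lambda>\<omega>. (f \<omega> \<bullet> b) * (s k i \<omega> \<bullet> b))"
  shows "integrable M (\<lambda>\<omega>. f \<omega> \<bullet> avg_noise (Z i \<omega>))" "(\<integral>\<omega>. f \<omega> \<bullet> avg_noise (Z i \<omega>) \<partial>M) = 0"
proof -
  have eq: "f \<omega> \<bullet> avg_noise (Z i \<omega>)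
      = (\<Sum>k<n. (p k * \<tau> k) * (\<Sum>b\<in>Basis. (f \<omega> \<bullet> b) * (s k i \<omega> \<bullet> b)))" for \<omega>
    unfolding avg_noise_def Z_def inner_sum_right inner_scaleR_right
    by (intro sum.cong refl arg_cong2[where f = "(*)"] euclidean_inner)
  show "integrable M (\<lambda>\<omega>. f \<omega> \<bullet> avg_noise (Z i \<omega>))"
    unfolding eq using assms by (intro Bochner_Integration.integrable_sum integrable_mult_right) auto
  have "(\<integral>\<omega>. f \<omega> \<bullet> avg_noise (Z i \<omega>) \<partial>M)
      = (\<Sum>k<n. (p k * \<tau> k) * (\<Sum>b\<in>Basis. \<integral>\<omega>. (f \<omega> \<bullet> b) * (s k i \<omega> \<bullet> b) \<partial>M))"
    unfolding eq using assms by (simp add: Bochner_Integration.integral_sum)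
  also have "\<dots> = 0"
    using assms noisyD(4)[of _ _ "\<lambda>\<omega>. f \<omega> \<bullet> _"] by (intro sum.neutral ballI) simp
  finally show "(\<integral>\<omega>. f \<omega> \<bullet> avg_noise (Z i \<omega>) \<partial>M) = 0" .
qed

lemma err4: assumes "k < n" shows "(\<integral>\<omega>. norm (ws - w k i \<omega>) ^ 4 \<partial>M) \<le> 8 * K ^ 4 * (X i + Y i)"
proof -
  have "norm (ws - w k i \<omega>) ^ 4 \<le> 8 * K ^ 4 * (norm (cen (W i \<omega>)) ^ 4 + D (W i \<omega>) ^ 4)" for \<omega>
  proof -
    have "norm (ws - w k i \<omega>) \<le> norm (cen (W i \<omega>)) + K * D (W i \<omega>)"
      using error_le[OF assms, of "W i \<omega>"] by (simp add: W_def norm_minus_commute)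
    then have "norm (ws - w k i \<omega>) ^ 4 \<le> (norm (cen (W i \<omega>)) + K * D (W i \<omega>)) ^ 4"
      by (intro power_mono) auto
    also have "\<dots> \<le> 8 * (1 * norm (cen (W i \<omega>)) ^ 4 + K ^ 4 * D (W i \<omega>) ^ 4)"
      using add_power4_le[of "norm (cen (W i \<omega>))" "K * D (W i \<omega>)"] by (simp add: power_mult_distrib)
    also have "\<dots> \<le> 8 * (K ^ 4 * norm (cen (W i \<omega>)) ^ 4 + K ^ 4 * D (W i \<omega>) ^ 4)"
      using K by (intro mult_left_mono add_mono mult_right_mono) auto
    finally show ?thesis by (simp add: algebra_simps)
  qed
  then have "(\<integral>\<omega>. norm (ws - w k i \<omega>) ^ 4 \<partial>M)
      \<le> (\<integral>\<omega>. 8 * K ^ 4 * (norm (cen (W i \<omega>)) ^ 4 + D (W i \<omega>) ^ 4) \<partial>M)"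
    using fourth_momentD(2)[OF fm_err[OF assms]] fourth_momentD(2)[OF fm_cen] fourth_momentD(2)[OF fm_D] D_nonneg
    by (intro integral_mono) auto
  also have "\<dots> = 8 * K ^ 4 * (X i + Y i)"
    using fourth_momentD(2)[OF fm_cen] fourth_momentD(2)[OF fm_D] D_nonneg by (simp add: X_def Y_def)
  finally show ?thesis .
qed

lemma XY_nonneg: "0 \<le> X i" "0 \<le> Y i"
  by (simp_all add: X_def Y_def integral_nonneg_AE)

lemma noise4: assumes "k < n" shows "(\<integral>\<omega>. norm (s k i \<omega>) ^ 4 \<partial>M) \<le> 8 * B * K ^ 4 * (1 + X i + Y i)"
proof -
  have "1 \<le> 8 * K ^ 4" using K one_le_power[of K 4] by linarith
  then have "1 + (\<integral>\<omega>. norm (ws - w k i \<omega>) ^ 4 \<partial>M) \<le> 8 * K ^ 4 * (1 + X i + Y i)"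
    using err4[OF assms, of i] by (simp add: distrib_left)
  then show ?thesis using noisyD(6)[OF assms, of i] B
    by (auto intro: order_trans mult_left_mono simp: mult.assoc mult.left_commute[of 8])
qed

lemma Y_step: "Y (Suc i) \<le> r * Y i + D_const * (1 + 8 * n * B * K ^ 4) * \<mu> ^ 4 * (1 + X i + Y i)"
proof -
  have int: "integrable M (\<lambda>\<omega>. norm (cen (W i \<omega>)) ^ 4)" "integrable M (\<lambda>\<omega>. D (W i \<omega>) ^ 4)" for i
    using fourth_momentD(2)[OF fm_cen, of i] fourth_momentD(2)[OF fm_D, of i] by simp_all
  have ints: "integrable M (\<lambda>\<omega>. norm (s l i \<omega>) ^ 4)" if "l < n" for l
    using fourth_momentD(2) noisyD(2) that by blast
  then have intS: "integrable M (\<lambda>\<omega>. \<Sum>l<n. norm (s l i \<omega>) ^ 4)"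
    by (intro Bochner_Integration.integrable_sum) auto
  have "Y (Suc i) \<le> (\<integral>\<omega>. r * D (W i \<omega>) ^ 4 + D_const * \<mu> ^ 4 *
      (1 + norm (cen (W i \<omega>)) ^ 4 + D (W i \<omega>) ^ 4 + (\<Sum>l<n. norm (s l i \<omega>) ^ 4)) \<partial>M)"
    unfolding Y_def
  proof (rule integral_mono)
    fix \<omega> assume "\<omega> \<in> space M"
    then show "D (W (Suc i) \<omega>) ^ 4 \<le> r * D (W i \<omega>) ^ 4 + D_const * \<mu> ^ 4 *
      (1 + norm (cen (W i \<omega>)) ^ 4 + D (W i \<omega>) ^ 4 + (\<Sum>l<n. norm (s l i \<omega>) ^ 4))"
      using D_const(2)[OF \<mu>(1), of "Z i \<omega>" "W i \<omega>"] by (simp add: D_Suc Z_def)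
  qed (use int intS in auto)
  also have "\<dots> = r * Y i + D_const * \<mu> ^ 4 * (1 + X i + Y i + (\<Sum>l<n. \<integral>\<omega>. norm (s l i \<omega>) ^ 4 \<partial>M))"
    using int intS ints by (simp add: X_def Y_def prob_space Bochner_Integration.integral_sum)
  also have "\<dots> \<le> r * Y i + D_const * \<mu> ^ 4 * (1 + X i + Y i + n * (8 * B * K ^ 4 * (1 + X i + Y i)))"
    using D_const(1) \<mu> sum_bounded_above[of "{..<n}" "\<lambda>l. \<integral>\<omega>. norm (s l i \<omega>) ^ 4 \<partial>M"] noise4
    by (intro add_left_mono mult_left_mono) auto
  finally show ?thesis by (simp add: algebra_simps)
qed

lemma drift4:
  "(\<integral>\<omega>. norm (drift \<mu> (W i \<omega>)) ^ 4 \<partial>M) \<le> (1 - \<nu> / 2 * \<mu>) * X i + K ^ 8 / (\<nu> / 2) ^ 3 * \<mu> * Y i"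
proof -
  have int: "integrable M (\<lambda>\<omega>. norm (cen (W i \<omega>)) ^ 4)" "integrable M (\<lambda>\<omega>. D (W i \<omega>) ^ 4)"
    using fourth_momentD(2)[OF fm_cen, of i] fourth_momentD(2)[OF fm_D, of i] by simp_all
  have "(\<integral>\<omega>. norm (drift \<mu> (W i \<omega>)) ^ 4 \<partial>M) \<le> (\<integral>\<omega>. (1 - \<nu> / 2 * \<mu>) * norm (cen (W i \<omega>)) ^ 4
      + K ^ 8 / (\<nu> / 2) ^ 3 * \<mu> * D (W i \<omega>) ^ 4 \<partial>M)"
    using int fourth_momentD(2)[OF fm_drift]
    by (intro integral_mono drift_power4 \<mu> Bochner_Integration.integrable_add integrable_mult_right) auto
  then show ?thesis using int by (simp add: X_def Y_def)
qed

text \<open>Tested against the squared drift, the conditional second moment of the noise is replaced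
  by the current error. The resulting product of squares is split into fourth moments, which the two
  unknowns \<open>X\<close> and \<open>Y\<close> control.\<close>

lemma drift2_noise2:
  assumes "k < n"
  shows "(\<integral>\<omega>. (norm (drift \<mu> (W i \<omega>)))\<^sup>2 * (norm (s k i \<omega>))\<^sup>2 \<partial>M)
    \<le> B * ((\<integral>\<omega>. (norm (drift \<mu> (W i \<omega>)))\<^sup>2 \<partial>M) + (\<integral>\<omega>. norm (drift \<mu> (W i \<omega>)) ^ 4 \<partial>M)
      + 8 * K ^ 4 * (X i + Y i))"
proof -
  let ?y = "\<lambda>\<omega>. drift \<mu> (W i \<omega>)" and ?e = "\<lambda>\<omega>. ws - w k i \<omega>"
  note y = fm_drift[of i] and e = fm_err[OF assms, of i]
  have int: "integrable M (\<lambda>\<omega>. (norm (?y \<omega>))\<^sup>2 * (norm (?e \<omega>))\<^sup>2)"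
    using fourth_moment_prod4[OF y[THEN fourth_moment_norm] y[THEN fourth_moment_norm]
        e[THEN fourth_moment_norm] e[THEN fourth_moment_norm]]
    by (simp add: power2_eq_square mult.assoc)
  note y2 = fourth_moment_integrable(3)[OF ps y]
  have "(\<integral>\<omega>. (norm (?y \<omega>))\<^sup>2 * (norm (s k i \<omega>))\<^sup>2 \<partial>M)
      \<le> B * (\<integral>\<omega>. (norm (?y \<omega>))\<^sup>2 * (1 + (norm (?e \<omega>))\<^sup>2) \<partial>M)"
    using drift_F[of i] int y2
    by (intro noisyD(5) assms borel_measurable_power measurable_compose[OF _ borel_measurable_norm]) auto
  also have "(\<integral>\<omega>. (norm (?y \<omega>))\<^sup>2 * (1 + (norm (?e \<omega>))\<^sup>2) \<partial>M)
      \<le> (\<integral>\<omega>. (norm (?y \<omega>))\<^sup>2 + (norm (?y \<omega>) ^ 4 + norm (?e \<omega>) ^ 4) \<partial>M)"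
  proof (rule integral_mono)
    fix \<omega>
    have "2 * (norm (?y \<omega>))\<^sup>2 * (norm (?e \<omega>))\<^sup>2 \<le> norm (?y \<omega>) ^ 4 + norm (?e \<omega>) ^ 4"
      using sum_squares_bound[of "(norm (?y \<omega>))\<^sup>2" "(norm (?e \<omega>))\<^sup>2"] by simp
    moreover have "0 \<le> (norm (?y \<omega>))\<^sup>2 * (norm (?e \<omega>))\<^sup>2" by simp
    ultimately show "(norm (?y \<omega>))\<^sup>2 * (1 + (norm (?e \<omega>))\<^sup>2)
        \<le> (norm (?y \<omega>))\<^sup>2 + (norm (?y \<omega>) ^ 4 + norm (?e \<omega>) ^ 4)"
      unfolding distrib_left by linarith
  qed (use int y2 fourth_momentD(2)[OF y] fourth_momentD(2)[OF e] in \<open>auto simp: distrib_left\<close>)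
  also have "\<dots> = (\<integral>\<omega>. (norm (?y \<omega>))\<^sup>2 \<partial>M) + (\<integral>\<omega>. norm (?y \<omega>) ^ 4 \<partial>M) + (\<integral>\<omega>. norm (?e \<omega>) ^ 4 \<partial>M)"
    using y2 fourth_momentD(2)[OF y] fourth_momentD(2)[OF e] by simp
  also have "\<dots> \<le> (\<integral>\<omega>. (norm (?y \<omega>))\<^sup>2 \<partial>M) + (\<integral>\<omega>. norm (?y \<omega>) ^ 4 \<partial>M) + 8 * K ^ 4 * (X i + Y i)"
    using err4[OF assms] by simp
  finally show ?thesis using B by (simp add: mult_left_mono)
qed

text \<open>Integrates \<open>norm_diff_power4_le\<close>. The first-order term vanishes because the
  squared norm of the drift times the drift is \<open>F i\<close>-measurable. The noises of the
  agents are added by Cauchy-Schwarz, whence the factors \<open>n\<^sup>2\<close> and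
  \<open>n ^ 4\<close>. The second moment of the drift is still left to be absorbed.\<close>

lemma X_step_raw:
  defines "y2 \<equiv> \<lambda>i. \<integral>\<omega>. (norm (drift \<mu> (W i \<omega>)))\<^sup>2 \<partial>M"
  defines "y4 \<equiv> \<lambda>i. \<integral>\<omega>. norm (drift \<mu> (W i \<omega>)) ^ 4 \<partial>M"
  shows "X (Suc i) \<le> y4 i + 8 * n\<^sup>2 * B * \<mu>\<^sup>2 * (y2 i + y4 i + 8 * K ^ 4 * (X i + Y i))
    + 24 * n ^ 4 * B * K ^ 4 * \<mu> ^ 4 * (1 + X i + Y i)"
proof -
  let ?y = "\<lambda>\<omega>. drift \<mu> (W i \<omega>)" and ?v = "\<lambda>\<omega>. avg_noise (Z i \<omega>)"
  note y = fm_drift[of i] and v = fm_noise[of i]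
  have ns: "norm (?v \<omega>) \<le> (\<Sum>k<n. norm (s k i \<omega>))" for \<omega>
    unfolding avg_noise_def Z_def using weight
    by (intro sum_norm_le) (auto intro!: mult_left_le_one_le simp: abs_mult \<tau> p)
  have v2: "(norm (?v \<omega>))\<^sup>2 \<le> n * (\<Sum>k<n. (norm (s k i \<omega>))\<^sup>2)" for \<omega>
    using power_mono[OF ns, of \<omega> 2] sum_squared_le_sum_of_squares[of "\<lambda>k. norm (s k i \<omega>)" "{..<n}"]
    by (simp add: mult.commute)
  have v4: "norm (?v \<omega>) ^ 4 \<le> n ^ 3 * (\<Sum>k<n. norm (s k i \<omega>) ^ 4)" for \<omega>
    using power_mono[OF ns, of \<omega> 4] sum_power4_le[of "\<lambda>k. norm (s k i \<omega>)" "{..<n}"] by simp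
  have int2: "integrable M (\<lambda>\<omega>. (norm (?y \<omega>))\<^sup>2 * (norm (s k i \<omega>))\<^sup>2)" if "k < n" for k
    using fourth_moment_prod4[OF y[THEN fourth_moment_norm] y[THEN fourth_moment_norm]
        noisyD(2)[OF that, THEN fourth_moment_norm] noisyD(2)[OF that, THEN fourth_moment_norm]]
    by (simp add: power2_eq_square mult.assoc)
  have int4: "integrable M (\<lambda>\<omega>. norm (s k i \<omega>) ^ 4)" if "k < n" for k
    using fourth_momentD(2) noisyD(2) that by blast
  have cross: "integrable M (\<lambda>\<omega>. (norm (?y \<omega>))\<^sup>2 * (?y \<omega> \<bullet> ?v \<omega>))"
    "(\<integral>\<omega>. (norm (?y \<omega>))\<^sup>2 * (?y \<omega> \<bullet> ?v \<omega>) \<partial>M) = 0"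
  proof -
    have inn: "fourth_moment M (\<lambda>\<omega>. f \<omega> \<bullet> b)" if "fourth_moment M f" "b \<in> Basis" for f :: "'w \<Rightarrow> 'a" and b
      using that by (intro fourth_moment_bound[OF _ that(1)])
        (auto simp: fourth_moment_def Basis_le_norm)
    have "integrable M (\<lambda>\<omega>. (((norm (?y \<omega>))\<^sup>2 *\<^sub>R ?y \<omega>) \<bullet> b) * (s k i \<omega> \<bullet> b))" if "k < n" "b \<in> Basis" for k b
      using fourth_moment_prod4[OF y[THEN fourth_moment_norm] y[THEN fourth_moment_norm]
        inn[OF y that(2)] inn[OF noisyD(2)[OF that(1), of i] that(2)]]
      by (simp add: power2_eq_square mult.assoc)
    moreover have "(\<lambda>\<omega>. (norm (?y \<omega>))\<^sup>2 *\<^sub>R ?y \<omega>) \<in> borel_measurable (F i)"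
      using drift_F[of i]
      by (intro borel_measurable_scaleR borel_measurable_power measurable_compose[OF _ borel_measurable_norm]) auto
    ultimately show "integrable M (\<lambda>\<omega>. (norm (?y \<omega>))\<^sup>2 * (?y \<omega> \<bullet> ?v \<omega>))"
      "(\<integral>\<omega>. (norm (?y \<omega>))\<^sup>2 * (?y \<omega> \<bullet> ?v \<omega>) \<partial>M) = 0"
      using noise_test_zero[of "\<lambda>\<omega>. (norm (?y \<omega>))\<^sup>2 *\<^sub>R ?y \<omega>" i] by simp_all
  qed
  have S2: "integrable M (\<lambda>\<omega>. \<Sum>k<n. (norm (?y \<omega>))\<^sup>2 * (norm (s k i \<omega>))\<^sup>2)"
    using int2 by (intro Bochner_Integration.integrable_sum) auto
  have S4: "integrable M (\<lambda>\<omega>. \<Sum>k<n. norm (s k i \<omega>) ^ 4)"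
    using int4 by (intro Bochner_Integration.integrable_sum) auto
  note Y4 = fourth_momentD(2)[OF y]
  have "X (Suc i) \<le> (\<integral>\<omega>. norm (?y \<omega>) ^ 4 - 4 * \<mu> * ((norm (?y \<omega>))\<^sup>2 * (?y \<omega> \<bullet> ?v \<omega>))
    + 8 * \<mu>\<^sup>2 * n * (\<Sum>k<n. (norm (?y \<omega>))\<^sup>2 * (norm (s k i \<omega>))\<^sup>2)
    + 3 * \<mu> ^ 4 * n ^ 3 * (\<Sum>k<n. norm (s k i \<omega>) ^ 4) \<partial>M)"
    unfolding X_def
  proof (rule integral_mono)
    fix \<omega> assume \<omega>: "\<omega> \<in> space M"
    have "norm (cen (W (Suc i) \<omega>)) ^ 4 \<le> norm (?y \<omega>) ^ 4 - 4 * \<mu> * ((norm (?y \<omega>))\<^sup>2 * (?y \<omega> \<bullet> ?v \<omega>))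
      + 8 * \<mu>\<^sup>2 * ((norm (?y \<omega>))\<^sup>2 * (norm (?v \<omega>))\<^sup>2) + 3 * \<mu> ^ 4 * norm (?v \<omega>) ^ 4"
      unfolding cen_Suc[OF \<omega>] using \<mu> by (intro norm_diff_power4_le) simp
    also have "\<dots> \<le> norm (?y \<omega>) ^ 4 - 4 * \<mu> * ((norm (?y \<omega>))\<^sup>2 * (?y \<omega> \<bullet> ?v \<omega>))
      + 8 * \<mu>\<^sup>2 * ((norm (?y \<omega>))\<^sup>2 * (n * (\<Sum>k<n. (norm (s k i \<omega>))\<^sup>2)))
      + 3 * \<mu> ^ 4 * (n ^ 3 * (\<Sum>k<n. norm (s k i \<omega>) ^ 4))"
      using v2 v4 \<mu> by (intro add_mono mult_left_mono order_refl) auto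
    finally show "norm (cen (W (Suc i) \<omega>)) ^ 4 \<le> norm (?y \<omega>) ^ 4
      - 4 * \<mu> * ((norm (?y \<omega>))\<^sup>2 * (?y \<omega> \<bullet> ?v \<omega>))
      + 8 * \<mu>\<^sup>2 * n * (\<Sum>k<n. (norm (?y \<omega>))\<^sup>2 * (norm (s k i \<omega>))\<^sup>2)
      + 3 * \<mu> ^ 4 * n ^ 3 * (\<Sum>k<n. norm (s k i \<omega>) ^ 4)"
      unfolding sum_distrib_left[symmetric] by (simp add: ac_simps)
  qed (use fourth_momentD(2)[OF fm_cen] Y4 cross S2 S4 in auto)
  also have "\<dots> = y4 i + 8 * \<mu>\<^sup>2 * n * (\<Sum>k<n. \<integral>\<omega>. (norm (?y \<omega>))\<^sup>2 * (norm (s k i \<omega>))\<^sup>2 \<partial>M)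
    + 3 * \<mu> ^ 4 * n ^ 3 * (\<Sum>k<n. \<integral>\<omega>. norm (s k i \<omega>) ^ 4 \<partial>M)"
    using Y4 cross S2 S4 int2 int4 by (simp add: y4_def Bochner_Integration.integral_sum)
  also have "\<dots> \<le> y4 i + 8 * \<mu>\<^sup>2 * n * (n * (B * (y2 i + y4 i + 8 * K ^ 4 * (X i + Y i))))
    + 3 * \<mu> ^ 4 * n ^ 3 * (n * (8 * B * K ^ 4 * (1 + X i + Y i)))"
    using \<mu> sum_bounded_above[of "{..<n}" "\<lambda>k. \<integral>\<omega>. norm (s k i \<omega>) ^ 4 \<partial>M"] noise4
      sum_bounded_above[of "{..<n}" "\<lambda>k. \<integral>\<omega>. (norm (?y \<omega>))\<^sup>2 * (norm (s k i \<omega>))\<^sup>2 \<partial>M"] drift2_noise2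
    by (intro add_mono mult_left_mono order_refl) (auto simp: y2_def y4_def)
  finally show ?thesis by (simp add: ac_simps eval_nat_numeral)
qed

end

text \<open>A sum dominating every coefficient of the two recursions below, because
  \<open>coupled_recursion_eventually\<close> takes a single \<open>K\<close>. It belongs to the
  block and to \<open>B\<close>, hence is fixed before any run.\<close>

definition (in diffusion_block) rate_const :: "real \<Rightarrow> real" where
  "rate_const B = (let Q = 8 * real n ^ 2 * B in
     (1 + \<nu> / 2 + Q) * (K ^ 8 / (\<nu> / 2) ^ 3) + Q + 8 * Q * K ^ 4 + 24 * real n ^ 4 * B * K ^ 4
     + Q\<^sup>2 / \<nu> + D_const * (1 + 8 * real n * B * K ^ 4))"

context block_run
begin

text \<open>The obstacle is \<open>Q * \<mu>\<^sup>2\<close> times the second moment of the drift. A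
  completed square bounds it by \<open>\<nu> / 4 * \<mu>\<close> times the fourth moment plus
  \<open>\<mu> ^ 3 * (Q\<^sup>2 / \<nu>)\<close>, so the rate drops from \<open>\<nu> / 2\<close> to
  \<open>\<nu> / 4\<close>.\<close>

lemma coupled_step:
  "X (Suc i) \<le> (1 - \<nu> / 4 * \<mu>) * X i + rate_const B * \<mu> * Y i
    + rate_const B * \<mu>\<^sup>2 * (X i + Y i) + rate_const B * \<mu> ^ 3"
  "Y (Suc i) \<le> r * Y i + rate_const B * \<mu> ^ 4 * (1 + X i + Y i)"
proof -
  define y2 where "y2 = (\<integral>\<omega>. (norm (drift \<mu> (W i \<omega>)))\<^sup>2 \<partial>M)"
  define y4 where "y4 = (\<integral>\<omega>. norm (drift \<mu> (W i \<omega>)) ^ 4 \<partial>M)"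
  define Q where "Q = 8 * real n ^ 2 * B"
  define C4 where "C4 = K ^ 8 / (\<nu> / 2) ^ 3"
  define G where "G = 24 * real n ^ 4 * B * K ^ 4"
  define P where "P = D_const * (1 + 8 * real n * B * K ^ 4)"
  define T where "T = (1 + \<nu> / 2 + Q) * C4 + Q + 8 * Q * K ^ 4 + G + Q\<^sup>2 / \<nu> + P"
  have T: "rate_const B = T" by (simp add: rate_const_def T_def Q_def C4_def G_def P_def Let_def)
  have nn: "0 \<le> Q" "0 \<le> C4" "0 \<le> G" "0 \<le> P" "0 \<le> Q\<^sup>2 / \<nu>" "0 \<le> Q * K ^ 4" "0 \<le> (1 + \<nu> / 2 + Q) * C4"
    using B K \<nu> D_const(1) by (auto simp: Q_def C4_def G_def P_def intro!: mult_nonneg_nonneg divide_nonneg_nonneg add_nonneg_nonneg)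
  have PT: "P \<le> T" using nn by (simp add: T_def)
  have m: "\<mu>\<^sup>2 \<le> \<mu>" "\<mu> ^ 4 \<le> \<mu> ^ 3" "\<mu> ^ 4 \<le> \<mu>\<^sup>2" "\<mu>\<^sup>2 \<le> 1"
    using power_decreasing[of 1 2 \<mu>] power_decreasing[of 3 4 \<mu>] power_decreasing[of 2 4 \<mu>]
      power_decreasing[of 0 2 \<mu>] \<mu> by auto
  show "Y (Suc i) \<le> r * Y i + rate_const B * \<mu> ^ 4 * (1 + X i + Y i)"
  proof -
    have "P * \<mu> ^ 4 * (1 + X i + Y i) \<le> T * \<mu> ^ 4 * (1 + X i + Y i)"
      using PT XY_nonneg by (intro mult_right_mono) auto
    then show ?thesis using Y_step[of i] unfolding T P_def by simp
  qed
  have y4: "y4 \<le> (1 - \<nu> / 2 * \<mu>) * X i + C4 * \<mu> * Y i"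
    using drift4[of i] by (simp add: y4_def C4_def)
  have y40: "0 \<le> y4" by (simp add: y4_def)
  have "Q * \<mu>\<^sup>2 * y2 \<le> \<nu> / 4 * \<mu> * y4 + \<mu> ^ 3 * (Q\<^sup>2 / \<nu>)"
  proof -
    have pw: "Q * \<mu>\<^sup>2 * t \<le> \<nu> / 4 * \<mu> * t\<^sup>2 + \<mu> ^ 3 * (Q\<^sup>2 / \<nu>)" for t
    proof -
      have "0 \<le> \<mu> / \<nu> * (\<nu> / 2 * t - \<mu> * Q)\<^sup>2" using \<mu> \<nu> by simp
      also have "\<dots> = \<nu> / 4 * \<mu> * t\<^sup>2 + \<mu> ^ 3 * (Q\<^sup>2 / \<nu>) - Q * \<mu>\<^sup>2 * t"
        using \<nu> by (simp add: field_simps eval_nat_numeral)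
      finally show ?thesis by simp
    qed
    note i2 = fourth_moment_integrable(3)[OF ps fm_drift[of i]]
    note i4 = fourth_momentD(2)[OF fm_drift[of i]]
    have "(\<integral>\<omega>. Q * \<mu>\<^sup>2 * (norm (drift \<mu> (W i \<omega>)))\<^sup>2 \<partial>M)
        \<le> (\<integral>\<omega>. \<nu> / 4 * \<mu> * norm (drift \<mu> (W i \<omega>)) ^ 4 + \<mu> ^ 3 * (Q\<^sup>2 / \<nu>) \<partial>M)"
    proof (rule integral_mono)
      fix \<omega>
      show "Q * \<mu>\<^sup>2 * (norm (drift \<mu> (W i \<omega>)))\<^sup>2
          \<le> \<nu> / 4 * \<mu> * norm (drift \<mu> (W i \<omega>)) ^ 4 + \<mu> ^ 3 * (Q\<^sup>2 / \<nu>)"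
        using pw[of "(norm (drift \<mu> (W i \<omega>)))\<^sup>2"] by simp
    qed (use i2 i4 in auto)
    then show ?thesis using i2 i4 by (simp add: y2_def y4_def prob_space)
  qed
  then have "X (Suc i) \<le> (1 + \<nu> / 4 * \<mu> + Q * \<mu>\<^sup>2) * y4 + \<mu> ^ 3 * (Q\<^sup>2 / \<nu>)
      + 8 * Q * K ^ 4 * \<mu>\<^sup>2 * (X i + Y i) + G * \<mu> ^ 4 * (1 + X i + Y i)"
    using X_step_raw[of i] by (simp add: y2_def[symmetric] y4_def[symmetric] Q_def G_def algebra_simps)
  also have "(1 + \<nu> / 4 * \<mu> + Q * \<mu>\<^sup>2) * y4
      \<le> (1 + \<nu> / 4 * \<mu> + Q * \<mu>\<^sup>2) * ((1 - \<nu> / 2 * \<mu>) * X i + C4 * \<mu> * Y i)"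
    using y4 nn \<mu> \<nu> by (intro mult_left_mono) auto
  also have "\<dots> = (1 + \<nu> / 4 * \<mu> + Q * \<mu>\<^sup>2) * (1 - \<nu> / 2 * \<mu>) * X i
      + (1 + \<nu> / 4 * \<mu> + Q * \<mu>\<^sup>2) * C4 * (\<mu> * Y i)" by (simp add: algebra_simps)
  also have "\<dots> \<le> (1 - \<nu> / 4 * \<mu> + Q * \<mu>\<^sup>2) * X i + (1 + \<nu> / 2 + Q) * C4 * (\<mu> * Y i)"
  proof -
    have "0 \<le> \<nu> * \<mu> * (\<nu> * \<mu>)" "0 \<le> Q * \<mu>\<^sup>2 * (\<nu> * \<mu>)" using \<nu> \<mu> nn by simp_all
    then have x: "(1 + \<nu> / 4 * \<mu> + Q * \<mu>\<^sup>2) * (1 - \<nu> / 2 * \<mu>) \<le> 1 - \<nu> / 4 * \<mu> + Q * \<mu>\<^sup>2"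
      by (simp add: algebra_simps)
    have "\<nu> / 4 * \<mu> \<le> \<nu> / 2 * 1" using \<nu> \<mu> by (intro mult_mono) auto
    moreover have "Q * \<mu>\<^sup>2 \<le> Q * 1" using nn m by (intro mult_left_mono) auto
    ultimately have y: "1 + \<nu> / 4 * \<mu> + Q * \<mu>\<^sup>2 \<le> 1 + \<nu> / 2 + Q" by linarith
    show ?thesis using XY_nonneg nn \<mu>
      by (intro add_mono[OF mult_right_mono[OF x] mult_right_mono[OF mult_right_mono[OF y]]]) auto
  qed
  also have "G * \<mu> ^ 4 * (1 + X i + Y i) \<le> G * \<mu> ^ 3 + G * \<mu>\<^sup>2 * (X i + Y i)"
  proof -
    have "\<mu> ^ 4 * (1 + X i + Y i) = \<mu> ^ 4 + \<mu> ^ 4 * (X i + Y i)" by (simp add: algebra_simps)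
    also have "\<dots> \<le> \<mu> ^ 3 + \<mu>\<^sup>2 * (X i + Y i)"
      using m XY_nonneg[of i] by (intro add_mono mult_right_mono) auto
    finally show ?thesis using nn(3) by (simp add: mult_left_mono mult.assoc flip: distrib_left)
  qed
  finally have "X (Suc i) \<le> (1 - \<nu> / 4 * \<mu>) * X i + (1 + \<nu> / 2 + Q) * C4 * (\<mu> * Y i)
      + Q * (\<mu>\<^sup>2 * X i) + (8 * Q * K ^ 4 + G) * (\<mu>\<^sup>2 * (X i + Y i)) + (Q\<^sup>2 / \<nu> + G) * \<mu> ^ 3"
    by (simp add: algebra_simps)
  also have "Q * (\<mu>\<^sup>2 * X i) \<le> Q * (\<mu>\<^sup>2 * (X i + Y i))"
    using nn XY_nonneg[of i] by (intro mult_left_mono) auto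
  also have "(1 + \<nu> / 2 + Q) * C4 * (\<mu> * Y i) \<le> T * (\<mu> * Y i)"
    using nn XY_nonneg[of i] \<mu> by (intro mult_right_mono) (auto simp: T_def)
  also have "(Q\<^sup>2 / \<nu> + G) * \<mu> ^ 3 \<le> T * \<mu> ^ 3"
    using nn \<mu> by (intro mult_right_mono) (auto simp: T_def)
  finally have "X (Suc i) \<le> (1 - \<nu> / 4 * \<mu>) * X i + T * (\<mu> * Y i)
      + (Q + (8 * Q * K ^ 4 + G)) * (\<mu>\<^sup>2 * (X i + Y i)) + T * \<mu> ^ 3"
    by (simp add: algebra_simps)
  moreover have "(Q + (8 * Q * K ^ 4 + G)) * (\<mu>\<^sup>2 * (X i + Y i)) \<le> T * (\<mu>\<^sup>2 * (X i + Y i))"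
    using nn XY_nonneg[of i] by (intro mult_right_mono) (auto simp: T_def)
  ultimately show "X (Suc i) \<le> (1 - \<nu> / 4 * \<mu>) * X i + rate_const B * \<mu> * Y i
    + rate_const B * \<mu>\<^sup>2 * (X i + Y i) + rate_const B * \<mu> ^ 3"
    unfolding T by (simp add: mult.assoc)
qed

lemma noise_mean: "integrable M (\<lambda>\<omega>. avg_noise (Z i \<omega>))" "(\<integral>\<omega>. avg_noise (Z i \<omega>) \<partial>M) = 0"
proof -
  show i: "integrable M (\<lambda>\<omega>. avg_noise (Z i \<omega>))" by (rule fourth_moment_integrable[OF ps fm_noise])
  have "(\<integral>\<omega>. avg_noise (Z i \<omega>) \<partial>M) \<bullet> b = 0" for b
  proof -
    have "(\<integral>\<omega>. b \<bullet> avg_noise (Z i \<omega>) \<partial>M) = 0"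
      using fourth_moment_integrable(1)[OF ps noisyD(2)] by (intro noise_test_zero(2)) auto
    then show ?thesis using i by (simp add: inner_commute[of _ b])
  qed
  then show "(\<integral>\<omega>. avg_noise (Z i \<omega>) \<partial>M) = 0" using inner_eq_zero_iff by blast
qed

text \<open>Up to an error of order \<open>E\<bar>c\<bar>\<^sup>2\<close> the mean of the averaged gradient at the centroid is the averaged
  gradient at the mean centroid, so that the mean inherits the contraction of a gradient step.\<close>

lemma mean_step:
  "norm (\<integral>\<omega>. cen (W (Suc i) \<omega>) \<partial>M) \<le> (1 - \<nu> / 2 * \<mu>) * norm (\<integral>\<omega>. cen (W i \<omega>) \<partial>M)
    + \<mu> * (2 * K * (\<integral>\<omega>. (norm (cen (W i \<omega>)))\<^sup>2 \<partial>M) + K\<^sup>2 * (\<integral>\<omega>. D (W i \<omega>) \<partial>M))"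
proof -
  define c where "c \<omega> = cen (W i \<omega>)" for \<omega>
  define m where "m = (\<integral>\<omega>. c \<omega> \<partial>M)"
  define q where "q \<omega> = avg_grad (ws + c \<omega>)" for \<omega>
  define G where "G \<omega> = (\<Sum>k<n. (p k * \<tau> k) *\<^sub>R grad k (W i \<omega> k))" for \<omega>
  have fc: "fourth_moment M c" unfolding c_def[abs_def] by (rule fm_cen)
  have c: "integrable M c" and c1: "integrable M (\<lambda>\<omega>. norm (c \<omega>))" and c2: "integrable M (\<lambda>\<omega>. (norm (c \<omega>))\<^sup>2)"
    using fourth_moment_integrable[OF ps fc] by auto
  have "fourth_moment M q" unfolding q_def
    by (intro fourth_moment_lipschitz[where g = avg_grad and K = K] fourth_moment_add fourth_moment_const ps fc avg_grad_lip)
  then have q: "integrable M q" by (rule fourth_moment_integrable[OF ps])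
  have "fourth_moment M G" unfolding G_def
    by (intro fourth_moment_sum fourth_moment_scaleR ps fm_grad) auto
  then have G: "integrable M G" by (rule fourth_moment_integrable[OF ps])
  have Dint: "integrable M (\<lambda>\<omega>. D (W i \<omega>))" by (rule fourth_moment_integrable[OF ps fm_D])
  \<comment> \<open>Jensen's inequality for the square, read off from the nonnegative variance of
    \<open>norm (c \<omega>)\<close>.\<close>
  have msq: "(norm m)\<^sup>2 \<le> (\<integral>\<omega>. (norm (c \<omega>))\<^sup>2 \<partial>M)"
  proof -
    define t where "t = (\<integral>\<omega>. norm (c \<omega>) \<partial>M)"
    have "norm m \<le> t" unfolding m_def t_def by (rule integral_norm_bound)
    then have "(norm m)\<^sup>2 \<le> t\<^sup>2" by (intro power_mono) auto
    moreover have "0 \<le> (\<integral>\<omega>. (norm (c \<omega>))\<^sup>2 - 2 * t * norm (c \<omega>) + t\<^sup>2 \<partial>M)"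
    proof (rule integral_nonneg_AE, rule AE_I2)
      fix \<omega>
      have "0 \<le> (norm (c \<omega>) - t)\<^sup>2" by simp
      then show "0 \<le> (norm (c \<omega>))\<^sup>2 - 2 * t * norm (c \<omega>) + t\<^sup>2"
        by (simp add: power2_eq_square algebra_simps)
    qed
    moreover have "(\<integral>\<omega>. (norm (c \<omega>))\<^sup>2 - 2 * t * norm (c \<omega>) + t\<^sup>2 \<partial>M)
        = (\<integral>\<omega>. (norm (c \<omega>))\<^sup>2 \<partial>M) - 2 * t * t + t\<^sup>2"
      using c1 c2 by (simp add: prob_space t_def)
    ultimately show ?thesis by (simp add: power2_eq_square)
  qed
  have quad: "norm (avg_grad (ws + u) - H u) \<le> K * (norm u)\<^sup>2" for u
    using avg_quad by (simp add: avg_grad_def)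
  have Hc: "integrable M (\<lambda>\<omega>. H (c \<omega>))" "(\<integral>\<omega>. H (c \<omega>) \<partial>M) = H m"
    unfolding m_def using c H by (auto intro: integrable_bounded_linear integral_bounded_linear)
  \<comment> \<open>Both terms are compared with \<open>H\<close>, which commutes with the
    expectation; each comparison costs \<open>K\<close> times the second moment, hence the factor
    2.\<close>
  have lin: "norm ((\<integral>\<omega>. q \<omega> \<partial>M) - avg_grad (ws + m)) \<le> 2 * K * (\<integral>\<omega>. (norm (c \<omega>))\<^sup>2 \<partial>M)"
  proof -
    have "(\<integral>\<omega>. q \<omega> \<partial>M) - avg_grad (ws + m) = (\<integral>\<omega>. q \<omega> - H (c \<omega>) \<partial>M) - (avg_grad (ws + m) - H m)"
      using q Hc by simp
    also have "norm \<dots> \<le> norm (\<integral>\<omega>. q \<omega> - H (c \<omega>) \<partial>M) + norm (avg_grad (ws + m) - H m)"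
      by (rule norm_triangle_ineq4)
    also have "norm (\<integral>\<omega>. q \<omega> - H (c \<omega>) \<partial>M) \<le> (\<integral>\<omega>. norm (q \<omega> - H (c \<omega>)) \<partial>M)"
      by (rule integral_norm_bound)
    also have "\<dots> \<le> (\<integral>\<omega>. K * (norm (c \<omega>))\<^sup>2 \<partial>M)"
    proof (rule integral_mono)
      show "norm (q \<omega> - H (c \<omega>)) \<le> K * (norm (c \<omega>))\<^sup>2" for \<omega> unfolding q_def by (rule quad)
    qed (use q Hc c2 in auto)
    also have "\<dots> = K * (\<integral>\<omega>. (norm (c \<omega>))\<^sup>2 \<partial>M)" by simp
    also have "norm (avg_grad (ws + m) - H m) \<le> K * (\<integral>\<omega>. (norm (c \<omega>))\<^sup>2 \<partial>M)"
      using msq K by (intro order_trans[OF quad] mult_left_mono) auto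
    finally show ?thesis by simp
  qed
  have dev: "norm (\<integral>\<omega>. G \<omega> - q \<omega> \<partial>M) \<le> K\<^sup>2 * (\<integral>\<omega>. D (W i \<omega>) \<partial>M)"
  proof -
    have "norm (\<integral>\<omega>. G \<omega> - q \<omega> \<partial>M) \<le> (\<integral>\<omega>. norm (G \<omega> - q \<omega>) \<partial>M)" by (rule integral_norm_bound)
    also have "\<dots> \<le> (\<integral>\<omega>. K\<^sup>2 * D (W i \<omega>) \<partial>M)"
    proof (rule integral_mono)
      show "norm (G \<omega> - q \<omega>) \<le> K\<^sup>2 * D (W i \<omega>)" for \<omega>
        unfolding G_def q_def c_def by (rule grad_deviation)
    qed (use G q Dint in auto)
    finally show ?thesis by simp
  qed
  have "(\<integral>\<omega>. cen (W (Suc i) \<omega>) \<partial>M) = (\<integral>\<omega>. (c \<omega> - \<mu> *\<^sub>R G \<omega>) - \<mu> *\<^sub>R avg_noise (Z i \<omega>) \<partial>M)"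
    by (intro Bochner_Integration.integral_cong refl) (simp add: cen_Suc drift_def G_def c_def)
  also have "\<dots> = m - \<mu> *\<^sub>R (\<integral>\<omega>. G \<omega> \<partial>M)"
    using c G noise_mean by (simp add: m_def)
  also have "\<dots> = (m - \<mu> *\<^sub>R avg_grad (ws + m))
      - \<mu> *\<^sub>R (((\<integral>\<omega>. q \<omega> \<partial>M) - avg_grad (ws + m)) + (\<integral>\<omega>. G \<omega> - q \<omega> \<partial>M))"
    using G q by (simp add: algebra_simps)
  also have "norm \<dots> \<le> norm (m - \<mu> *\<^sub>R avg_grad (ws + m))
      + \<mu> * (norm ((\<integral>\<omega>. q \<omega> \<partial>M) - avg_grad (ws + m)) + norm (\<integral>\<omega>. G \<omega> - q \<omega> \<partial>M))"
    using \<mu> by (intro order_trans[OF norm_triangle_ineq4] add_left_mono)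
      (auto intro!: mult_left_mono norm_triangle_ineq)
  also have "\<dots> \<le> (1 - \<nu> / 2 * \<mu>) * norm m
      + \<mu> * (2 * K * (\<integral>\<omega>. (norm (c \<omega>))\<^sup>2 \<partial>M) + K\<^sup>2 * (\<integral>\<omega>. D (W i \<omega>) \<partial>M))"
    using \<mu> by (intro add_mono mult_left_mono mean_step_contraction lin dev) auto
  finally show ?thesis by (simp add: m_def c_def)
qed

text \<open>With \<open>X\<close> of order \<open>\<mu>\<^sup>2\<close>, weighting the
  arithmetic-geometric mean inequality by \<open>\<mu>\<close> gives the right order without a
  square root.\<close>

lemma second_moment_le: "(\<integral>\<omega>. (norm (cen (W i \<omega>)))\<^sup>2 \<partial>M) \<le> X i / \<mu> + \<mu>"
proof -
  note i2 = fourth_moment_integrable(3)[OF ps fm_cen[of i]] and i4 = fourth_momentD(2)[OF fm_cen[of i]]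
  have pw: "t\<^sup>2 \<le> t ^ 4 / \<mu> + \<mu>" for t :: real
  proof -
    have "0 \<le> ((t\<^sup>2 - \<mu>)\<^sup>2 + \<mu> * t\<^sup>2) / \<mu>" using \<mu> by simp
    also have "\<dots> = t ^ 4 / \<mu> + \<mu> - t\<^sup>2" using \<mu> by (simp add: field_simps eval_nat_numeral)
    finally show ?thesis by simp
  qed
  have "(\<integral>\<omega>. (norm (cen (W i \<omega>)))\<^sup>2 \<partial>M) \<le> (\<integral>\<omega>. norm (cen (W i \<omega>)) ^ 4 / \<mu> + \<mu> \<partial>M)"
    using i2 i4 by (intro integral_mono pw) auto
  then show ?thesis using i4 by (simp add: X_def prob_space)
qed

text \<open>A value of \<open>D\<close> is either at most \<open>\<mu>\<close> or bounded by its
  fourth power over \<open>\<mu> ^ 3\<close>; with \<open>Y\<close> of order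
  \<open>\<mu> ^ 4\<close> both are of order \<open>\<mu>\<close>.\<close>

lemma D_mean_le: "(\<integral>\<omega>. D (W i \<omega>) \<partial>M) \<le> Y i / \<mu> ^ 3 + \<mu>"
proof -
  note i1 = fourth_moment_integrable(1)[OF ps fm_D[of i]] and i4 = fourth_momentD(2)[OF fm_D[of i]]
  have i4': "integrable M (\<lambda>\<omega>. D (W i \<omega>) ^ 4)" using i4 by simp
  have pw: "t \<le> t ^ 4 / \<mu> ^ 3 + \<mu>" if "0 \<le> t" for t :: real
  proof (cases "t \<le> \<mu>")
    case True
    have "0 \<le> t ^ 4 / \<mu> ^ 3" using \<mu> by simp
    then show ?thesis using True by linarith
  next
    case False
    have "t * \<mu> ^ 3 \<le> t * t ^ 3" using False \<mu> that by (intro mult_left_mono power_mono) auto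
    then have "t \<le> t ^ 4 / \<mu> ^ 3" using \<mu> by (simp add: field_simps eval_nat_numeral)
    then show ?thesis using \<mu> by simp
  qed
  have "(\<integral>\<omega>. D (W i \<omega>) \<partial>M) \<le> (\<integral>\<omega>. D (W i \<omega>) ^ 4 / \<mu> ^ 3 + \<mu> \<partial>M)"
    using i1 i4' D_nonneg by (intro integral_mono pw) auto
  then show ?thesis using i4' by (simp add: Y_def prob_space)
qed

end

text \<open>The run is quantified inside and \<open>block_run\<close> is interpreted only after
  \<open>C\<close> and \<open>\<mu>0\<close> are fixed; this gives the uniformity that the final
  statement requires.\<close>

lemma (in diffusion_block) block_moments:
  assumes B: "0 \<le> B"
  shows "\<exists>C \<mu>0. 0 < C \<and> 0 < \<mu>0 \<and> \<mu>0 \<le> 1 \<and> (\<forall>\<mu> (M :: 'w measure) F w s.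
     0 < \<mu> \<longrightarrow> \<mu> < \<mu>0 \<longrightarrow> noisy_run M F n (\<lambda>_. ws) B w s \<longrightarrow>
     (\<forall>k<n. \<forall>i. \<forall>\<omega>\<in>space M. w k (Suc i) \<omega> = (\<Sum>l<n. a l k *\<^sub>R
        (w l i \<omega> - (\<mu> * \<tau> l) *\<^sub>R (grad l (w l i \<omega>) + s l i \<omega>)))) \<longrightarrow>
     (\<forall>k<n. eventually (\<lambda>i. norm (\<integral>\<omega>. ws - w k i \<omega> \<partial>M) \<le> C * \<mu>
        \<and> (\<integral>\<omega>. norm (ws - w k i \<omega>) ^ 4 \<partial>M) \<le> C * \<mu>\<^sup>2) sequentially))"
proof -
  have T: "rate_const B > 0"
  proof -
    have "0 < (1 + \<nu> / 2 + 8 * (real n)\<^sup>2 * B) * (K ^ 8 / (\<nu> / 2) ^ 3)"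
      using \<nu> K B by (intro mult_pos_pos divide_pos_pos add_pos_nonneg) auto
    moreover have "0 \<le> D_const * (1 + 8 * real n * B * K ^ 4)"
      using D_const(1) B K by (intro mult_nonneg_nonneg add_nonneg_nonneg) auto
    moreover have "0 \<le> 8 * (8 * (real n)\<^sup>2 * B) * K ^ 4" "0 \<le> 24 * real n ^ 4 * B * K ^ 4"
      "0 \<le> (8 * (real n)\<^sup>2 * B)\<^sup>2 / \<nu>" "0 \<le> 8 * (real n)\<^sup>2 * B"
      using B K \<nu> by (auto intro!: mult_nonneg_nonneg)
    ultimately show ?thesis unfolding rate_const_def Let_def by linarith
  qed
  obtain C1 \<mu>1 where C1: "0 < C1" "0 < \<mu>1" "\<mu>1 \<le> 1"
    and coupled: "\<And>\<mu> (X :: nat \<Rightarrow> real) Y. 0 < \<mu> \<and> \<mu> < \<mu>1 \<and>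
     (\<forall>i. 0 \<le> X i \<and> 0 \<le> Y i \<and>
        X (Suc i) \<le> (1 - \<nu> / 4 * \<mu>) * X i + rate_const B * \<mu> * Y i
          + rate_const B * \<mu>\<^sup>2 * (X i + Y i) + rate_const B * \<mu> ^ 3 \<and>
        Y (Suc i) \<le> r * Y i + rate_const B * \<mu> ^ 4 * (1 + X i + Y i)) \<Longrightarrow>
     eventually (\<lambda>i. X i \<le> C1 * \<mu>\<^sup>2 \<and> Y i \<le> C1 * \<mu> ^ 4) sequentially"
    using coupled_recursion_eventually[OF _ T r, of "\<nu> / 4"] \<nu> by auto
  \<comment> \<open>The threshold of the coupled recursion and the two conditions under which a
    gradient step contracts.\<close>
  define \<mu>0 where "\<mu>0 = Min {\<mu>1, \<nu> / K\<^sup>2, 2 / \<nu>}"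
  have \<mu>0: "0 < \<mu>0" "\<mu>0 \<le> 1" using C1 \<nu> K by (auto simp: \<mu>0_def min_le_iff_disj)
  \<comment> \<open>Once the moments have settled, the mean recursion has forcing
    \<open>b * \<mu>\<^sup>2\<close>; divided by its gap \<open>\<nu> / 2 * \<mu>\<close> this is a
    bias of order \<open>\<mu>\<close>.\<close>
  define b where "b = (2 * K + K\<^sup>2) * (C1 + 1)"
  have b: "b > 0" unfolding b_def using C1 K by (intro mult_pos_pos add_pos_pos) auto
  \<comment> \<open>The summands cover the bias of the centroid, the mean disagreement and the
    fourth moment of the error.\<close>
  define C where "C = 4 * b / \<nu> + K * (C1 + 1) + 16 * K ^ 4 * C1"
  have C: "C > 0" unfolding C_def using b C1 K \<nu> by (intro add_pos_pos mult_pos_pos divide_pos_pos) auto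
  have "eventually (\<lambda>i. norm (\<integral>\<omega>. ws - w k i \<omega> \<partial>M) \<le> C * \<mu>
        \<and> (\<integral>\<omega>. norm (ws - w k i \<omega>) ^ 4 \<partial>M) \<le> C * \<mu>\<^sup>2) sequentially"
    if \<mu>: "0 < \<mu>" "\<mu> < \<mu>0" and noisy: "noisy_run M F n (\<lambda>_. ws) B w s"
      and rec: "\<forall>k<n. \<forall>i. \<forall>\<omega>\<in>space M. w k (Suc i) \<omega> = (\<Sum>l<n. a l k *\<^sub>R
        (w l i \<omega> - (\<mu> * \<tau> l) *\<^sub>R (grad l (w l i \<omega>) + s l i \<omega>)))" and k: "k < n"
    for \<mu> and M :: "'w measure" and F w s k
  proof -
    interpret prob_space M using noisy by (simp add: noisy_run_def)
    have "\<mu> < \<nu> / K\<^sup>2" "\<mu> < 2 / \<nu>" "\<mu> < \<mu>1" using \<mu> by (auto simp: \<mu>0_def)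
    then have m: "\<mu> * K\<^sup>2 \<le> \<nu>" "\<mu> * \<nu> \<le> 2" "\<mu> < \<mu>1"
      using K \<nu> by (simp_all add: pos_less_divide_eq)
    interpret block_run n a p \<tau> grad ws D K r \<nu> H dummy M F w s B \<mu>
      using noisy B \<mu> m C1 rec by unfold_locales (auto simp: step_def)
    have XY: "eventually (\<lambda>i. X i \<le> C1 * \<mu>\<^sup>2 \<and> Y i \<le> C1 * \<mu> ^ 4) sequentially"
      using \<mu> m coupled_step XY_nonneg by (intro coupled) auto
    have ev: "eventually (\<lambda>i. (\<integral>\<omega>. (norm (cen (W i \<omega>)))\<^sup>2 \<partial>M) \<le> (C1 + 1) * \<mu>
        \<and> (\<integral>\<omega>. D (W i \<omega>) \<partial>M) \<le> (C1 + 1) * \<mu>) sequentially"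
      using XY
    proof eventually_elim
      case (elim i)
      have "X i / \<mu> \<le> C1 * \<mu>" "Y i / \<mu> ^ 3 \<le> C1 * \<mu>"
        using elim \<mu> by (auto simp: field_simps eval_nat_numeral)
      then show ?case using second_moment_le[of i] D_mean_le[of i] by (simp add: distrib_right)
    qed
    have "eventually (\<lambda>i. norm (\<integral>\<omega>. cen (W i \<omega>) \<partial>M) \<le> 2 * (b * \<mu>\<^sup>2) / (1 - (1 - \<nu> / 2 * \<mu>))) sequentially"
    proof (rule affine_recursion_eventually)
      show "eventually (\<lambda>i. norm (\<integral>\<omega>. cen (W (Suc i) \<omega>) \<partial>M)
          \<le> (1 - \<nu> / 2 * \<mu>) * norm (\<integral>\<omega>. cen (W i \<omega>) \<partial>M) + b * \<mu>\<^sup>2) sequentially"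
        using ev
      proof eventually_elim
        case (elim i)
        have "\<mu> * (2 * K * (\<integral>\<omega>. (norm (cen (W i \<omega>)))\<^sup>2 \<partial>M) + K\<^sup>2 * (\<integral>\<omega>. D (W i \<omega>) \<partial>M))
            \<le> \<mu> * (2 * K * ((C1 + 1) * \<mu>) + K\<^sup>2 * ((C1 + 1) * \<mu>))"
          using elim \<mu> K by (intro mult_left_mono add_mono) auto
        also have "\<dots> = b * \<mu>\<^sup>2" by (simp add: b_def power2_eq_square algebra_simps)
        finally show ?case using mean_step[of i] by simp
      qed
    qed (use m \<mu> \<nu> b in \<open>auto simp: mult.commute\<close>)
    moreover have "2 * (b * \<mu>\<^sup>2) / (1 - (1 - \<nu> / 2 * \<mu>)) = 4 * b / \<nu> * \<mu>"
      using \<mu> \<nu> by (simp add: power2_eq_square)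
    ultimately have evm: "eventually (\<lambda>i. norm (\<integral>\<omega>. cen (W i \<omega>) \<partial>M) \<le> 4 * b / \<nu> * \<mu>) sequentially"
      by simp
    show ?thesis using XY ev evm
    proof eventually_elim
      case (elim i)
      have "norm (\<integral>\<omega>. ws - w k i \<omega> \<partial>M) \<le> C * \<mu>"
      proof -
        note ci = fourth_moment_integrable(1)[OF ps fm_cen[of i]] and ei = fourth_moment_integrable(1)[OF ps fm_err[OF k, of i]]
        have "norm (\<integral>\<omega>. (ws - w k i \<omega>) + cen (W i \<omega>) \<partial>M)
            \<le> (\<integral>\<omega>. norm ((ws - w k i \<omega>) + cen (W i \<omega>)) \<partial>M)"
          by (rule integral_norm_bound)
        also have "\<dots> \<le> (\<integral>\<omega>. K * D (W i \<omega>) \<partial>M)"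
        proof (rule integral_mono)
          show "norm (ws - w k i \<omega> + cen (W i \<omega>)) \<le> K * D (W i \<omega>)" for \<omega>
            using D_dev[OF k, of "W i \<omega>"] by (simp add: cen_def W_def norm_minus_commute)
          show "integrable M (\<lambda>\<omega>. norm (ws - w k i \<omega> + cen (W i \<omega>)))"
            by (intro integrable_norm Bochner_Integration.integrable_add ci ei)
          show "integrable M (\<lambda>\<omega>. K * D (W i \<omega>))"
            by (intro integrable_mult_right fourth_moment_integrable(1)[OF ps fm_D])
        qed
        also have "\<dots> \<le> K * ((C1 + 1) * \<mu>)" using elim K by (simp add: mult_left_mono)
        finally have dev: "norm (\<integral>\<omega>. (ws - w k i \<omega>) + cen (W i \<omega>) \<partial>M) \<le> K * ((C1 + 1) * \<mu>)" .
        have "(\<integral>\<omega>. ws - w k i \<omega> \<partial>M) = (\<integral>\<omega>. (ws - w k i \<omega>) + cen (W i \<omega>) \<partial>M) - (\<integral>\<omega>. cen (W i \<omega>) \<partial>M)"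
          by (subst Bochner_Integration.integral_add[OF ei ci]) simp
        then have "norm (\<integral>\<omega>. ws - w k i \<omega> \<partial>M) \<le> norm (\<integral>\<omega>. (ws - w k i \<omega>) + cen (W i \<omega>) \<partial>M)
            + norm (\<integral>\<omega>. cen (W i \<omega>) \<partial>M)" by (simp only: norm_triangle_ineq4)
        then have "norm (\<integral>\<omega>. ws - w k i \<omega> \<partial>M) \<le> K * ((C1 + 1) * \<mu>) + 4 * b / \<nu> * \<mu>"
          using dev elim by linarith
        then have "norm (\<integral>\<omega>. ws - w k i \<omega> \<partial>M) \<le> (4 * b / \<nu> + K * (C1 + 1)) * \<mu>"
          by (simp add: algebra_simps)
        also have "\<dots> \<le> C * \<mu>" using \<mu> C1 K by (intro mult_right_mono) (auto simp: C_def)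
        finally show ?thesis .
      qed
      moreover have "(\<integral>\<omega>. norm (ws - w k i \<omega>) ^ 4 \<partial>M) \<le> C * \<mu>\<^sup>2"
      proof -
        have "\<mu> ^ 4 \<le> \<mu>\<^sup>2" using power_decreasing[of 2 4 \<mu>] \<mu> \<mu>0 by simp
        then have "C1 * \<mu> ^ 4 \<le> C1 * \<mu>\<^sup>2" using C1 by simp
        then have "X i + Y i \<le> 2 * (C1 * \<mu>\<^sup>2)" using elim by linarith
        then have "8 * K ^ 4 * (X i + Y i) \<le> 8 * K ^ 4 * (2 * (C1 * \<mu>\<^sup>2))"
          using K by (intro mult_left_mono) auto
        also have "\<dots> = 16 * K ^ 4 * C1 * \<mu>\<^sup>2" by simp
        also have "\<dots> \<le> C * \<mu>\<^sup>2" using b \<nu> K C1 by (intro mult_right_mono) (auto simp: C_def)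
        finally show ?thesis using err4[OF k, of i] by simp
      qed
      ultimately show ?case by simp
    qed
  qed
  note main = this
  show ?thesis
  proof (intro exI[of _ C] exI[of _ \<mu>0] conjI C \<mu>0, intro allI impI)
    fix \<mu> and M :: "'w measure" and F w s k
    assume "0 < \<mu>" "\<mu> < \<mu>0" "noisy_run M F n (\<lambda>_. ws) B w s"
      "\<forall>k<n. \<forall>i. \<forall>\<omega>\<in>space M. w k (Suc i) \<omega> = (\<Sum>l<n. a l k *\<^sub>R
        (w l i \<omega> - (\<mu> * \<tau> l) *\<^sub>R (grad l (w l i \<omega>) + s l i \<omega>)))" "k < n"
    then show "eventually (\<lambda>i. norm (\<integral>\<omega>. ws - w k i \<omega> \<partial>M) \<le> C * \<mu>
        \<and> (\<integral>\<omega>. norm (ws - w k i \<omega>) ^ 4 \<partial>M) \<le> C * \<mu>\<^sup>2) sequentially" by (rule main)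
  qed
qed

section \<open>Agents downstream of converged ones\<close>

lemma le_one_plus_power4: "(t::real) \<le> 1 + t ^ 4"
proof (cases "t \<le> 1")
  case True
  moreover have "0 \<le> t ^ 4" by simp
  ultimately show ?thesis by linarith
next
  case False
  then have "t ^ 1 \<le> t ^ 4" by (intro power_increasing) auto
  then show ?thesis by simp
qed

text \<open>By the assumption on \<open>ws\<close>, the downstream limit points are reproduced by
  averaging, so the errors obey the same averaging as the iterates. Their sum weighted by
  \<open>u\<close> contracts at the fixed rate \<open>r\<close>, and the upstream errors and the
  gradient terms only force it. The local gradients need not vanish at \<open>ws\<close>, but they
  carry a factor \<open>\<mu>\<close>, so the result has the order of the upstream errors. The
  argument is run twice, for fourth moments and for norms of means.\<close>

lemma downstream_moments:
  fixes grad :: "nat \<Rightarrow> 'a::euclidean_space \<Rightarrow> 'a" and a :: "nat \<Rightarrow> nat \<Rightarrow> real"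
  assumes nn: "\<And>l k. l < N \<Longrightarrow> k < N \<Longrightarrow> 0 \<le> a l k"
    and colsum: "\<And>k. k < N \<Longrightarrow> (\<Sum>l<N. a l k) = 1" and mN: "m \<le> N"
    and u: "\<And>k. m \<le> k \<Longrightarrow> k < N \<Longrightarrow> 1 \<le> u k" and r: "0 \<le> r" "r < 1"
    and au: "\<And>l. m \<le> l \<Longrightarrow> l < N \<Longrightarrow> (\<Sum>k=m..<N. a l k * u k) \<le> r * u l"
    and ws: "\<And>k. m \<le> k \<Longrightarrow> k < N \<Longrightarrow> ws k = (\<Sum>l<N. a l k *\<^sub>R ws l)"
    and K: "1 \<le> K" and grad_lip: "\<And>k x y. k < N \<Longrightarrow> norm (grad k x - grad k y) \<le> K * norm (x - y)"
    and grad_ws: "\<And>k. k < N \<Longrightarrow> norm (grad k (ws k)) \<le> K"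
    and \<tau>: "\<And>k. k < N \<Longrightarrow> 0 \<le> \<tau> k" "\<And>k. k < N \<Longrightarrow> \<tau> k \<le> 1"
    and B: "0 \<le> B" and C0: "0 \<le> C0"
  shows "\<exists>C \<mu>0. 0 < C \<and> 0 < \<mu>0 \<and> (\<forall>\<mu> (M :: 'w measure) F w s.
     0 < \<mu> \<longrightarrow> \<mu> < \<mu>0 \<longrightarrow> noisy_run M F N ws B w s \<longrightarrow>
     (\<forall>k<N. \<forall>i. \<forall>\<omega>\<in>space M. w k (Suc i) \<omega> = (\<Sum>l<N. a l k *\<^sub>R
        (w l i \<omega> - (\<mu> * \<tau> l) *\<^sub>R (grad l (w l i \<omega>) + s l i \<omega>)))) \<longrightarrow>
     (\<forall>k<m. eventually (\<lambda>i. norm (\<integral>\<omega>. ws k - w k i \<omega> \<partial>M) \<le> C0 * \<mu>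
        \<and> (\<integral>\<omega>. norm (ws k - w k i \<omega>) ^ 4 \<partial>M) \<le> C0 * \<mu>\<^sup>2) sequentially) \<longrightarrow>
     (\<forall>k\<in>{m..<N}. eventually (\<lambda>i. norm (\<integral>\<omega>. ws k - w k i \<omega> \<partial>M) \<le> C * \<mu>
        \<and> (\<integral>\<omega>. norm (ws k - w k i \<omega>) ^ 4 \<partial>M) \<le> C * \<mu>\<^sup>2) sequentially))"
proof -
  define U where "U = 1 + (\<Sum>k=m..<N. u k)"
  have u0: "0 \<le> u k" if "m \<le> k" "k < N" for k using u[OF that] by simp
  have U1: "1 \<le> U" using u0 by (auto simp: U_def intro!: sum_nonneg)
  have a1: "a l k \<le> 1" if "l < N" "k < N" for l k
    using member_le_sum[of l "{..<N}" "\<lambda>l. a l k"] nn colsum that by auto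
  have coef_U: "(\<Sum>k=m..<N. a l k * u k) \<le> U" if "l < N" for l
  proof -
    have "(\<Sum>k=m..<N. a l k * u k) \<le> (\<Sum>k=m..<N. 1 * u k)"
      using a1 nn u0 that by (intro sum_mono mult_right_mono) auto
    then show ?thesis by (simp add: U_def)
  qed
  \<comment> \<open>After exchanging the sums, the downstream part of \<open>x\<close> meets the
    contraction \<open>au\<close>, while its upstream part and all of the forcing \<open>y\<close>
    meet only the crude bound \<open>U\<close>.\<close>
  have weighted: "(\<Sum>k=m..<N. u k * (\<Sum>l<N. a l k * (x l + y l)))
      \<le> r * (\<Sum>k=m..<N. u k * x k) + U * ((\<Sum>l<m. x l) + (\<Sum>l<N. y l))"
    if x: "\<And>l. 0 \<le> x l" and y: "\<And>l. 0 \<le> y l" for x y :: "nat \<Rightarrow> real"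
  proof -
    have split: "(\<Sum>l<N. f l) = (\<Sum>l<m. f l) + (\<Sum>l=m..<N. f l)" for f :: "nat \<Rightarrow> real"
      using mN by (metis atLeast0LessThan sum.atLeastLessThan_concat zero_le)
    have "(\<Sum>k=m..<N. u k * (\<Sum>l<N. a l k * (x l + y l)))
        = (\<Sum>l<N. (\<Sum>k=m..<N. a l k * u k) * (x l + y l))"
      unfolding sum_distrib_left sum_distrib_right by (subst sum.swap) (simp add: ac_simps)
    also have "\<dots> = (\<Sum>l<N. (\<Sum>k=m..<N. a l k * u k) * x l) + (\<Sum>l<N. (\<Sum>k=m..<N. a l k * u k) * y l)"
      by (simp add: distrib_left sum.distrib)
    also have "\<dots> \<le> ((\<Sum>l<m. U * x l) + (\<Sum>l=m..<N. r * u l * x l)) + (\<Sum>l<N. U * y l)"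
      unfolding split[of "\<lambda>l. (\<Sum>k=m..<N. a l k * u k) * x l"]
      by (intro add_mono sum_mono mult_right_mono coef_U au x y) (use mN in auto)
    also have "\<dots> = r * (\<Sum>k=m..<N. u k * x k) + U * ((\<Sum>l<m. x l) + (\<Sum>l<N. y l))"
      by (simp add: sum_distrib_left distrib_left ac_simps)
    finally show ?thesis .
  qed
  \<comment> \<open>\<open>c1\<close> bounds the fourth moment of gradient plus noise relative to
    one plus that of the error, and \<open>g\<close> is the price of splitting off the forcing. The
    \<open>+ 1\<close> in the constants below keeps them positive, as the recursion lemma and the
    divisions demand.\<close>
  define c1 where "c1 = 64 * K ^ 4 * (1 + B)"
  define g where "g = 8 * U ^ 4 / (1 - r) ^ 3"
  define Gc where "Gc = g * real N ^ 4 * (C0 + c1 * (1 + C0)) + 1"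
  define h where "h = g * real N ^ 4 * c1 + 1"
  have c1: "0 \<le> c1" using K B by (auto simp: c1_def)
  have g: "0 \<le> g" using U1 r by (auto simp: g_def)
  have Gc: "0 < Gc" unfolding Gc_def using g c1 C0 by (intro add_nonneg_pos mult_nonneg_nonneg) auto
  have h: "0 < h" unfolding h_def using g c1 by (intro add_nonneg_pos mult_nonneg_nonneg) auto
  define Cv where "Cv = 4 * Gc / (1 - r)"
  have Cv: "0 < Cv" using Gc r by (simp add: Cv_def)
  define c2 where "c2 = 1 + c1 * (1 + C0 + Cv)"
  have c2: "0 < c2" unfolding c2_def using c1 C0 Cv by (intro add_pos_nonneg mult_nonneg_nonneg) auto
  define Gm where "Gm = U * (real N * (C0 + c2)) + 1"
  have Gm: "0 < Gm" unfolding Gm_def using U1 C0 c2 by (intro add_nonneg_pos mult_nonneg_nonneg) auto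
  define C where "C = Cv + 2 * Gm / (1 - r)"
  have C: "0 < C" using Cv Gm r by (simp add: C_def add_pos_pos)
  \<comment> \<open>Ensures \<open>h * \<mu> \<le> (1 - r) / 2\<close>, so the feedback of the
    downstream errors through their own gradients uses only half of the gap.\<close>
  define \<mu>0 where "\<mu>0 = min 1 ((1 - r) / (2 * h))"
  have \<mu>0: "0 < \<mu>0" using h r by (simp add: \<mu>0_def)
  have "eventually (\<lambda>i. norm (\<integral>\<omega>. ws k - w k i \<omega> \<partial>M) \<le> C * \<mu>
        \<and> (\<integral>\<omega>. norm (ws k - w k i \<omega>) ^ 4 \<partial>M) \<le> C * \<mu>\<^sup>2) sequentially"
    if \<mu>: "0 < \<mu>" "\<mu> < \<mu>0" and noisy: "noisy_run M F N ws B w s"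
      and rec: "\<forall>k<N. \<forall>i. \<forall>\<omega>\<in>space M. w k (Suc i) \<omega> = (\<Sum>l<N. a l k *\<^sub>R
        (w l i \<omega> - (\<mu> * \<tau> l) *\<^sub>R (grad l (w l i \<omega>) + s l i \<omega>)))"
      and up: "\<forall>k<m. eventually (\<lambda>i. norm (\<integral>\<omega>. ws k - w k i \<omega> \<partial>M) \<le> C0 * \<mu>
        \<and> (\<integral>\<omega>. norm (ws k - w k i \<omega>) ^ 4 \<partial>M) \<le> C0 * \<mu>\<^sup>2) sequentially"
      and k: "k \<in> {m..<N}"
    for \<mu> and M :: "'w measure" and F w s k
  proof -
    interpret prob_space M using noisy by (simp add: noisy_run_def)
    have ps: "prob_space M" by unfold_locales
    have m1: "\<mu> \<le> 1" using \<mu> by (simp add: \<mu>0_def)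
    have "\<mu> < (1 - r) / (2 * h)" using \<mu> by (simp add: \<mu>0_def)
    then have mh: "h * \<mu> \<le> (1 - r) / 2" using h by (simp add: pos_less_divide_eq algebra_simps)
    define e where "e l i \<omega> = ws l - w l i \<omega>" for l i \<omega>
    define d where "d l i \<omega> = grad l (w l i \<omega>) + s l i \<omega>" for l i \<omega>
    define V where "V i \<omega> = (\<Sum>k=m..<N. u k * norm (e k i \<omega>))" for i \<omega>
    define v where "v i = (\<integral>\<omega>. V i \<omega> ^ 4 \<partial>M)" for i
    have fw: "fourth_moment M (w l i)" and fs: "fourth_moment M (s l i)" if "l < N" for l i
      using noisy that by (auto simp: noisy_run_def noisy_agent_def)
    have s4: "(\<integral>\<omega>. norm (s l i \<omega>) ^ 4 \<partial>M) \<le> B * (1 + (\<integral>\<omega>. norm (e l i \<omega>) ^ 4 \<partial>M))" if "l < N" for l i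
      using noisy that by (auto simp: noisy_run_def noisy_agent_def e_def)
    have fe: "fourth_moment M (e l i)" if "l < N" for l i
      unfolding e_def[abs_def] by (intro fourth_moment_diff fourth_moment_const ps fw that)
    have fd: "fourth_moment M (d l i)" if "l < N" for l i
      unfolding d_def[abs_def]
      by (intro fourth_moment_add fourth_moment_lipschitz[OF ps fw grad_lip] fs that)
    have fV: "fourth_moment M (V i)" for i
    proof -
      have "fourth_moment M (\<lambda>\<omega>. \<Sum>k=m..<N. u k *\<^sub>R norm (e k i \<omega>))"
        by (intro fourth_moment_sum fourth_moment_scaleR fourth_moment_norm fe ps) auto
      then show ?thesis by (simp add: V_def[abs_def])
    qed
    have V0: "0 \<le> V i \<omega>" for i \<omega> unfolding V_def using u0 by (intro sum_nonneg mult_nonneg_nonneg) auto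
    have iV: "integrable M (\<lambda>\<omega>. V i \<omega> ^ 4)" for i using fourth_momentD(2)[OF fV, of i] by simp
    have v0: "0 \<le> v i" for i by (simp add: v_def integral_nonneg_AE)
    have e_V: "norm (e k i \<omega>) \<le> V i \<omega>" if "k \<in> {m..<N}" for k i \<omega>
    proof -
      have "1 * norm (e k i \<omega>) \<le> u k * norm (e k i \<omega>)" using u that by (intro mult_right_mono) auto
      also have "\<dots> \<le> V i \<omega>"
        unfolding V_def using that u0 by (intro member_le_sum[where f = "\<lambda>k. u k * norm (e k i \<omega>)"]) auto
      finally show ?thesis by simp
    qed
    have e4_v: "(\<integral>\<omega>. norm (e k i \<omega>) ^ 4 \<partial>M) \<le> v i" if "k \<in> {m..<N}" for k i
      unfolding v_def using that fourth_momentD(2)[OF fe] iV e_V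
      by (intro integral_mono power_mono) auto
    have d4: "(\<integral>\<omega>. norm (d l i \<omega>) ^ 4 \<partial>M) \<le> c1 * (1 + (\<integral>\<omega>. norm (e l i \<omega>) ^ 4 \<partial>M))" if l: "l < N" for l i
    proof -
      note ie = fourth_momentD(2)[OF fe[OF l, of i]] and isn = fourth_momentD(2)[OF fs[OF l, of i]]
      have "norm (d l i \<omega>) ^ 4 \<le> 64 * K ^ 4 * (1 + norm (e l i \<omega>) ^ 4) + 8 * norm (s l i \<omega>) ^ 4" for \<omega>
      proof -
        have "norm (d l i \<omega>) \<le> norm (grad l (ws l)) + norm (grad l (w l i \<omega>) - grad l (ws l)) + norm (s l i \<omega>)"
          unfolding d_def by norm
        also have "\<dots> \<le> (K * 1 + K * norm (e l i \<omega>)) + norm (s l i \<omega>)"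
          using grad_ws[OF l] grad_lip[OF l, of "w l i \<omega>" "ws l"]
          by (intro add_mono) (auto simp: e_def norm_minus_commute)
        finally have "norm (d l i \<omega>) ^ 4 \<le> ((K * 1 + K * norm (e l i \<omega>)) + norm (s l i \<omega>)) ^ 4"
          by (intro power_mono) auto
        also have "\<dots> \<le> 8 * ((K * 1 + K * norm (e l i \<omega>)) ^ 4 + norm (s l i \<omega>) ^ 4)"
          by (rule add_power4_le)
        also have "\<dots> \<le> 8 * (8 * ((K * 1) ^ 4 + (K * norm (e l i \<omega>)) ^ 4) + norm (s l i \<omega>) ^ 4)"
          by (intro mult_left_mono add_mono add_power4_le order_refl) auto
        finally show ?thesis by (simp add: power_mult_distrib algebra_simps)
      qed
      then have "(\<integral>\<omega>. norm (d l i \<omega>) ^ 4 \<partial>M)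
          \<le> (\<integral>\<omega>. 64 * K ^ 4 * (1 + norm (e l i \<omega>) ^ 4) + 8 * norm (s l i \<omega>) ^ 4 \<partial>M)"
        using fourth_momentD(2)[OF fd[OF l, of i]] ie isn by (intro integral_mono) auto
      also have "\<dots> = 64 * K ^ 4 * (1 + (\<integral>\<omega>. norm (e l i \<omega>) ^ 4 \<partial>M)) + 8 * (\<integral>\<omega>. norm (s l i \<omega>) ^ 4 \<partial>M)"
        using ie isn by (simp add: prob_space)
      also have "8 * (\<integral>\<omega>. norm (s l i \<omega>) ^ 4 \<partial>M) \<le> (64 * K ^ 4) * (B * (1 + (\<integral>\<omega>. norm (e l i \<omega>) ^ 4 \<partial>M)))"
        using s4[OF l, of i] one_le_power[OF K, of 4] by (intro mult_mono) (auto simp: integral_nonneg_AE)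
      finally show ?thesis by (simp add: c1_def algebra_simps)
    qed
    have e_Suc: "e k (Suc i) \<omega> = (\<Sum>l<N. a l k *\<^sub>R (e l i \<omega> + (\<mu> * \<tau> l) *\<^sub>R d l i \<omega>))"
      if "k \<in> {m..<N}" "\<omega> \<in> space M" for k i \<omega>
      using that rec ws[of k] unfolding e_def d_def
      by (simp add: algebra_simps sum.distrib sum_subtractf)
    have up_all: "eventually (\<lambda>i. \<forall>l<m. norm (\<integral>\<omega>. e l i \<omega> \<partial>M) \<le> C0 * \<mu>
        \<and> (\<integral>\<omega>. norm (e l i \<omega>) ^ 4 \<partial>M) \<le> C0 * \<mu>\<^sup>2) sequentially"
    proof -
      have "eventually (\<lambda>i. \<forall>l\<in>{..<m}. norm (\<integral>\<omega>. e l i \<omega> \<partial>M) \<le> C0 * \<mu>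
          \<and> (\<integral>\<omega>. norm (e l i \<omega>) ^ 4 \<partial>M) \<le> C0 * \<mu>\<^sup>2) sequentially"
        by (rule eventually_ball_finite) (use up in \<open>auto simp: e_def\<close>)
      then show ?thesis by (rule eventually_mono) auto
    qed
    have mu2: "\<mu>\<^sup>2 \<le> 1" "\<mu> ^ 4 \<le> \<mu>\<^sup>2" "\<mu> ^ 4 \<le> \<mu>"
      using power_decreasing[of 0 2 \<mu>] power_decreasing[of 2 4 \<mu>] power_decreasing[of 1 4 \<mu>] \<mu> m1 by auto
    have d_all: "(\<integral>\<omega>. norm (d l i \<omega>) ^ 4 \<partial>M) \<le> c1 * (1 + C0 + v i)"
      if "\<forall>l<m. (\<integral>\<omega>. norm (e l i \<omega>) ^ 4 \<partial>M) \<le> C0 * \<mu>\<^sup>2" "l < N" for l i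
    proof -
      have "(\<integral>\<omega>. norm (e l i \<omega>) ^ 4 \<partial>M) \<le> C0 + v i"
      proof (cases "l < m")
        case True
        have "C0 * \<mu>\<^sup>2 \<le> C0 * 1" using C0 mu2 by (intro mult_left_mono)
        then show ?thesis using that True v0[of i] by fastforce
      next
        case False
        then show ?thesis using e4_v[of l i] that C0 by simp
      qed
      then have "c1 * (1 + (\<integral>\<omega>. norm (e l i \<omega>) ^ 4 \<partial>M)) \<le> c1 * (1 + C0 + v i)"
        using c1 by (intro mult_left_mono) auto
      then show ?thesis using d4[OF that(2), of i] by linarith
    qed
    have v_step: "v (Suc i) \<le> (1 + r) / 2 * v i + Gc * \<mu>\<^sup>2"
      if upi: "\<forall>l<m. (\<integral>\<omega>. norm (e l i \<omega>) ^ 4 \<partial>M) \<le> C0 * \<mu>\<^sup>2" for i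
    proof -
      have pw: "V (Suc i) \<omega> ^ 4 \<le> r * V i \<omega> ^ 4
          + g * real N ^ 3 * ((\<Sum>l<m. norm (e l i \<omega>) ^ 4) + \<mu> ^ 4 * (\<Sum>l<N. norm (d l i \<omega>) ^ 4))"
        if \<omega>: "\<omega> \<in> space M" for \<omega>
      proof -
        have step: "norm (e l i \<omega> + (\<mu> * \<tau> l) *\<^sub>R d l i \<omega>) \<le> norm (e l i \<omega>) + \<mu> * norm (d l i \<omega>)" if "l < N" for l
        proof -
          have "\<mu> * \<tau> l * norm (d l i \<omega>) \<le> \<mu> * 1 * norm (d l i \<omega>)"
            using \<mu> \<tau>[OF that] by (intro mult_right_mono mult_left_mono) auto
          moreover have "norm ((\<mu> * \<tau> l) *\<^sub>R d l i \<omega>) = \<mu> * \<tau> l * norm (d l i \<omega>)"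
            using \<mu> \<tau>[OF that] by (simp add: abs_mult)
          ultimately show ?thesis using norm_triangle_ineq[of "e l i \<omega>" "(\<mu> * \<tau> l) *\<^sub>R d l i \<omega>"]
            by linarith
        qed
        have "V (Suc i) \<omega> \<le> (\<Sum>k=m..<N. u k * (\<Sum>l<N. a l k * (norm (e l i \<omega>) + \<mu> * norm (d l i \<omega>))))"
          unfolding V_def
        proof (intro sum_mono mult_left_mono)
          fix k assume k: "k \<in> {m..<N}"
          show "norm (e k (Suc i) \<omega>) \<le> (\<Sum>l<N. a l k * (norm (e l i \<omega>) + \<mu> * norm (d l i \<omega>)))"
            unfolding e_Suc[OF k \<omega>]
          proof (rule sum_norm_le)
            fix l assume "l \<in> {..<N}"
            then show "norm (a l k *\<^sub>R (e l i \<omega> + (\<mu> * \<tau> l) *\<^sub>R d l i \<omega>))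
                \<le> a l k * (norm (e l i \<omega>) + \<mu> * norm (d l i \<omega>))"
              using nn[of l k] step[of l] k by (simp add: mult_left_mono)
          qed
        qed (use u0 in auto)
        also have "\<dots> \<le> r * V i \<omega> + U * ((\<Sum>l<m. norm (e l i \<omega>)) + (\<Sum>l<N. \<mu> * norm (d l i \<omega>)))"
          unfolding V_def using \<mu> by (intro weighted) auto
        finally have "V (Suc i) \<omega> ^ 4
            \<le> (r * V i \<omega> + U * ((\<Sum>l<m. norm (e l i \<omega>)) + (\<Sum>l<N. \<mu> * norm (d l i \<omega>)))) ^ 4"
          using V0 by (intro power_mono) auto
        also have "\<dots> \<le> r * V i \<omega> ^ 4
            + (U * ((\<Sum>l<m. norm (e l i \<omega>)) + (\<Sum>l<N. \<mu> * norm (d l i \<omega>)))) ^ 4 / (1 - r) ^ 3"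
          by (rule perturbed_contraction_power4[OF r])
        also have "(U * ((\<Sum>l<m. norm (e l i \<omega>)) + (\<Sum>l<N. \<mu> * norm (d l i \<omega>)))) ^ 4
            = U ^ 4 * ((\<Sum>l<m. norm (e l i \<omega>)) + (\<Sum>l<N. \<mu> * norm (d l i \<omega>))) ^ 4"
          by (rule power_mult_distrib)
        also have "((\<Sum>l<m. norm (e l i \<omega>)) + (\<Sum>l<N. \<mu> * norm (d l i \<omega>))) ^ 4
            \<le> 8 * ((\<Sum>l<m. norm (e l i \<omega>)) ^ 4 + (\<Sum>l<N. \<mu> * norm (d l i \<omega>)) ^ 4)"
          by (rule add_power4_le)
        also have "(\<Sum>l<m. norm (e l i \<omega>)) ^ 4 \<le> real N ^ 3 * (\<Sum>l<m. norm (e l i \<omega>) ^ 4)"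
        proof -
          have "(\<Sum>l<m. norm (e l i \<omega>)) ^ 4 \<le> real m ^ 3 * (\<Sum>l<m. norm (e l i \<omega>) ^ 4)"
            using sum_power4_le[of "\<lambda>l. norm (e l i \<omega>)" "{..<m}"] by simp
          also have "\<dots> \<le> real N ^ 3 * (\<Sum>l<m. norm (e l i \<omega>) ^ 4)"
            using mN by (intro mult_right_mono power_mono sum_nonneg) auto
          finally show ?thesis .
        qed
        also have "(\<Sum>l<N. \<mu> * norm (d l i \<omega>)) ^ 4 \<le> real N ^ 3 * (\<mu> ^ 4 * (\<Sum>l<N. norm (d l i \<omega>) ^ 4))"
          using sum_power4_le[of "\<lambda>l. \<mu> * norm (d l i \<omega>)" "{..<N}"]
          by (simp add: power_mult_distrib sum_distrib_left)
        finally show ?thesis using U1 r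
          by (simp add: g_def divide_right_mono mult_left_mono algebra_simps add_divide_distrib)
      qed
      have ie: "integrable M (\<lambda>\<omega>. norm (e l i \<omega>) ^ 4)" and id: "integrable M (\<lambda>\<omega>. norm (d l i \<omega>) ^ 4)"
        if "l < N" for l using fourth_momentD(2) fe fd that by blast+
      have ieS: "integrable M (\<lambda>\<omega>. \<Sum>l<m. norm (e l i \<omega>) ^ 4)"
        using ie mN by (intro Bochner_Integration.integrable_sum) auto
      have idS: "integrable M (\<lambda>\<omega>. \<Sum>l<N. norm (d l i \<omega>) ^ 4)"
        using id by (intro Bochner_Integration.integrable_sum) auto
      have "v (Suc i) \<le> (\<integral>\<omega>. r * V i \<omega> ^ 4
          + g * real N ^ 3 * ((\<Sum>l<m. norm (e l i \<omega>) ^ 4) + \<mu> ^ 4 * (\<Sum>l<N. norm (d l i \<omega>) ^ 4)) \<partial>M)"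
        unfolding v_def using iV ieS idS pw by (intro integral_mono) auto
      also have "\<dots> = r * v i + g * real N ^ 3 * ((\<Sum>l<m. \<integral>\<omega>. norm (e l i \<omega>) ^ 4 \<partial>M)
          + \<mu> ^ 4 * (\<Sum>l<N. \<integral>\<omega>. norm (d l i \<omega>) ^ 4 \<partial>M))"
        using iV ieS idS ie id mN by (simp add: v_def Bochner_Integration.integral_sum)
      also have "\<dots> \<le> r * v i + g * real N ^ 3 * (real N * (C0 * \<mu>\<^sup>2) + \<mu> ^ 4 * (real N * (c1 * (1 + C0 + v i))))"
      proof -
        have "(\<Sum>l<m. \<integral>\<omega>. norm (e l i \<omega>) ^ 4 \<partial>M) \<le> real m * (C0 * \<mu>\<^sup>2)"
          using sum_bounded_above[of "{..<m}" "\<lambda>l. \<integral>\<omega>. norm (e l i \<omega>) ^ 4 \<partial>M"] upi by auto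
        also have "\<dots> \<le> real N * (C0 * \<mu>\<^sup>2)" using mN C0 by (intro mult_right_mono) auto
        finally have "(\<Sum>l<m. \<integral>\<omega>. norm (e l i \<omega>) ^ 4 \<partial>M) \<le> real N * (C0 * \<mu>\<^sup>2)" .
        moreover have "(\<Sum>l<N. \<integral>\<omega>. norm (d l i \<omega>) ^ 4 \<partial>M) \<le> real N * (c1 * (1 + C0 + v i))"
          using sum_bounded_above[of "{..<N}" "\<lambda>l. \<integral>\<omega>. norm (d l i \<omega>) ^ 4 \<partial>M"] d_all[OF upi] by auto
        ultimately show ?thesis using g by (intro add_mono mult_left_mono order_refl) auto
      qed
      also have "\<dots> = r * v i + (g * real N ^ 4 * C0) * \<mu>\<^sup>2 + (g * real N ^ 4 * (c1 * (1 + C0))) * \<mu> ^ 4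
          + (g * real N ^ 4 * c1) * \<mu> ^ 4 * v i"
        by (simp add: algebra_simps eval_nat_numeral)
      also have "\<dots> \<le> r * v i + (g * real N ^ 4 * C0) * \<mu>\<^sup>2 + (g * real N ^ 4 * (c1 * (1 + C0))) * \<mu>\<^sup>2
          + h * \<mu> * v i"
        using g c1 C0 mu2 v0 h \<mu> by (intro add_mono mult_left_mono mult_mono order_refl) (auto simp: h_def)
      also have "\<dots> \<le> r * v i + (g * real N ^ 4 * C0) * \<mu>\<^sup>2 + (g * real N ^ 4 * (c1 * (1 + C0))) * \<mu>\<^sup>2
          + (1 - r) / 2 * v i" using mh v0 by (intro add_mono mult_right_mono order_refl)
      also have "\<dots> = (1 + r) / 2 * v i + (Gc - 1) * \<mu>\<^sup>2" by (simp add: Gc_def field_simps)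
      also have "\<dots> \<le> (1 + r) / 2 * v i + Gc * \<mu>\<^sup>2" by (simp add: algebra_simps)
      finally show ?thesis .
    qed
    have "eventually (\<lambda>i. v i \<le> 2 * (Gc * \<mu>\<^sup>2) / (1 - (1 + r) / 2)) sequentially"
    proof (rule affine_recursion_eventually)
      show "eventually (\<lambda>i. v (Suc i) \<le> (1 + r) / 2 * v i + Gc * \<mu>\<^sup>2) sequentially"
        using up_all by eventually_elim (intro v_step, blast)
    qed (use r Gc \<mu> in auto)
    moreover have "2 * (Gc * \<mu>\<^sup>2) / (1 - (1 + r) / 2) = Cv * \<mu>\<^sup>2"
      using r by (simp add: Cv_def field_simps)
    ultimately have ev_v: "eventually (\<lambda>i. v i \<le> Cv * \<mu>\<^sup>2) sequentially" by simp
    \<comment> \<open>The norms of the means are treated like the errors before. A constant bound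
      \<open>c2\<close> on the mean of gradient plus noise suffices, since it enters multiplied by
      \<open>\<mu>\<close>.\<close>
    define t where "t i = (\<Sum>k=m..<N. u k * norm (\<integral>\<omega>. e k i \<omega> \<partial>M))" for i
    have "eventually (\<lambda>i. t i \<le> 2 * (Gm * \<mu>) / (1 - r)) sequentially"
    proof (rule affine_recursion_eventually[OF r])
      show "eventually (\<lambda>i. t (Suc i) \<le> r * t i + Gm * \<mu>) sequentially"
        using up_all ev_v
      proof eventually_elim
        case (elim i)
        have upi: "\<forall>l<m. (\<integral>\<omega>. norm (e l i \<omega>) ^ 4 \<partial>M) \<le> C0 * \<mu>\<^sup>2" using elim by blast
        have "Cv * \<mu>\<^sup>2 \<le> Cv * 1" using Cv mu2 by (intro mult_left_mono) auto
        then have "1 + c1 * (1 + C0 + v i) \<le> c2"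
          unfolding c2_def using elim c1 by (intro add_mono mult_left_mono order_refl) auto
        then have d1: "norm (\<integral>\<omega>. d l i \<omega> \<partial>M) \<le> c2" if l: "l < N" for l
        proof -
          have "norm (\<integral>\<omega>. d l i \<omega> \<partial>M) \<le> (\<integral>\<omega>. norm (d l i \<omega>) \<partial>M)" by (rule integral_norm_bound)
          also have "\<dots> \<le> (\<integral>\<omega>. 1 + norm (d l i \<omega>) ^ 4 \<partial>M)"
            using fourth_momentD(2)[OF fd[OF l, of i]] fourth_moment_integrable(2)[OF ps fd[OF l, of i]]
            by (intro integral_mono le_one_plus_power4) auto
          also have "\<dots> = 1 + (\<integral>\<omega>. norm (d l i \<omega>) ^ 4 \<partial>M)"
            using fourth_momentD(2)[OF fd[OF l, of i]] by (simp add: prob_space)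
          finally show ?thesis using d_all[OF upi l] \<open>1 + c1 * (1 + C0 + v i) \<le> c2\<close> by linarith
        qed
        note ie = fourth_moment_integrable(1)[OF ps fe] and id = fourth_moment_integrable(1)[OF ps fd]
        have "t (Suc i) \<le> (\<Sum>k=m..<N. u k * (\<Sum>l<N. a l k * (norm (\<integral>\<omega>. e l i \<omega> \<partial>M) + \<mu> * c2)))"
          unfolding t_def
        proof (intro sum_mono mult_left_mono)
          fix k assume k: "k \<in> {m..<N}"
          have "(\<integral>\<omega>. e k (Suc i) \<omega> \<partial>M) = (\<integral>\<omega>. (\<Sum>l<N. a l k *\<^sub>R (e l i \<omega> + (\<mu> * \<tau> l) *\<^sub>R d l i \<omega>)) \<partial>M)"
            by (intro Bochner_Integration.integral_cong refl e_Suc k)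
          also have "\<dots> = (\<Sum>l<N. a l k *\<^sub>R ((\<integral>\<omega>. e l i \<omega> \<partial>M) + (\<mu> * \<tau> l) *\<^sub>R (\<integral>\<omega>. d l i \<omega> \<partial>M)))"
            using ie id by (simp add: Bochner_Integration.integral_sum)
          also have "norm \<dots> \<le> (\<Sum>l<N. a l k * (norm (\<integral>\<omega>. e l i \<omega> \<partial>M) + \<mu> * c2))"
          proof (rule sum_norm_le)
            fix l assume "l \<in> {..<N}"
            then have l: "l < N" by simp
            have "\<mu> * \<tau> l * norm (\<integral>\<omega>. d l i \<omega> \<partial>M) \<le> \<mu> * 1 * c2"
              using \<mu> \<tau>[OF l] d1[OF l] by (intro mult_mono) auto
            then have "norm ((\<integral>\<omega>. e l i \<omega> \<partial>M) + (\<mu> * \<tau> l) *\<^sub>R (\<integral>\<omega>. d l i \<omega> \<partial>M)) \<le> norm (\<integral>\<omega>. e l i \<omega> \<partial>M) + \<mu> * c2"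
              using \<mu> \<tau>[OF l] by (intro order_trans[OF norm_triangle_ineq]) (simp add: abs_mult)
            then show "norm (a l k *\<^sub>R ((\<integral>\<omega>. e l i \<omega> \<partial>M) + (\<mu> * \<tau> l) *\<^sub>R (\<integral>\<omega>. d l i \<omega> \<partial>M)))
                \<le> a l k * (norm (\<integral>\<omega>. e l i \<omega> \<partial>M) + \<mu> * c2)"
              using nn[OF l, of k] k by (simp add: mult_left_mono)
          qed
          finally show "norm (\<integral>\<omega>. e k (Suc i) \<omega> \<partial>M) \<le> (\<Sum>l<N. a l k * (norm (\<integral>\<omega>. e l i \<omega> \<partial>M) + \<mu> * c2))" .
        qed (use u0 in auto)
        also have "\<dots> \<le> r * t i + U * ((\<Sum>l<m. norm (\<integral>\<omega>. e l i \<omega> \<partial>M)) + (\<Sum>l<N. \<mu> * c2))"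
          unfolding t_def using \<mu> c2 by (intro weighted) auto
        also have "\<dots> \<le> r * t i + U * (real N * (C0 * \<mu>) + real N * (\<mu> * c2))"
        proof -
          have "(\<Sum>l<m. norm (\<integral>\<omega>. e l i \<omega> \<partial>M)) \<le> real m * (C0 * \<mu>)"
            using sum_bounded_above[of "{..<m}" "\<lambda>l. norm (\<integral>\<omega>. e l i \<omega> \<partial>M)"] elim by auto
          also have "\<dots> \<le> real N * (C0 * \<mu>)" using mN C0 \<mu> by (intro mult_right_mono) auto
          finally show ?thesis using U1 by (intro add_mono mult_left_mono order_refl) auto
        qed
        also have "\<dots> = r * t i + (Gm - 1) * \<mu>" by (simp add: Gm_def algebra_simps)
        also have "\<dots> \<le> r * t i + Gm * \<mu>" using \<mu> by simp
        finally show ?case .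
      qed
    qed (use Gm \<mu> in auto)
    with ev_v show ?thesis
    proof eventually_elim
      case (elim i)
      have "1 * norm (\<integral>\<omega>. e k i \<omega> \<partial>M) \<le> u k * norm (\<integral>\<omega>. e k i \<omega> \<partial>M)"
        using u k by (intro mult_right_mono) auto
      also have "\<dots> \<le> t i"
        unfolding t_def using k u0 by (intro member_le_sum[where f = "\<lambda>k. u k * norm (\<integral>\<omega>. e k i \<omega> \<partial>M)"]) auto
      also have "\<dots> \<le> 2 * Gm / (1 - r) * \<mu>" using elim by simp
      also have "\<dots> \<le> C * \<mu>" using Cv \<mu> by (intro mult_right_mono) (auto simp: C_def)
      finally have "norm (\<integral>\<omega>. e k i \<omega> \<partial>M) \<le> C * \<mu>" by simp
      moreover have "(\<integral>\<omega>. norm (e k i \<omega>) ^ 4 \<partial>M) \<le> C * \<mu>\<^sup>2"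
      proof -
        have "Cv * \<mu>\<^sup>2 \<le> C * \<mu>\<^sup>2" using Gm r by (intro mult_right_mono) (auto simp: C_def)
        then show ?thesis using e4_v[OF k, of i] elim by linarith
      qed
      ultimately show ?case by (simp add: e_def)
    qed
  qed
  note main = this
  show ?thesis
  proof (rule exI[of _ C], rule exI[of _ \<mu>0], intro conjI C \<mu>0, intro allI impI ballI)
    fix \<mu> and M :: "'w measure" and F w s k
    assume "0 < \<mu>" "\<mu> < \<mu>0" "noisy_run M F N ws B w s"
      "\<forall>k<N. \<forall>i. \<forall>\<omega>\<in>space M. w k (Suc i) \<omega> = (\<Sum>l<N. a l k *\<^sub>R
        (w l i \<omega> - (\<mu> * \<tau> l) *\<^sub>R (grad l (w l i \<omega>) + s l i \<omega>)))"
      "\<forall>k<m. eventually (\<lambda>i. norm (\<integral>\<omega>. ws k - w k i \<omega> \<partial>M) \<le> C0 * \<mu>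
        \<and> (\<integral>\<omega>. norm (ws k - w k i \<omega>) ^ 4 \<partial>M) \<le> C0 * \<mu>\<^sup>2) sequentially" "k \<in> {m..<N}"
    then show "eventually (\<lambda>i. norm (\<integral>\<omega>. ws k - w k i \<omega> \<partial>M) \<le> C * \<mu>
        \<and> (\<integral>\<omega>. norm (ws k - w k i \<omega>) ^ 4 \<partial>M) \<le> C * \<mu>\<^sup>2) sequentially" by (rule main)
  qed
qed

text \<open>Replaces conditional expectations by integrals against \<open>hist\<close>-measurable
  functions. Finite fourth moments are given only for the initial iterates; for the later ones and
  for the noise they have to be established on the way.\<close>

lemma atc_run_noisy_run:
  fixes grad :: "nat \<Rightarrow> 'a::euclidean_space \<Rightarrow> 'a" and w gh :: "nat \<Rightarrow> nat \<Rightarrow> 'w \<Rightarrow> 'a"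
  assumes run: "atc_run N A \<mu> grad ws \<beta> \<sigma> \<beta>4 \<sigma>4 M w gh"
    and grad_lip: "\<And>k x y. k < N \<Longrightarrow> norm (grad k x - grad k y) \<le> K * norm (x - y)"
    and B: "\<And>k. k < N \<Longrightarrow> (\<beta> k)\<^sup>2 \<le> B \<and> (\<sigma> k)\<^sup>2 \<le> B \<and> (\<beta>4 k)\<^sup>2 \<le> B \<and> (\<sigma>4 k)\<^sup>2 \<le> B"
  shows "noisy_run M (hist M w N) N ws B w (\<lambda>l i \<omega>. gh l i \<omega> - grad l (w l i \<omega>))"
proof -
  define s where "s l i \<omega> = gh l i \<omega> - grad l (w l i \<omega>)" for l i \<omega>
  interpret prob_space M using run by (simp add: atc_run_def)
  have ps: "prob_space M" by unfold_locales
  have gh: "gh l i \<in> borel_measurable M" if "l < N" for l i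
    using run that by (simp add: atc_run_def)
  have rec: "w k (Suc i) \<omega> = (\<Sum>l<N. A $$ (l,k) *\<^sub>R (w l i \<omega> - \<mu> l *\<^sub>R gh l i \<omega>))"
    if "k < N" "\<omega> \<in> space M" for k i \<omega>
    using run that by (simp add: atc_run_def)
  have wm: "w k i \<in> borel_measurable M" if "k < N" for k i
    using that
  proof (induction i arbitrary: k)
    case 0 then show ?case using run by (simp add: atc_run_def)
  next
    case (Suc i)
    have "(\<lambda>\<omega>. \<Sum>l<N. A $$ (l,k) *\<^sub>R (w l i \<omega> - \<mu> l *\<^sub>R gh l i \<omega>)) \<in> borel_measurable M"
      using Suc.IH gh
      by (intro borel_measurable_sum borel_measurable_scaleR borel_measurable_diff borel_measurable_const) auto
    then show ?case using rec[OF Suc.prems] by (subst measurable_cong) auto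
  qed
  have cont: "continuous_on UNIV (grad k)" if "k < N" for k
  proof (intro lipschitz_on_continuous_on[of "\<bar>K\<bar>"] lipschitz_onI)
    show "dist (grad k x) (grad k y) \<le> \<bar>K\<bar> * dist x y" for x y
      unfolding dist_norm by (intro order_trans[OF grad_lip[OF that]] mult_right_mono) auto
  qed auto
  have sm: "s l i \<in> borel_measurable M" if "l < N" for l i
    unfolding s_def[abs_def]
    using gh[OF that] borel_measurable_continuous_onI[OF cont[OF that]] wm[OF that]
    by (intro borel_measurable_diff measurable_compose[of "w l i" M borel "grad l"]) auto
  define G where "G i = {w l j -` B' \<inter> space M | l j B'. l < N \<and> j \<le> i \<and> B' \<in> sets borel}" for i
  have G: "G i \<subseteq> sets M" for i
    using wm by (auto simp: G_def measurable_sets)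
  have hist: "space (hist M w N i) = space M" "sets (hist M w N i) = sigma_sets (space M) (G i)" for i
    using sets.space_closed[of M] G[of i] unfolding hist_def G_def[symmetric]
    by (auto intro!: space_measure_of sets_measure_of)
  have sub: "subalgebra M (hist M w N i)" for i
    unfolding subalgebra_def using hist sets.sigma_sets_subset[OF G[of i]] by simp
  have fs: "finite_measure_subalgebra M (hist M w N i)" for i
    using sub by unfold_locales
  have wF: "w l i \<in> borel_measurable (hist M w N i)" if "l < N" for l i
  proof (rule measurableI)
    fix B' :: "'a set" assume "B' \<in> sets borel"
    then have "w l i -` B' \<inter> space M \<in> G i" using that by (auto simp: G_def)
    then show "w l i -` B' \<inter> space (hist M w N i) \<in> sets (hist M w N i)" by (simp add: hist)
  qed simp
  \<comment> \<open>Stated with nonnegative integrals, so that it is available before the noise is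
    known to have finite moments.\<close>
  have test: "(\<integral>\<^sup>+\<omega>. ennreal (f \<omega>) * g \<omega> \<partial>M) \<le> (\<integral>\<^sup>+\<omega>. ennreal (f \<omega> * b \<omega>) \<partial>M)"
    if f: "f \<in> borel_measurable (hist M w N i)" "\<And>\<omega>. 0 \<le> f \<omega>" and g: "g \<in> borel_measurable M"
      and b: "AE \<omega> in M. nn_cond_exp M (hist M w N i) g \<omega> \<le> ennreal (b \<omega>)" for f b i and g :: "'w \<Rightarrow> ennreal"
  proof -
    interpret finite_measure_subalgebra M "hist M w N i" by (rule fs)
    have "(\<integral>\<^sup>+\<omega>. ennreal (f \<omega>) * g \<omega> \<partial>M) = (\<integral>\<^sup>+\<omega>. ennreal (f \<omega>) * nn_cond_exp M (hist M w N i) g \<omega> \<partial>M)"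
      using f g by (intro nn_cond_exp_intg[symmetric]) auto
    also have "\<dots> \<le> (\<integral>\<^sup>+\<omega>. ennreal (f \<omega> * b \<omega>) \<partial>M)"
    proof (rule nn_integral_mono_AE)
      show "AE \<omega> in M. ennreal (f \<omega>) * nn_cond_exp M (hist M w N i) g \<omega> \<le> ennreal (f \<omega> * b \<omega>)"
        using b by eventually_elim (simp add: f(2) ennreal_mult' mult_left_mono)
    qed
    finally show ?thesis .
  qed
  have s2: "AE \<omega> in M. nn_cond_exp M (hist M w N i) (\<lambda>\<omega>. ennreal ((norm (s l i \<omega>))\<^sup>2)) \<omega>
      \<le> ennreal (B * (1 + (norm (ws l - w l i \<omega>))\<^sup>2))" if l: "l < N" for l i
  proof -
    have "AE \<omega> in M. nn_cond_exp M (hist M w N i) (\<lambda>\<omega>. ennreal ((norm (s l i \<omega>))\<^sup>2)) \<omega>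
        \<le> ennreal ((\<beta> l)\<^sup>2 * (norm (ws l - w l i \<omega>))\<^sup>2 + (\<sigma> l)\<^sup>2)"
      using run l by (simp add: atc_run_def s_def)
    then show ?thesis
    proof eventually_elim
      case (elim \<omega>)
      have "(\<beta> l)\<^sup>2 * (norm (ws l - w l i \<omega>))\<^sup>2 + (\<sigma> l)\<^sup>2 \<le> B * (norm (ws l - w l i \<omega>))\<^sup>2 + B"
        using B[OF l] by (intro add_mono mult_right_mono) auto
      then show ?case by (intro order_trans[OF elim] ennreal_leI) (simp add: algebra_simps)
    qed
  qed
  have s4: "AE \<omega> in M. nn_cond_exp M (hist M w N i) (\<lambda>\<omega>. ennreal (norm (s l i \<omega>) ^ 4)) \<omega>
      \<le> ennreal (B * (1 + norm (ws l - w l i \<omega>) ^ 4))" if l: "l < N" for l i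
  proof -
    have "AE \<omega> in M. nn_cond_exp M (hist M w N i) (\<lambda>\<omega>. ennreal (norm (s l i \<omega>) ^ 4)) \<omega>
        \<le> ennreal ((\<beta>4 l)\<^sup>2 * norm (ws l - w l i \<omega>) ^ 4 + (\<sigma>4 l)\<^sup>2)"
      using run l by (simp add: atc_run_def s_def)
    then show ?thesis
    proof eventually_elim
      case (elim \<omega>)
      have "(\<beta>4 l)\<^sup>2 * norm (ws l - w l i \<omega>) ^ 4 + (\<sigma>4 l)\<^sup>2 \<le> B * norm (ws l - w l i \<omega>) ^ 4 + B"
        using B[OF l] by (intro add_mono mult_right_mono) auto
      then show ?case by (intro order_trans[OF elim] ennreal_leI) (simp add: algebra_simps)
    qed
  qed
  have B0: "0 \<le> B" if "l < N" for l using B[OF that] zero_le_power2 order_trans by blast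
  have s4_nn: "(\<integral>\<^sup>+\<omega>. ennreal (norm (s l i \<omega>) ^ 4) \<partial>M) \<le> ennreal (B * (1 + (\<integral>\<omega>. norm (ws l - w l i \<omega>) ^ 4 \<partial>M)))"
    if l: "l < N" and fw: "fourth_moment M (w l i)" for l i
  proof -
    have "fourth_moment M (\<lambda>\<omega>. ws l - w l i \<omega>)"
      by (intro fourth_moment_diff fourth_moment_const ps fw)
    then have ie: "integrable M (\<lambda>\<omega>. norm (ws l - w l i \<omega>) ^ 4)" by (rule fourth_momentD)
    have "(\<integral>\<^sup>+\<omega>. ennreal (norm (s l i \<omega>) ^ 4) \<partial>M) \<le> (\<integral>\<^sup>+\<omega>. ennreal (1 * (B * (1 + norm (ws l - w l i \<omega>) ^ 4))) \<partial>M)"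
      using test[of "\<lambda>_. 1" i, OF _ _ _ s4[OF l]] sm[OF l] by simp
    also have "\<dots> = ennreal (\<integral>\<omega>. B * (1 + norm (ws l - w l i \<omega>) ^ 4) \<partial>M)"
      using ie B0[OF l] by (simp add: nn_integral_eq_integral)
    also have "(\<integral>\<omega>. B * (1 + norm (ws l - w l i \<omega>) ^ 4) \<partial>M) = B * (1 + (\<integral>\<omega>. norm (ws l - w l i \<omega>) ^ 4 \<partial>M))"
      using ie by (simp add: prob_space)
    finally show ?thesis .
  qed
  have fs4: "fourth_moment M (s l i)" if l: "l < N" and fw: "fourth_moment M (w l i)" for l i
    unfolding fourth_moment_def
  proof
    have "(\<integral>\<^sup>+\<omega>. ennreal (norm (s l i \<omega>) ^ 4) \<partial>M) < \<infinity>"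
      using s4_nn[OF l fw] by (rule le_less_trans) simp
    then show "integrable M (\<lambda>\<omega>. norm (s l i \<omega>) ^ 4)"
      using sm[OF l] by (intro integrableI_nonneg) auto
  qed (rule sm[OF l])
  \<comment> \<open>Iterates and noise alternate: finite moments of the iterates bound those of the
    noise at the same step, and both together bound the next iterates.\<close>
  have fw: "fourth_moment M (w k i)" if "k < N" for k i
    using that
  proof (induction i arbitrary: k)
    case 0
    have "(\<integral>\<^sup>+\<omega>. ennreal (norm (w k 0 \<omega>) ^ 4) \<partial>M) < \<infinity>" using run 0 by (simp add: atc_run_def)
    then show ?case unfolding fourth_moment_def using wm[OF 0] by (auto intro!: integrableI_nonneg)
  next
    case (Suc i)
    have gh_s: "gh l i \<omega> = s l i \<omega> + grad l (w l i \<omega>)" for l \<omega> by (simp add: s_def)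
    have sum4: "fourth_moment M (\<lambda>\<omega>. \<Sum>l<N. A $$ (l,k) *\<^sub>R (w l i \<omega> - \<mu> l *\<^sub>R gh l i \<omega>))"
      unfolding gh_s
      by (intro fourth_moment_sum fourth_moment_scaleR fourth_moment_diff fourth_moment_add ps fs4
          fourth_moment_lipschitz[OF ps _ grad_lip] Suc.IH) auto
    show ?case by (rule fourth_moment_bound[OF wm[OF Suc.prems] sum4]) (simp add: rec[OF Suc.prems])
  qed
  show ?thesis unfolding noisy_run_def noisy_agent_def s_def[symmetric]
  proof (intro conjI allI impI ballI ps)
    fix k i assume k: "k < N"
    show "fourth_moment M (w k i)" "fourth_moment M (s k i)" "w k i \<in> borel_measurable (hist M w N i)"
      using k fw fs4 wF by auto
    show "(\<integral>\<omega>. norm (s k i \<omega>) ^ 4 \<partial>M) \<le> B * (1 + (\<integral>\<omega>. norm (ws k - w k i \<omega>) ^ 4 \<partial>M))"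
    proof -
      have "(\<integral>\<omega>. norm (s k i \<omega>) ^ 4 \<partial>M) = enn2real (\<integral>\<^sup>+\<omega>. ennreal (norm (s k i \<omega>) ^ 4) \<partial>M)"
        using sm[OF k] by (intro integral_eq_nn_integral) auto
      also have "\<dots> \<le> B * (1 + (\<integral>\<omega>. norm (ws k - w k i \<omega>) ^ 4 \<partial>M))"
        using s4_nn[OF k fw[OF k]] B0[OF k] by (intro enn2real_leI) (auto simp: integral_nonneg_AE)
      finally show ?thesis .
    qed
  next
    fix k i b f assume k: "k < N" and b: "b \<in> (Basis :: 'a set)" and f: "f \<in> borel_measurable (hist M w N i)"
      and int: "integrable M (\<lambda>\<omega>. f \<omega> * (s k i \<omega> \<bullet> b))"
    interpret finite_measure_subalgebra M "hist M w N i" by (rule fs)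
    have m: "(\<lambda>\<omega>. s k i \<omega> \<bullet> b) \<in> borel_measurable M" using sm[OF k] by simp
    have "AE \<omega> in M. real_cond_exp M (hist M w N i) (\<lambda>\<omega>. s k i \<omega> \<bullet> b) \<omega> = 0"
      using run k b by (simp add: atc_run_def s_def)
    then have "(\<integral>\<omega>. f \<omega> * real_cond_exp M (hist M w N i) (\<lambda>\<omega>. s k i \<omega> \<bullet> b) \<omega> \<partial>M) = 0"
      by (intro integral_eq_zero_AE) auto
    then show "(\<integral>\<omega>. f \<omega> * (s k i \<omega> \<bullet> b) \<partial>M) = 0" using real_cond_exp_intg(2)[OF int f m] by simp
  next
    fix k i f assume k: "k < N" and f: "f \<in> borel_measurable (hist M w N i)" "\<forall>\<omega>. 0 \<le> f \<omega>"
      and int: "integrable M f" "integrable M (\<lambda>\<omega>. f \<omega> * (norm (ws k - w k i \<omega>))\<^sup>2)"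
    have fM: "f \<in> borel_measurable M" using int by auto
    have "(\<integral>\<omega>. f \<omega> * (norm (s k i \<omega>))\<^sup>2 \<partial>M) = enn2real (\<integral>\<^sup>+\<omega>. ennreal (f \<omega> * (norm (s k i \<omega>))\<^sup>2) \<partial>M)"
      using sm[OF k] fM f by (intro integral_eq_nn_integral) auto
    also have "\<dots> \<le> B * (\<integral>\<omega>. f \<omega> * (1 + (norm (ws k - w k i \<omega>))\<^sup>2) \<partial>M)"
    proof (rule enn2real_leI)
      have i1: "integrable M (\<lambda>\<omega>. f \<omega> * (1 + (norm (ws k - w k i \<omega>))\<^sup>2))"
        using int by (simp add: distrib_left)
      have "(\<integral>\<^sup>+\<omega>. ennreal (f \<omega> * (norm (s k i \<omega>))\<^sup>2) \<partial>M)
          \<le> (\<integral>\<^sup>+\<omega>. ennreal (f \<omega> * (B * (1 + (norm (ws k - w k i \<omega>))\<^sup>2))) \<partial>M)"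
        using test[OF f(1) _ _ s2[OF k]] f sm[OF k] by (simp add: ennreal_mult)
      also have "\<dots> = (\<integral>\<^sup>+\<omega>. ennreal (B * (f \<omega> * (1 + (norm (ws k - w k i \<omega>))\<^sup>2))) \<partial>M)"
        by (simp add: ac_simps)
      also have "\<dots> = ennreal (\<integral>\<omega>. B * (f \<omega> * (1 + (norm (ws k - w k i \<omega>))\<^sup>2)) \<partial>M)"
        using i1 f B0[OF k] by (intro nn_integral_eq_integral) auto
      finally show "(\<integral>\<^sup>+\<omega>. ennreal (f \<omega> * (norm (s k i \<omega>))\<^sup>2) \<partial>M)
          \<le> ennreal (B * (\<integral>\<omega>. f \<omega> * (1 + (norm (ws k - w k i \<omega>))\<^sup>2) \<partial>M))" by simp
      show "0 \<le> B * (\<integral>\<omega>. f \<omega> * (1 + (norm (ws k - w k i \<omega>))\<^sup>2) \<partial>M)"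
        using f B0[OF k] by (intro mult_nonneg_nonneg integral_nonneg_AE) auto
    qed
    finally show "(\<integral>\<omega>. f \<omega> * (norm (s k i \<omega>))\<^sup>2 \<partial>M) \<le> B * (\<integral>\<omega>. f \<omega> * (1 + (norm (ws k - w k i \<omega>))\<^sup>2) \<partial>M)" .
  qed
qed

section \<open>The topology of a weakly-connected network\<close>

lemma down_closed_eq_lessThan_card:
  fixes P :: "nat set"
  assumes "finite P" "\<And>k l. k \<in> P \<Longrightarrow> l \<le> k \<Longrightarrow> l \<in> P"
  shows "P = {..<card P}"
proof (cases "P = {}")
  case False
  have "P = {..Max P}" using assms False by (auto intro: Max_ge) (use Max_in in blast)
  then show ?thesis by (metis card_atMost lessThan_Suc_atMost)
qed simp

lemma kpow_colsum_le_1: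
  assumes nn: "\<And>l k. l < n \<Longrightarrow> k < n \<Longrightarrow> 0 \<le> a l k"
    and colsum: "\<And>k. k < n \<Longrightarrow> (\<Sum>l<n. a l k) \<le> 1" and "k < n"
  shows "(\<Sum>l<n. kpow n a q l k) \<le> 1"
  using \<open>k < n\<close>
proof (induction q arbitrary: k)
  case (Suc q)
  have "(\<Sum>l<n. kpow n a (Suc q) l k) = (\<Sum>i<n. (\<Sum>l<n. kpow n a q l i) * a i k)"
    unfolding kpow.simps(2) sum_distrib_right by (rule sum.swap)
  also have "\<dots> \<le> (\<Sum>i<n. 1 * a i k)" using Suc nn by (intro sum_mono mult_right_mono) auto
  finally show ?case using colsum[OF Suc.prems] by simp
qed simp

text \<open>The column mass of the next power at \<open>k\<close> averages the masses at all
  \<open>i\<close> with the weights \<open>a i k\<close>. None exceeds one, and the one at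
  \<open>j\<close>, which carries positive weight, is strictly smaller.\<close>

lemma leaky_step:
  assumes nn: "\<And>l k. l < n \<Longrightarrow> k < n \<Longrightarrow> 0 \<le> a l k"
    and colsum: "\<And>k. k < n \<Longrightarrow> (\<Sum>l<n. a l k) \<le> 1" and "j < n" "k < n"
    and "0 < a j k" "(\<Sum>l<n. kpow n a q l j) < 1"
  shows "(\<Sum>l<n. kpow n a (Suc q) l k) < 1"
proof -
  have "(\<Sum>l<n. kpow n a (Suc q) l k) = (\<Sum>i<n. (\<Sum>l<n. kpow n a q l i) * a i k)"
    unfolding kpow.simps(2) sum_distrib_right by (rule sum.swap)
  also have "\<dots> < (\<Sum>i<n. 1 * a i k)"
  proof (rule sum_strict_mono_ex1)
    show "\<forall>i\<in>{..<n}. (\<Sum>l<n. kpow n a q l i) * a i k \<le> 1 * a i k"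
      using assms(4) by (intro ballI mult_right_mono kpow_colsum_le_1 nn colsum) auto
    show "\<exists>i\<in>{..<n}. (\<Sum>l<n. kpow n a q l i) * a i k < 1 * a i k"
      using assms by (intro bexI[of _ j] mult_strict_right_mono) auto
  qed simp
  finally show ?thesis using colsum[OF \<open>k < n\<close>] by simp
qed

locale weak_network =
  fixes N S R :: nat and sub :: "nat \<Rightarrow> nat" and A :: "real mat"
  assumes sub_range: "\<And>k. k < N \<Longrightarrow> 1 \<le> sub k \<and> sub k \<le> S + R"
    and sub_nonempty: "\<And>s. s \<in> {1..S+R} \<Longrightarrow> \<exists>k<N. sub k = s"
    and sub_ordered: "\<And>k l. k \<le> l \<Longrightarrow> l < N \<Longrightarrow> sub k \<le> sub l"
    and A_dim: "A \<in> carrier_mat N N"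
    and A_nonneg: "\<And>l k. l < N \<Longrightarrow> k < N \<Longrightarrow> 0 \<le> A $$ (l,k)"
    and A_left_stoch: "\<And>k. k < N \<Longrightarrow> (\<Sum>l<N. A $$ (l,k)) = 1"
    and A_block: "\<And>l k. l < N \<Longrightarrow> k < N \<Longrightarrow> A $$ (l,k) \<noteq> 0 \<Longrightarrow> sub l \<le> sub k \<and> (sub k \<le> S \<longrightarrow> sub l = sub k)"
    and A_S_prim: "\<And>s. s \<in> {1..S} \<Longrightarrow> primitive_mat (blk A sub N s)"
    and A_R_irred: "\<And>r. r \<in> {S+1..S+R} \<Longrightarrow> irreducible_mat (blk A sub N r) \<and>
          (\<exists>j<dim_col (blk A sub N r). (\<Sum>i<dim_row (blk A sub N r). blk A sub N r $$ (i,j)) < 1)"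
begin

abbreviation off :: "nat \<Rightarrow> nat" where "off s \<equiv> subnet_off sub N s"
definition len :: "nat \<Rightarrow> nat" where "len s = card (subnet sub N s)"
text \<open>The agents of group S are those preceding sub-network \<open>S + 1\<close>, so the
  offset of the latter counts them.\<close>

abbreviation NgS :: nat where "NgS \<equiv> off (Suc S)"
abbreviation a :: "nat \<Rightarrow> nat \<Rightarrow> real" where "a l k \<equiv> A $$ (l, k)"

lemma prefix: "{k. k < N \<and> sub k < s} = {..<off s}"
  unfolding subnet_off_def
  by (rule down_closed_eq_lessThan_card) (auto dest: sub_ordered intro: le_less_trans)

lemma lt_off: "k < off s \<longleftrightarrow> k < N \<and> sub k < s"
  using prefix[of s] by auto

lemma NgS: "card {l. l < N \<and> sub l \<le> S} = NgS" "NgS \<le> N"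
proof -
  show "card {l. l < N \<and> sub l \<le> S} = NgS" by (simp add: subnet_off_def less_Suc_eq_le)
  show "NgS \<le> N" using lt_off[of N "Suc S"] by (simp add: not_less)
qed

text \<open>The ordering of the agents makes every sub-network an interval of indices; this is what
  lets \<open>blk\<close> address it by an offset.\<close>

lemma subnet_interval: "subnet sub N s = {off s..<off s + len s}"
proof -
  have e: "subnet sub N s = {off s..<off (Suc s)}"
    by (auto simp: subnet_def lt_off not_less[symmetric])
  then have "len s = off (Suc s) - off s" by (simp add: len_def)
  moreover have "off s \<le> off (Suc s)" using lt_off[of "off (Suc s)" s] lt_off[of "off (Suc s)" "Suc s"]
    by (auto simp: not_less[symmetric])
  ultimately show ?thesis using e by simp
qed

lemma in_subnet: "i < len s \<Longrightarrow> off s + i < N \<and> sub (off s + i) = s"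
proof -
  assume "i < len s"
  then have "off s + i \<in> subnet sub N s" unfolding subnet_interval by simp
  then show ?thesis by (simp add: subnet_def)
qed

lemma subnet_sum: "(\<Sum>k\<in>subnet sub N s. f k) = (\<Sum>i<len s. f (off s + i))"
  for f :: "nat \<Rightarrow> 'b::comm_monoid_add"
  unfolding subnet_interval
  by (rule sum.reindex_bij_witness[of _ "\<lambda>i. off s + i" "\<lambda>k. k - off s"]) auto

lemma len_pos: "s \<in> {1..S+R} \<Longrightarrow> 0 < len s"
  using sub_nonempty[of s] by (auto simp: len_def subnet_def card_gt_0_iff)

lemma blk: "blk A sub N s \<in> carrier_mat (len s) (len s)"
  "i < len s \<Longrightarrow> j < len s \<Longrightarrow> blk A sub N s $$ (i, j) = a (off s + i) (off s + j)"
  by (simp_all add: blk_def Let_def len_def)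

text \<open>\<open>A_block\<close> lets an agent of group S listen only inside its own sub-network,
  so each such block evolves autonomously.\<close>

lemma block_sum:
  fixes x :: "nat \<Rightarrow> 'b::real_vector"
  assumes "s \<le> S" "j < len s"
  shows "(\<Sum>l<N. a l (off s + j) *\<^sub>R x l) = (\<Sum>i<len s. a (off s + i) (off s + j) *\<^sub>R x (off s + i))"
proof -
  have "(\<Sum>l<N. a l (off s + j) *\<^sub>R x l) = (\<Sum>l\<in>subnet sub N s. a l (off s + j) *\<^sub>R x l)"
    using A_block[of _ "off s + j"] in_subnet[OF assms(2)] assms(1)
    by (intro sum.mono_neutral_right) (auto simp: subnet_def)
  then show ?thesis by (simp add: subnet_sum)
qed

lemma block_colsum: "s \<le> S \<Longrightarrow> j < len s \<Longrightarrow> (\<Sum>i<len s. a (off s + i) (off s + j)) = 1"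
  using block_sum[of s j "\<lambda>_. 1 :: real"] A_left_stoch[of "off s + j"] in_subnet[of j s] by simp

lemma kpow_cong: "(\<And>i j. i < n \<Longrightarrow> j < n \<Longrightarrow> f i j = g i j) \<Longrightarrow> k < n \<Longrightarrow> kpow n f q l k = kpow n g q l k"
  by (induction q arbitrary: k) auto

lemma kpow_blk:
  assumes "i < len s" "j < len s"
  shows "(blk A sub N s ^\<^sub>m q) $$ (i, j) = kpow (len s) (\<lambda>i j. a (off s + i) (off s + j)) q i j"
  unfolding pow_mat_eq_kpow[OF blk(1) assms] by (rule kpow_cong[OF blk(2) assms(2)])

text \<open>\<open>primitive_mat\<close> also accepts the exponent 0, which occurs for a single
  agent. The seminorm needs at least one summand, so the exponent is raised by one.\<close>

lemma block_power_pos: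
  assumes "s \<in> {1..S}"
  obtains m where "0 < m" "\<And>i j. i < len s \<Longrightarrow> j < len s \<Longrightarrow>
    0 < kpow (len s) (\<lambda>i j. a (off s + i) (off s + j)) m i j"
proof -
  obtain m where m: "\<forall>i<len s. \<forall>j<len s. 0 < (blk A sub N s ^\<^sub>m m) $$ (i, j)"
    using A_S_prim[OF assms] blk(1)[of s] unfolding primitive_mat_def by auto
  have "0 < kpow (len s) (\<lambda>i j. a (off s + i) (off s + j)) m i j" if "i < len s" "j < len s" for i j
    using m that by (simp add: kpow_blk[symmetric])
  then have "0 < kpow (len s) (\<lambda>i j. a (off s + i) (off s + j)) (Suc m) i j" if "i < len s" "j < len s" for i j
    using that assms in_subnet by (intro kpow_pos_Suc A_nonneg block_colsum) auto
  then show thesis using that[of "Suc m"] by simp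
qed

lemma perron:
  assumes s: "s \<in> {1..S}"
  shows "(\<Sum>k<len s. perron_vec (blk A sub N s) $ k) = 1"
    "\<And>k. k < len s \<Longrightarrow> 0 < perron_vec (blk A sub N s) $ k"
    "\<And>l. l < len s \<Longrightarrow> (\<Sum>k<len s. a (off s + l) (off s + k) * perron_vec (blk A sub N s) $ k)
      = perron_vec (blk A sub N s) $ l"
proof -
  obtain m where "0 < m"
    and m: "\<And>i j. i < len s \<Longrightarrow> j < len s \<Longrightarrow> 0 < kpow (len s) (\<lambda>i j. a (off s + i) (off s + j)) m i j"
    by (rule block_power_pos[OF s]) (rule that)
  have p: "0 < kpow (len s) (\<lambda>i j. blk A sub N s $$ (i, j)) m i j" if "i < len s" "j < len s" for i j
    using m[OF that] by (simp add: pow_mat_eq_kpow[OF blk(1) that, symmetric] kpow_blk[OF that])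
  have nn: "0 \<le> blk A sub N s $$ (i, j)" if "i < len s" "j < len s" for i j
    using that blk(2) A_nonneg in_subnet by simp
  have cs: "(\<Sum>i<len s. blk A sub N s $$ (i, j)) = 1" if "j < len s" for j
    using that blk(2) block_colsum[of s j] s by simp
  have l: "0 < len s" using s by (intro len_pos) auto
  note P = perron_vec_left_stochastic[OF blk(1) l, where m = m]
  show "(\<Sum>k<len s. perron_vec (blk A sub N s) $ k) = 1"
    "\<And>k. k < len s \<Longrightarrow> 0 < perron_vec (blk A sub N s) $ k"
    using P(1,2) nn cs p by auto
  show "\<And>l. l < len s \<Longrightarrow> (\<Sum>k<len s. a (off s + l) (off s + k) * perron_vec (blk A sub N s) $ k)
      = perron_vec (blk A sub N s) $ l"
  proof -
    fix l assume l: "l < len s"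
    have "(\<Sum>k<len s. a (off s + l) (off s + k) * perron_vec (blk A sub N s) $ k)
        = (\<Sum>k<len s. blk A sub N s $$ (l, k) * perron_vec (blk A sub N s) $ k)"
      using l by (intro sum.cong) (auto simp: blk(2))
    then show "(\<Sum>k<len s. a (off s + l) (off s + k) * perron_vec (blk A sub N s) $ k)
      = perron_vec (blk A sub N s) $ l" using P(3)[of l] l nn cs p by auto
  qed
qed

section \<open>Group R: leakage of mass and limit points\<close>

abbreviation NgR :: nat where "NgR \<equiv> N - NgS"
abbreviation aR :: "nat \<Rightarrow> nat \<Rightarrow> real" where "aR i j \<equiv> a (NgS + i) (NgS + j)"

lemma split_sum: "(\<Sum>l<N. f l) = (\<Sum>l<NgS. f l) + (\<Sum>i<NgR. f (NgS + i))"
  for f :: "nat \<Rightarrow> 'b::comm_monoid_add"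
proof -
  have "(\<Sum>l<N. f l) = (\<Sum>l<NgS. f l) + (\<Sum>l=NgS..<N. f l)"
    using NgS(2) by (metis atLeast0LessThan sum.atLeastLessThan_concat zero_le)
  also have "(\<Sum>l=NgS..<N. f l) = (\<Sum>i<NgR. f (NgS + i))"
    using sum.shift_bounds_nat_ivl[of f 0 NgS NgR] NgS(2) by (simp add: lessThan_atLeast0 add.commute)
  finally show ?thesis .
qed

lemma aR_nonneg: "i < NgR \<Longrightarrow> j < NgR \<Longrightarrow> 0 \<le> aR i j"
  by (rule A_nonneg) auto

lemma aR_colsum: "j < NgR \<Longrightarrow> (\<Sum>i<NgR. aR i j) \<le> 1"
  using A_left_stoch[of "NgS + j"] split_sum[of "\<lambda>l. a l (NgS + j)"] A_nonneg NgS(2)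
    sum_nonneg[of "{..<NgS}" "\<lambda>l. a l (NgS + j)"] by fastforce

text \<open>In each sub-network of group R some agent listens to an earlier sub-network, which loses mass
  either directly (group S) or by induction; irreducibility spreads the loss over the sub-network.\<close>

lemma leaky: "NgS \<le> k \<Longrightarrow> k < N \<Longrightarrow> \<exists>q. (\<Sum>l<NgR. kpow NgR aR q l (k - NgS)) < 1"
proof (induction "sub k" arbitrary: k rule: less_induct)
  case less
  define r where "r = sub k"
  define L where "L j \<longleftrightarrow> (\<exists>q. (\<Sum>l<NgR. kpow NgR aR q l (j - NgS)) < 1)" for j
  have step: "L j" if Ll: "L l" and bd: "NgS \<le> l" "NgS \<le> j" "l < N" "j < N" "0 < a l j" for l j
  proof -
    obtain q where "(\<Sum>i<NgR. kpow NgR aR q i (l - NgS)) < 1" using Ll unfolding L_def by blast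
    then have "(\<Sum>i<NgR. kpow NgR aR (Suc q) i (j - NgS)) < 1"
      using bd by (intro leaky_step[of NgR aR "l - NgS"] aR_nonneg aR_colsum) auto
    then show ?thesis unfolding L_def by blast
  qed
  have "\<not> sub k \<le> S" using less.prems lt_off[of k "Suc S"] by auto
  then have r: "r \<in> {S+1..S+R}" using sub_range[of k] less.prems by (auto simp: r_def)
  have inR: "NgS \<le> off r + i" "off r + i < N" if "i < len r" for i
  proof -
    show "off r + i < N" using in_subnet[OF that] by simp
    have "\<not> off r + i < NgS" unfolding lt_off using in_subnet[OF that] r by auto
    then show "NgS \<le> off r + i" by simp
  qed
  obtain j0 where j0: "j0 < len r" "(\<Sum>i<len r. a (off r + i) (off r + j0)) < 1"
  proof -
    obtain j where j: "j < len r" "(\<Sum>i<len r. blk A sub N r $$ (i, j)) < 1"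
      using A_R_irred[OF r] blk(1)[of r] by auto
    moreover have "(\<Sum>i<len r. blk A sub N r $$ (i, j)) = (\<Sum>i<len r. a (off r + i) (off r + j))"
      using j(1) by (intro sum.cong) (auto simp: blk(2))
    ultimately show thesis using that by simp
  qed
  define k0 where "k0 = off r + j0"
  have k0: "NgS \<le> k0" "k0 < N" "sub k0 = r" using inR[OF j0(1)] in_subnet[OF j0(1)] by (auto simp: k0_def)
  \<comment> \<open>The whole column of \<open>k0\<close> sums to one but its internal part to less,
    so some weight comes from outside; \<open>A_block\<close> then places its source in an earlier
    sub-network.\<close>
  have "\<exists>l<N. l \<notin> subnet sub N r \<and> a l k0 \<noteq> 0"
  proof (rule ccontr)
    assume "\<not> ?thesis"
    then have "(\<Sum>l<N. a l k0) = (\<Sum>l\<in>subnet sub N r. a l k0)"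
      by (intro sum.mono_neutral_right) (auto simp: subnet_def)
    also have "\<dots> < 1" using j0(2) by (simp add: subnet_sum k0_def)
    finally show False using A_left_stoch[OF k0(2)] by simp
  qed
  then obtain l where l: "l < N" "l \<notin> subnet sub N r" "a l k0 \<noteq> 0" by blast
  then have sl: "sub l < r" using A_block[OF l(1) k0(2)] k0(3) by (auto simp: subnet_def)
  have al: "0 < a l k0" using A_nonneg[OF l(1) k0(2)] l(3) by simp
  have L0: "L k0"
  proof (cases "l < NgS")
    case True
    have "0 < (\<Sum>l<NgS. a l k0)"
      using True al k0 NgS(2) A_nonneg by (intro sum_pos2[of _ l]) auto
    then have "(\<Sum>i<NgR. aR i (k0 - NgS)) < 1"
      using A_left_stoch[OF k0(2)] split_sum[of "\<lambda>l. a l k0"] k0 by simp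
    moreover have "kpow NgR aR (Suc 0) i j = aR i j" if "i < NgR" for i j
      using that by (simp add: mult_delta_left)
    ultimately have "(\<Sum>i<NgR. kpow NgR aR (Suc 0) i (k0 - NgS)) < 1" by simp
    then show ?thesis unfolding L_def by blast
  next
    case False
    then have "L l" unfolding L_def using less.hyps[of l] sl l(1) by (auto simp: r_def)
    then show ?thesis using step[of l k0] False l k0 al by auto
  qed
  \<comment> \<open>A positive entry of a power of the block is a path of positive weights from
    \<open>j0\<close>, along which \<open>step\<close> transports the leak.\<close>
  have spread: "L (off r + j)" if "0 < kpow (len r) (\<lambda>i j. a (off r + i) (off r + j)) q j0 j" "j < len r" for q j
    using that
  proof (induction q arbitrary: j)
    case 0
    then show ?case using L0 by (auto simp: k0_def split: if_splits)
  next
    case (Suc q)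
    have nnr: "0 \<le> a (off r + i) (off r + j)" if "i < len r" "j < len r" for i j
      using that inR by (intro A_nonneg)
    have "\<exists>i\<in>{..<len r}. 0 < kpow (len r) (\<lambda>i j. a (off r + i) (off r + j)) q j0 i * a (off r + i) (off r + j)"
    proof (rule ccontr)
      assume "\<not> ?thesis"
      then have "kpow (len r) (\<lambda>i j. a (off r + i) (off r + j)) (Suc q) j0 j \<le> 0"
        by (auto simp: not_less intro!: sum_nonpos)
      then show False using Suc.prems by simp
    qed
    then obtain i where i: "i < len r"
      "0 < kpow (len r) (\<lambda>i j. a (off r + i) (off r + j)) q j0 i * a (off r + i) (off r + j)" by blast
    then have "0 < kpow (len r) (\<lambda>i j. a (off r + i) (off r + j)) q j0 i" "0 < a (off r + i) (off r + j)"
      using nnr[OF i(1) Suc.prems(2)] by (auto simp: zero_less_mult_iff)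
    then show ?case using Suc.IH[of i] step[of "off r + i" "off r + j"] i inR Suc.prems by blast
  qed
  have "k \<in> subnet sub N r" using less.prems by (simp add: subnet_def r_def)
  then obtain j where j: "j < len r" "k = off r + j"
    unfolding subnet_interval by (auto simp: le_iff_add)
  obtain q where "0 < (blk A sub N r ^\<^sub>m q) $$ (j0, j)"
    using A_R_irred[OF r] blk(1)[of r] j0(1) j(1) unfolding irreducible_mat_def by auto
  then have "L k" using spread[of q j] kpow_blk[OF j0(1) j(1)] j by simp
  then show ?case by (simp add: L_def)
qed

lemma column_weights:
  obtains v r where "\<And>k. k < NgR \<Longrightarrow> 1 \<le> v k" "0 \<le> r" "r < 1"
    "\<And>k. k < NgR \<Longrightarrow> (\<Sum>l<NgR. v l * aR l k) \<le> r * v k"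
proof -
  have "\<exists>q. (\<Sum>l<NgR. kpow NgR aR q l k) < 1" if "k < NgR" for k
    using leaky[of "NgS + k"] that by simp
  then obtain v r where "\<forall>k<NgR. 1 \<le> v k" "0 \<le> r" "r < 1" "\<forall>k<NgR. (\<Sum>l<NgR. v l * aR l k) \<le> r * v k"
    using leaky_column_weights[of NgR aR, OF aR_nonneg aR_colsum] by blast
  then show thesis using that[of v r] by blast
qed

lemma row_weights:
  obtains u r where "\<And>k. NgS \<le> k \<Longrightarrow> k < N \<Longrightarrow> 1 \<le> u k" "0 \<le> r" "r < 1"
    "\<And>l. NgS \<le> l \<Longrightarrow> l < N \<Longrightarrow> (\<Sum>k=NgS..<N. a l k * u k) \<le> r * u l"
proof -
  obtain v r0 where v: "\<And>k. k < NgR \<Longrightarrow> 1 \<le> v k" "0 \<le> r0" "r0 < 1"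
    "\<And>k. k < NgR \<Longrightarrow> (\<Sum>l<NgR. v l * aR l k) \<le> r0 * v k" using column_weights by blast
  obtain u r where u: "\<forall>k<NgR. 1 \<le> u k" "0 \<le> r" "r < 1" "\<forall>l<NgR. (\<Sum>k<NgR. aR l k * u k) \<le> r * u l"
    using leaky_row_weights[of NgR aR v r0, OF aR_nonneg v] by blast
  show thesis
  proof (rule that[of "\<lambda>k. u (k - NgS)" r])
    fix l assume l: "NgS \<le> l" "l < N"
    have "(\<Sum>k=NgS..<N. a l k * u (k - NgS)) = (\<Sum>i<NgR. a l (NgS + i) * u i)"
      using sum.shift_bounds_nat_ivl[of "\<lambda>k. a l k * u (k - NgS)" 0 NgS NgR] NgS(2)
      by (simp add: lessThan_atLeast0 add.commute)
    then show "(\<Sum>k=NgS..<N. a l k * u (k - NgS)) \<le> r * u (l - NgS)"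
      using u(4)[rule_format, of "l - NgS"] l by simp
  qed (use u in auto)
qed

text \<open>The entries of the identity \<open>W * (1 - TRR) = TSR\<close>. The substance is that
  \<open>1 - TRR\<close> is invertible, so that \<open>mat_inverse\<close> in \<open>Wmat\<close>
  returns a value: a kernel vector would be fixed by \<open>TRR\<close>, and leakage forces it to
  vanish.\<close>

lemma Wmat_rec:
  assumes "l < NgS" "j < NgR"
  shows "Wmat A N NgS $$ (l, j) = a l (NgS + j) + (\<Sum>i<NgR. Wmat A N NgS $$ (l, i) * aR i j)"
proof -
  define TSR where "TSR = mat NgS NgR (\<lambda>(i,j). A $$ (i, NgS + j))"
  define TRR where "TRR = mat NgR NgR (\<lambda>(i,j). A $$ (NgS + i, NgS + j))"
  have T: "TSR \<in> carrier_mat NgS NgR" "TRR \<in> carrier_mat NgR NgR" by (simp_all add: TSR_def TRR_def)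
  define E where "E = 1\<^sub>m NgR - TRR"
  have E: "E \<in> carrier_mat NgR NgR" unfolding E_def by (rule minus_carrier_mat[OF T(2)])
  have Ee: "E $$ (i, j) = (if i = j then 1 else 0) - aR i j" if "i < NgR" "j < NgR" for i j
    using that T by (simp add: E_def TRR_def)
  obtain v r where v: "\<And>k. k < NgR \<Longrightarrow> 1 \<le> v k" "0 \<le> r" "r < 1"
    "\<And>k. k < NgR \<Longrightarrow> (\<Sum>l<NgR. v l * aR l k) \<le> r * v k" using column_weights by blast
  have "Determinant.det E \<noteq> 0"
  proof
    assume "Determinant.det E = 0"
    then obtain x where x: "x \<in> carrier_vec NgR" "x \<noteq> 0\<^sub>v NgR" "E *\<^sub>v x = 0\<^sub>v NgR"
      using det_0_iff_vec_prod_zero[OF E] by auto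
    have fx: "(\<Sum>k<NgR. aR i k * x $ k) = x $ i" if i: "i < NgR" for i
    proof -
      have "0 = (E *\<^sub>v x) $ i" using x i by simp
      also have "\<dots> = (\<Sum>k<NgR. E $$ (i, k) * x $ k)"
        using E x(1) i by (auto simp: scalar_prod_def lessThan_atLeast0 intro!: sum.cong)
      also have "\<dots> = (\<Sum>k<NgR. (if i = k then x $ k else 0) - aR i k * x $ k)"
        using i by (intro sum.cong) (auto simp: Ee left_diff_distrib)
      also have "\<dots> = x $ i - (\<Sum>k<NgR. aR i k * x $ k)" using i by (simp add: sum_subtractf)
      finally show ?thesis by simp
    qed
    have "x $ i = 0" if "i < NgR" for i
      by (rule leaky_fixed_zero[of NgR aR v r]) (use aR_nonneg v fx that in auto)
    then have "x = 0\<^sub>v NgR" using x(1) by (intro eq_vecI) auto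
    then show False using x(2) by simp
  qed
  then have "E \<in> Units (ring_mat TYPE(real) NgR ())" by (rule det_non_zero_imp_unit[OF E])
  then obtain I where I: "mat_inverse E = Some I" using mat_inverse(1)[OF E, where b = "()"] by (cases "mat_inverse E") auto
  then have Ic: "I * E = 1\<^sub>m NgR" "I \<in> carrier_mat NgR NgR" using mat_inverse(2)[OF E] by auto
  have W: "Wmat A N NgS = TSR * I"
    unfolding Wmat_def Let_def TSR_def[symmetric] TRR_def[symmetric] E_def[symmetric] by (simp add: I)
  have Wc: "Wmat A N NgS \<in> carrier_mat NgS NgR" unfolding W using T Ic by simp
  have "Wmat A N NgS * E = TSR"
    unfolding W using assoc_mult_mat[OF T(1) Ic(2) E] Ic T by simp
  then have "(Wmat A N NgS * E) $$ (l, j) = a l (NgS + j)" using assms by (simp add: TSR_def)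
  moreover have "(Wmat A N NgS * E) $$ (l, j) = (\<Sum>i<NgR. Wmat A N NgS $$ (l, i) * E $$ (i, j))"
    using Wc E assms by (auto simp: scalar_prod_def lessThan_atLeast0 intro!: sum.cong)
  moreover have "\<dots> = (\<Sum>i<NgR. (if i = j then Wmat A N NgS $$ (l, i) else 0) - Wmat A N NgS $$ (l, i) * aR i j)"
    using assms by (intro sum.cong) (auto simp: Ee right_diff_distrib)
  moreover have "\<dots> = Wmat A N NgS $$ (l, j) - (\<Sum>i<NgR. Wmat A N NgS $$ (l, i) * aR i j)"
    using assms by (simp add: sum_subtractf)
  ultimately show ?thesis by simp
qed

lemma lim_pt_S: "k < NgS \<Longrightarrow> lim_pt A sub N S \<mu> grad k = wS A sub N \<mu> grad (sub k)"
  by (simp add: lim_pt_def Let_def NgS(1))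

text \<open>The explicit formula through \<open>W\<close> is turned into the fixed-point property
  required by \<open>downstream_moments\<close>.\<close>

lemma lim_pt_R:
  fixes grad :: "nat \<Rightarrow> 'a::euclidean_space \<Rightarrow> 'a"
  assumes "NgS \<le> k" "k < N"
  shows "lim_pt A sub N S \<mu> grad k = (\<Sum>l<N. a l k *\<^sub>R lim_pt A sub N S \<mu> grad l)"
proof -
  define j where "j = k - NgS"
  have j: "k = NgS + j" "j < NgR" using assms by (auto simp: j_def)
  define x where "x l = wS A sub N \<mu> grad (sub l)" for l
  have R: "lim_pt A sub N S \<mu> grad (NgS + i) = (\<Sum>l<NgS. Wmat A N NgS $$ (l, i) *\<^sub>R x l)" for i
    by (simp add: lim_pt_def Let_def NgS(1) x_def)
  have "lim_pt A sub N S \<mu> grad k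
      = (\<Sum>l<NgS. a l k *\<^sub>R x l + (\<Sum>i<NgR. (Wmat A N NgS $$ (l, i) * aR i j) *\<^sub>R x l))"
    unfolding j(1) R using j(2)
    by (intro sum.cong refl) (subst Wmat_rec, auto simp: scaleR_add_left scaleR_sum_left)
  also have "\<dots> = (\<Sum>l<NgS. a l k *\<^sub>R x l) + (\<Sum>i<NgR. aR i j *\<^sub>R (\<Sum>l<NgS. Wmat A N NgS $$ (l, i) *\<^sub>R x l))"
    unfolding sum.distrib scaleR_sum_right by (subst sum.swap) (simp add: ac_simps)
  also have "\<dots> = (\<Sum>l<N. a l k *\<^sub>R lim_pt A sub N S \<mu> grad l)"
    unfolding split_sum R using lim_pt_S[of _ \<mu> grad] by (simp add: x_def j(1))
  finally show ?thesis .
qed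

end

lemma wS_scale:
  fixes grad :: "nat \<Rightarrow> 'a::euclidean_space \<Rightarrow> 'a"
  assumes "c > 0"
  shows "wS A sub N (\<lambda>l. \<tau> l * c) grad s = wS A sub N \<tau> grad s"
proof -
  have "(\<Sum>k\<in>I. (\<tau> k * c * q k) *\<^sub>R grad k w) = c *\<^sub>R (\<Sum>k\<in>I. (\<tau> k * q k) *\<^sub>R grad k w)" for q w I
    by (simp add: scaleR_sum_right ac_simps)
  then show ?thesis using assms by (simp add: wS_def)
qed

lemma lim_pt_scale: "c > 0 \<Longrightarrow> lim_pt A sub N S (\<lambda>l. \<tau> l * c) grad = lim_pt A sub N S \<tau> grad"
  by (rule ext) (simp add: lim_pt_def wS_scale Let_def)

section \<open>Convergence of the network\<close>

locale diffusion_network = weak_network N S R sub A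
  for N S R :: nat and sub :: "nat \<Rightarrow> nat" and A :: "real mat" +
  fixes \<tau> :: "nat \<Rightarrow> real"
    and J :: "nat \<Rightarrow> 'a::euclidean_space \<Rightarrow> real" and grad :: "nat \<Rightarrow> 'a \<Rightarrow> 'a"
    and hess :: "nat \<Rightarrow> 'a \<Rightarrow> 'a \<Rightarrow>\<^sub>L 'a" and \<delta> :: real
  assumes tau: "\<And>k. k < N \<Longrightarrow> 0 < \<tau> k \<and> \<tau> k \<le> 1"
    and J_convex: "\<And>k. k < N \<Longrightarrow> convex_on UNIV (J k)"
    and J_grad: "\<And>k x. k < N \<Longrightarrow> (J k has_derivative (\<lambda>h. grad k x \<bullet> h)) (at x)"
    and J_hess: "\<And>k x. k < N \<Longrightarrow> (grad k has_derivative blinfun_apply (hess k x)) (at x)"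
    and hess_bdd: "\<And>k x. k < N \<Longrightarrow> norm (hess k x) \<le> \<delta>"
    and strong: "\<And>s. s \<in> {1..S} \<Longrightarrow> \<exists>k<N. sub k = s \<and> strongly_convex (J k)"
begin

abbreviation ws :: "nat \<Rightarrow> 'a" where "ws \<equiv> lim_pt A sub N S \<tau> grad"

text \<open>The weights of the equation for the limit point with the common factor of the step-sizes
  divided out.\<close>

definition q :: "nat \<Rightarrow> nat \<Rightarrow> real" where
  "q s i = perron_vec (blk A sub N s) $ i * \<tau> (off s + i)"

definition network_run :: "real \<Rightarrow> real \<Rightarrow> 'w measure \<Rightarrow> (nat \<Rightarrow> 'w measure) \<Rightarrow>
    (nat \<Rightarrow> nat \<Rightarrow> 'w \<Rightarrow> 'a) \<Rightarrow> (nat \<Rightarrow> nat \<Rightarrow> 'w \<Rightarrow> 'a) \<Rightarrow> bool" where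
  "network_run B \<mu> M F w n \<longleftrightarrow> noisy_run M F N ws B w n \<and>
     (\<forall>k<N. \<forall>i. \<forall>\<omega>\<in>space M. w k (Suc i) \<omega> = (\<Sum>l<N. a l k *\<^sub>R
        (w l i \<omega> - (\<mu> * \<tau> l) *\<^sub>R (grad l (w l i \<omega>) + n l i \<omega>))))"

text \<open>Eventual bounds instead of limits superior, because the recursions consume and produce
  them in this form.\<close>

definition moments_le :: "real \<Rightarrow> real \<Rightarrow> 'w measure \<Rightarrow> (nat \<Rightarrow> nat \<Rightarrow> 'w \<Rightarrow> 'a) \<Rightarrow> nat \<Rightarrow> bool" where
  "moments_le C \<mu> M w k \<longleftrightarrow> eventually (\<lambda>i. norm (\<integral>\<omega>. ws k - w k i \<omega> \<partial>M) \<le> C * \<mu>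
        \<and> (\<integral>\<omega>. norm (ws k - w k i \<omega>) ^ 4 \<partial>M) \<le> C * \<mu>\<^sup>2) sequentially"

lemma moments_le_mono:
  assumes "moments_le C \<mu> M w k" "C \<le> C'" "0 < \<mu>"
  shows "moments_le C' \<mu> M w k"
  using assms(1) unfolding moments_le_def
proof eventually_elim
  case (elim i)
  have "C * \<mu> \<le> C' * \<mu>" "C * \<mu>\<^sup>2 \<le> C' * \<mu>\<^sup>2" using assms by (auto intro!: mult_right_mono)
  then show ?case using elim by linarith
qed

definition block_grad :: "nat \<Rightarrow> 'a \<Rightarrow> 'a" where
  "block_grad s u = (\<Sum>i<len s. q s i *\<^sub>R grad (off s + i) u)"

lemma grad_lip: "k < N \<Longrightarrow> norm (grad k x - grad k y) \<le> \<delta> * norm (x - y)"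
  by (rule bounded_derivative_lipschitz[OF J_hess hess_bdd])

lemma grad_mono:
  assumes "k < N" shows "0 \<le> (grad k x - grad k y) \<bullet> (x - y)"
proof -
  have "0 * (norm (x - y))\<^sup>2 \<le> (grad k x - grad k y) \<bullet> (x - y)"
  proof (rule gradient_strongly_monotone[OF J_grad[OF assms]])
    fix x y :: 'a and t :: real assume "t \<in> {0..1}"
    then show "J k (t *\<^sub>R x + (1 - t) *\<^sub>R y)
        \<le> t * J k x + (1 - t) * J k y - 0 / 2 * t * (1 - t) * (norm (x - y))\<^sup>2"
      using convex_onD[OF J_convex[OF assms], of "1 - t" x y] by simp
  qed
  then show ?thesis by simp
qed

lemma q_pos: "s \<in> {1..S} \<Longrightarrow> i < len s \<Longrightarrow> 0 < q s i"
  using perron(2) tau in_subnet by (simp add: q_def)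

text \<open>One strongly convex cost is enough: all Perron weights are positive, and the other costs
  contribute monotone terms.\<close>

lemma block_grad_mono:
  assumes s: "s \<in> {1..S}"
  shows "\<exists>\<nu>>0. \<forall>u v. \<nu> * (norm (u - v))\<^sup>2 \<le> (block_grad s u - block_grad s v) \<bullet> (u - v)"
proof -
  obtain k where k: "k < N" "sub k = s" "strongly_convex (J k)" using strong[OF s] by blast
  then have "k \<in> subnet sub N s" by (simp add: subnet_def)
  then obtain i where i: "i < len s" "k = off s + i"
    unfolding subnet_interval by (auto simp: le_iff_add)
  obtain \<nu> where \<nu>: "\<nu> > 0" "\<And>x y t. t \<in> {0..1} \<Longrightarrow> J k (t *\<^sub>R x + (1 - t) *\<^sub>R y)
      \<le> t * J k x + (1 - t) * J k y - \<nu> / 2 * t * (1 - t) * (norm (x - y))\<^sup>2"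
    using k(3) unfolding strongly_convex_def by blast
  have "q s i * \<nu> * (norm (u - v))\<^sup>2 \<le> (block_grad s u - block_grad s v) \<bullet> (u - v)" for u v
  proof -
    have "q s i * (\<nu> * (norm (u - v))\<^sup>2) \<le> q s i * ((grad k u - grad k v) \<bullet> (u - v))"
      using q_pos[OF s i(1)] gradient_strongly_monotone[OF J_grad[OF k(1)] \<nu>(2)]
      by (intro mult_left_mono) auto
    also have "\<dots> \<le> (\<Sum>j<len s. q s j * ((grad (off s + j) u - grad (off s + j) v) \<bullet> (u - v)))"
      unfolding i(2) using i(1) q_pos[OF s] grad_mono in_subnet
      by (intro member_le_sum[where f = "\<lambda>j. q s j * ((grad (off s + j) u - grad (off s + j) v) \<bullet> (u - v))"]
          mult_nonneg_nonneg) (auto intro: less_imp_le)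
    also have "\<dots> = (block_grad s u - block_grad s v) \<bullet> (u - v)"
      unfolding block_grad_def sum_subtractf[symmetric] scaleR_diff_right[symmetric] inner_sum_left
      by simp
    finally show ?thesis by (simp add: mult.assoc)
  qed
  moreover have "q s i * \<nu> > 0" using q_pos[OF s i(1)] \<nu>(1) by simp
  ultimately show ?thesis by blast
qed

text \<open>\<open>wS\<close> is a definite description, so its equation holds only once the
  weighted gradient is known to have exactly one zero.\<close>

lemma block_grad_wS:
  assumes s: "s \<in> {1..S}"
  shows "block_grad s (wS A sub N \<tau> grad s) = 0"
proof -
  obtain \<nu> where \<nu>: "\<nu> > 0" "\<And>u v. \<nu> * (norm (u - v))\<^sup>2 \<le> (block_grad s u - block_grad s v) \<bullet> (u - v)"
    using block_grad_mono[OF s] by blast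
  have "norm (block_grad s x - block_grad s y) \<le> (\<Sum>i<len s. q s i * \<delta>) * norm (x - y)" for x y
    unfolding block_grad_def sum_subtractf[symmetric] scaleR_diff_right[symmetric] sum_distrib_right
  proof (rule sum_norm_le)
    fix i assume "i \<in> {..<len s}"
    then show "norm (q s i *\<^sub>R (grad (off s + i) x - grad (off s + i) y)) \<le> q s i * \<delta> * norm (x - y)"
      using q_pos[OF s, of i] in_subnet[of i s] grad_lip[of "off s + i" x y] by (simp add: mult.assoc)
  qed
  then have ex: "\<exists>!w. block_grad s w = 0" by (rule strongly_monotone_zero[OF \<nu>(2) _ \<nu>(1)])
  have "wS A sub N \<tau> grad s = (THE w. block_grad s w = 0)"
    unfolding wS_def block_grad_def q_def subnet_sum by (simp add: mult.commute)
  then show ?thesis using theI'[OF ex] by simp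
qed

text \<open>Supplies the data of \<open>diffusion_block\<close> for sub-network \<open>s\<close>,
  re-indexed by \<open>off s + i\<close>. A run of the network restricts to it because the block is
  autonomous and all its agents share the limit point.\<close>

lemma block_convergence:
  fixes \<epsilon> \<kappa> B :: real
  assumes s: "s \<in> {1..S}" and eps: "0 < \<epsilon>" and kap: "0 \<le> \<kappa>" and B: "0 \<le> B"
    and smooth: "\<And>k \<Delta>. k < N \<Longrightarrow> norm \<Delta> \<le> \<epsilon> \<Longrightarrow> norm (hess k (ws k + \<Delta>) - hess k (ws k)) \<le> \<kappa> * norm \<Delta>"
  shows "\<exists>C \<mu>0. 0 < C \<and> 0 < \<mu>0 \<and> (\<forall>\<mu> (M :: 'w measure) F w n k. 0 < \<mu> \<longrightarrow> \<mu> < \<mu>0 \<longrightarrow>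
     network_run B \<mu> M F w n \<longrightarrow> k < N \<longrightarrow> sub k = s \<longrightarrow> moments_le C \<mu> M w k)"
proof -
  define x where "x = wS A sub N \<tau> grad s"
  define p where "p i = perron_vec (blk A sub N s) $ i" for i
  let ?a = "\<lambda>i j. a (off s + i) (off s + j)"
  have ws: "ws (off s + i) = x" if "i < len s" for i
    using lim_pt_S[of "off s + i"] in_subnet[OF that] s lt_off[of "off s + i" "Suc S"] by (simp add: x_def)
  obtain m where m: "0 < m" "\<And>i j. i < len s \<Longrightarrow> j < len s \<Longrightarrow> 0 < kpow (len s) ?a m i j"
    by (rule block_power_pos[OF s]) (rule that)
  obtain D :: "(nat \<Rightarrow> 'a) \<Rightarrow> real" and K r :: real where
    r: "0 \<le> r" "r < 1" and K: "1 \<le> K" and D0: "\<And>x. 0 \<le> D x"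
    and D1: "\<And>x. D (\<lambda>k. \<Sum>l<len s. ?a l k *\<^sub>R x l) \<le> r * D x"
    and D2: "\<And>x y. D (\<lambda>k. x k + y k) \<le> D x + D y"
    and D3: "\<And>x k. k < len s \<Longrightarrow> norm (x k - (\<Sum>l<len s. p l *\<^sub>R x l)) \<le> K * D x"
    and D4: "\<And>x. D x \<le> K * (\<Sum>l<len s. norm (x l))"
    and D5: "\<And>x (N :: 'w measure). (\<And>l. l < len s \<Longrightarrow> x l \<in> borel_measurable N) \<Longrightarrow>
       (\<lambda>\<omega>. D (\<lambda>l. x l \<omega>)) \<in> borel_measurable N"
  proof (rule consensus_seminorm[of "len s" ?a p m, where 'a = 'a and 'w = 'w], goal_cases)
    case (1 l k) then show ?case using A_nonneg in_subnet by simp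
  next
    case (2 k) then show ?case using block_colsum[of s k] s by simp
  next
    case (3 k) then show ?case using perron(2)[OF s] by (simp add: p_def)
  next
    case 4 show ?case using perron(1)[OF s] by (simp add: p_def)
  next
    case (5 l) then show ?case using perron(3)[OF s] by (simp add: p_def)
  next
    case 6 show ?case by (rule m)
  next
    case (7 l k) show ?case by (rule m(2)) (rule 7)+
  next
    case (8 D K r) show ?case by (rule that[of r K D]) (fact 8)+
  qed
  obtain \<nu> where \<nu>: "\<nu> > 0" "\<And>u v. \<nu> * (norm (u - v))\<^sup>2 \<le> (block_grad s u - block_grad s v) \<bullet> (u - v)"
    using block_grad_mono[OF s] by blast
  have \<delta>0: "0 \<le> \<delta>"
  proof -
    have "off s < N" using in_subnet[of 0 s] len_pos[of s] s by simp
    then show ?thesis using hess_bdd[of "off s" 0] norm_ge_zero[of "hess (off s) 0"] by linarith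
  qed
  define Q where "Q = \<kappa> + 2 * \<delta> / \<epsilon>"
  have Q: "0 \<le> Q" using kap eps \<delta>0 by (simp add: Q_def)
  define b where "b = (\<Sum>i<len s. norm (grad (off s + i) x))"
  have b: "0 \<le> b" by (simp add: b_def sum_nonneg)
  \<comment> \<open>One constant for all bounds of the locale: the seminorm, the Lipschitz constant,
    the quadratic remainder, and the gradients at \<open>x\<close>, of which only the weighted sum
    vanishes.\<close>
  define K' where "K' = K + \<delta> + Q + b"
  have K': "K \<le> K'" "\<delta> \<le> K'" "Q \<le> K'" "b \<le> K'" using K \<delta>0 Q b by (auto simp: K'_def)
  have q1: "(\<Sum>i<len s. q s i) \<le> 1"
  proof -
    have "(\<Sum>i<len s. q s i) \<le> (\<Sum>i<len s. p i)"
      unfolding q_def p_def using perron(2)[OF s] tau in_subnet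
      by (intro sum_mono mult_left_le) (auto intro: less_imp_le)
    then show ?thesis using perron(1)[OF s] by (simp add: p_def)
  qed
  define H where "H u = (\<Sum>i<len s. q s i *\<^sub>R hess (off s + i) x u)" for u
  have H: "bounded_linear H" unfolding H_def
    by (intro bounded_linear_sum bounded_linear_scaleR_right[THEN bounded_linear_compose] blinfun.bounded_linear_right)
  have quad: "norm (block_grad s (x + u) - H u) \<le> K' * (norm u)\<^sup>2" for u
  proof -
    \<comment> \<open>The weighted gradient at \<open>x\<close> is zero, so the individual gradients
      may be subtracted to form remainders.\<close>
    have eq: "block_grad s (x + u) - H u
        = (\<Sum>i<len s. q s i *\<^sub>R (grad (off s + i) (x + u) - grad (off s + i) x - hess (off s + i) x u))"
      using block_grad_wS[OF s] unfolding x_def[symmetric] block_grad_def H_def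
      by (simp add: scaleR_diff_right sum_subtractf)
    have "norm (block_grad s (x + u) - H u) \<le> (\<Sum>i<len s. q s i * (Q * (norm u)\<^sup>2))"
      unfolding eq
    proof (rule sum_norm_le)
      fix i assume "i \<in> {..<len s}"
      then have i: "i < len s" and iN: "off s + i < N" using in_subnet by auto
      have "norm (grad (off s + i) (x + u) - grad (off s + i) x - hess (off s + i) x u) \<le> Q * (norm u)\<^sup>2"
        unfolding Q_def
        by (rule quadratic_remainder[OF J_hess[OF iN] hess_bdd[OF iN] eps kap])
          (use smooth[OF iN] ws[OF i] in simp)
      then show "norm (q s i *\<^sub>R (grad (off s + i) (x + u) - grad (off s + i) x - hess (off s + i) x u))
          \<le> q s i * (Q * (norm u)\<^sup>2)" using q_pos[OF s i] by simp
    qed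
    also have "\<dots> = (\<Sum>i<len s. q s i) * (Q * (norm u)\<^sup>2)" by (simp only: sum_distrib_right)
    also have "\<dots> \<le> 1 * (K' * (norm u)\<^sup>2)"
      using q1 Q K' by (intro mult_mono mult_right_mono) auto
    finally show ?thesis by simp
  qed
  interpret B: diffusion_block "len s" ?a p "\<lambda>i. \<tau> (off s + i)" "\<lambda>i. grad (off s + i)" x D K' r \<nu> H
    "TYPE('w)"
  proof (rule diffusion_block.intro)
    show "norm (x k - (\<Sum>l<len s. p l *\<^sub>R x l)) \<le> K' * D x" if "k < len s" for x k
      using D3[OF that, of x] mult_right_mono[OF K'(1) D0[of x]] by linarith
    show "D x \<le> K' * (\<Sum>l<len s. norm (x l))" for x
      using D4[of x] mult_right_mono[OF K'(1), of "\<Sum>l<len s. norm (x l)"] by (simp add: sum_nonneg)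
    show "norm (grad (off s + k) u - grad (off s + k) v) \<le> K' * norm (u - v)" if "k < len s" for k u v
      using grad_lip[of "off s + k" u v] in_subnet[OF that] mult_right_mono[OF K'(2), of "norm (u - v)"] by simp
    show "norm (grad (off s + k) x) \<le> K'" if "k < len s" for k
    proof -
      have "norm (grad (off s + k) x) \<le> b" unfolding b_def using that by (intro member_le_sum) auto
      then show ?thesis using K' by simp
    qed
    show "\<nu> * (norm (u - v))\<^sup>2 \<le> ((\<Sum>k<len s. (p k * \<tau> (off s + k)) *\<^sub>R grad (off s + k) u)
      - (\<Sum>k<len s. (p k * \<tau> (off s + k)) *\<^sub>R grad (off s + k) v)) \<bullet> (u - v)" for u v
      using \<nu>(2)[of u v] by (simp add: block_grad_def q_def p_def)
    show "(\<Sum>k<len s. (p k * \<tau> (off s + k)) *\<^sub>R grad (off s + k) x) = 0"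
      using block_grad_wS[OF s] by (simp add: block_grad_def q_def p_def x_def)
    show "norm ((\<Sum>k<len s. (p k * \<tau> (off s + k)) *\<^sub>R grad (off s + k) (x + u)) - H u) \<le> K' * (norm u)\<^sup>2" for u
      using quad[of u] by (simp add: block_grad_def q_def p_def)
    show "bounded_linear H" by (rule H)
    show "(\<Sum>k<len s. p k) = 1" using perron(1)[OF s] by (simp add: p_def)
    show "(\<Sum>k<len s. ?a l k * p k) = p l" if "l < len s" for l using perron(3)[OF s that] by (simp add: p_def)
    show "0 \<le> p k" if "k < len s" for k using perron(2)[OF s that] by (simp add: p_def)
    show "0 \<le> \<tau> (off s + k)" "\<tau> (off s + k) \<le> 1" if "k < len s" for k
      using tau[of "off s + k"] in_subnet[OF that] by auto
    show "1 \<le> K'" using K K' by simp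
  qed (use r \<nu> D0 D1 D2 D5 in auto)
  obtain C \<mu>0 where C: "0 < C" "0 < \<mu>0" and main: "\<And>\<mu> (M :: 'w measure) F w n. 0 < \<mu> \<Longrightarrow> \<mu> < \<mu>0 \<Longrightarrow>
     noisy_run M F (len s) (\<lambda>_. x) B w n \<Longrightarrow>
     (\<forall>k<len s. \<forall>i. \<forall>\<omega>\<in>space M. w k (Suc i) \<omega> = (\<Sum>l<len s. ?a l k *\<^sub>R
        (w l i \<omega> - (\<mu> * \<tau> (off s + l)) *\<^sub>R (grad (off s + l) (w l i \<omega>) + n l i \<omega>)))) \<Longrightarrow>
     (\<forall>k<len s. eventually (\<lambda>i. norm (\<integral>\<omega>. x - w k i \<omega> \<partial>M) \<le> C * \<mu>
        \<and> (\<integral>\<omega>. norm (x - w k i \<omega>) ^ 4 \<partial>M) \<le> C * \<mu>\<^sup>2) sequentially)"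
    using B.block_moments[OF B] by blast
  show ?thesis
  proof (rule exI[of _ C], rule exI[of _ \<mu>0], intro conjI C, intro allI impI)
    fix \<mu> and M :: "'w measure" and F w n k
    assume \<mu>: "0 < \<mu>" "\<mu> < \<mu>0" and run: "network_run B \<mu> M F w n"
      and k: "k < N" "sub k = s"
    from run have noisy: "noisy_run M F N ws B w n"
      and rec: "\<forall>k<N. \<forall>i. \<forall>\<omega>\<in>space M. w k (Suc i) \<omega> = (\<Sum>l<N. a l k *\<^sub>R
        (w l i \<omega> - (\<mu> * \<tau> l) *\<^sub>R (grad l (w l i \<omega>) + n l i \<omega>)))"
      unfolding network_run_def by (rule conjunct1, rule conjunct2)
    have "k \<in> subnet sub N s" using k by (simp add: subnet_def)
    then obtain j where j: "j < len s" "k = off s + j"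
      unfolding subnet_interval by (auto simp: le_iff_add)
    have "noisy_run M F (len s) (\<lambda>_. x) B (\<lambda>l. w (off s + l)) (\<lambda>l. n (off s + l))"
      unfolding noisy_run_def
    proof (intro conjI allI impI)
      show "prob_space M" using noisy by (simp add: noisy_run_def)
      fix k assume k: "k < len s"
      then have "noisy_agent M F (ws (off s + k)) B (w (off s + k)) (n (off s + k))"
        using noisy in_subnet[OF k] by (simp add: noisy_run_def)
      then show "noisy_agent M F x B (w (off s + k)) (n (off s + k))" by (simp only: ws[OF k])
    qed
    moreover have "\<forall>k<len s. \<forall>i. \<forall>\<omega>\<in>space M. w (off s + k) (Suc i) \<omega> = (\<Sum>l<len s. ?a l k *\<^sub>R
        (w (off s + l) i \<omega> - (\<mu> * \<tau> (off s + l)) *\<^sub>R (grad (off s + l) (w (off s + l) i \<omega>) + n (off s + l) i \<omega>)))"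
    proof (intro allI impI ballI)
      fix k i \<omega> assume "k < len s" "\<omega> \<in> space M"
      then show "w (off s + k) (Suc i) \<omega> = (\<Sum>l<len s. ?a l k *\<^sub>R
        (w (off s + l) i \<omega> - (\<mu> * \<tau> (off s + l)) *\<^sub>R (grad (off s + l) (w (off s + l) i \<omega>) + n (off s + l) i \<omega>)))"
        using rec in_subnet[of k s] s
          block_sum[of s k "\<lambda>l. w l i \<omega> - (\<mu> * \<tau> l) *\<^sub>R (grad l (w l i \<omega>) + n l i \<omega>)"] by simp
    qed
    ultimately show "moments_le C \<mu> M w k"
      unfolding moments_le_def using main[OF \<mu>, of M F "\<lambda>l. w (off s + l)" "\<lambda>l. n (off s + l)"] j ws[OF j(1)] by simp
  qed
qed

lemma network_convergence:
  fixes \<epsilon> \<kappa> B :: real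
  assumes eps: "0 < \<epsilon>" and kap: "0 \<le> \<kappa>" and B: "0 \<le> B"
    and smooth: "\<And>k \<Delta>. k < N \<Longrightarrow> norm \<Delta> \<le> \<epsilon> \<Longrightarrow> norm (hess k (ws k + \<Delta>) - hess k (ws k)) \<le> \<kappa> * norm \<Delta>"
  shows "\<exists>C \<mu>0. 0 < C \<and> 0 < \<mu>0 \<and> (\<forall>\<mu> (M :: 'w measure) F w n k. 0 < \<mu> \<longrightarrow> \<mu> < \<mu>0 \<longrightarrow>
     network_run B \<mu> M F w n \<longrightarrow> k < N \<longrightarrow> moments_le C \<mu> M w k)"
proof -
  have "\<forall>s\<in>{1..S}. \<exists>C \<mu>0. 0 < C \<and> 0 < \<mu>0 \<and> (\<forall>\<mu> (M :: 'w measure) F w n k. 0 < \<mu> \<longrightarrow> \<mu> < \<mu>0 \<longrightarrow>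
      network_run B \<mu> M F w n \<longrightarrow> k < N \<longrightarrow> sub k = s \<longrightarrow> moments_le C \<mu> M w k)"
    by (intro ballI block_convergence[OF _ eps kap B smooth])
  \<comment> \<open>Constants are picked for each sub-network before any run; the sum of the
    \<open>Cs\<close> and the minimum of the \<open>ms\<close> then serve all of group S.\<close>
  then obtain Cs ms where Cms: "\<forall>s\<in>{1..S}. 0 < Cs s \<and> 0 < ms s \<and>
      (\<forall>\<mu> (M :: 'w measure) F w n k. 0 < \<mu> \<longrightarrow> \<mu> < ms s \<longrightarrow>
        network_run B \<mu> M F w n \<longrightarrow> k < N \<longrightarrow> sub k = s \<longrightarrow> moments_le (Cs s) \<mu> M w k)"
    unfolding bchoice_iff by (elim exE) (rule that)
  then have Cs: "\<And>s. s \<in> {1..S} \<Longrightarrow> 0 < Cs s" and ms: "\<And>s. s \<in> {1..S} \<Longrightarrow> 0 < ms s" by simp_all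
  define C0 where "C0 = (\<Sum>s\<in>{1..S}. Cs s)"
  define \<mu>1 where "\<mu>1 = Min (insert 1 (ms ` {1..S}))"
  have C0: "0 \<le> C0" unfolding C0_def using Cs by (intro sum_nonneg) (auto intro: less_imp_le)
  have \<mu>1: "0 < \<mu>1" unfolding \<mu>1_def using ms by (subst Min_gr_iff) auto
  have goodS: "moments_le C0 \<mu> M w k" if "0 < \<mu>" "\<mu> < \<mu>1" "network_run B \<mu> M F w n" "k < NgS" for \<mu> and M :: "'w measure" and F w n k
  proof -
    have k: "k < N" "sub k \<in> {1..S}" using that(4) lt_off[of k "Suc S"] sub_range[of k] by auto
    have "\<mu>1 \<le> ms (sub k)" unfolding \<mu>1_def using k by (intro Min_le) auto
    then have "\<mu> < ms (sub k)" using that by simp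
    then have "moments_le (Cs (sub k)) \<mu> M w k"
      using bspec[OF Cms k(2), THEN conjunct2, THEN conjunct2, rule_format, of \<mu> M F w n k] that k by blast
    moreover have "Cs (sub k) \<le> C0"
      unfolding C0_def using k Cs by (intro member_le_sum) (auto intro: less_imp_le)
    ultimately show ?thesis using moments_le_mono that by blast
  qed
  define K where "K = 1 + \<bar>\<delta>\<bar> + (\<Sum>k<N. norm (grad k (ws k)))"
  have s0: "0 \<le> (\<Sum>k<N. norm (grad k (ws k)))" by (simp add: sum_nonneg)
  have K1: "1 \<le> K" using s0 by (simp add: K_def)
  have lipK: "norm (grad k x - grad k y) \<le> K * norm (x - y)" if "k < N" for k x y
    using s0 by (intro order_trans[OF grad_lip[OF that]] mult_right_mono) (auto simp: K_def)
  have gK: "norm (grad k (ws k)) \<le> K" if "k < N" for k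
    using member_le_sum[of k "{..<N}" "\<lambda>k. norm (grad k (ws k))"] that by (simp add: K_def)
  obtain u r where u: "\<And>k. NgS \<le> k \<Longrightarrow> k < N \<Longrightarrow> 1 \<le> u k" "0 \<le> r" "r < 1"
    "\<And>l. NgS \<le> l \<Longrightarrow> l < N \<Longrightarrow> (\<Sum>k=NgS..<N. a l k * u k) \<le> r * u l" by (rule row_weights) (rule that)
  have "\<exists>C \<mu>0. 0 < C \<and> 0 < \<mu>0 \<and> (\<forall>\<mu> (M :: 'w measure) F w s.
     0 < \<mu> \<longrightarrow> \<mu> < \<mu>0 \<longrightarrow> noisy_run M F N ws B w s \<longrightarrow>
     (\<forall>k<N. \<forall>i. \<forall>\<omega>\<in>space M. w k (Suc i) \<omega> = (\<Sum>l<N. a l k *\<^sub>R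
        (w l i \<omega> - (\<mu> * \<tau> l) *\<^sub>R (grad l (w l i \<omega>) + s l i \<omega>)))) \<longrightarrow>
     (\<forall>k<NgS. eventually (\<lambda>i. norm (\<integral>\<omega>. ws k - w k i \<omega> \<partial>M) \<le> C0 * \<mu>
        \<and> (\<integral>\<omega>. norm (ws k - w k i \<omega>) ^ 4 \<partial>M) \<le> C0 * \<mu>\<^sup>2) sequentially) \<longrightarrow>
     (\<forall>k\<in>{NgS..<N}. eventually (\<lambda>i. norm (\<integral>\<omega>. ws k - w k i \<omega> \<partial>M) \<le> C * \<mu>
        \<and> (\<integral>\<omega>. norm (ws k - w k i \<omega>) ^ 4 \<partial>M) \<le> C * \<mu>\<^sup>2) sequentially))"
    by (rule downstream_moments[where u = u and r = r and K = K])
      (use A_nonneg A_left_stoch NgS(2) u lim_pt_R K1 lipK gK tau B C0 in \<open>auto intro: less_imp_le\<close>)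
  then obtain C2 \<mu>2 where C2: "0 < C2" "0 < \<mu>2" and D: "\<forall>\<mu> (M :: 'w measure) F w s.
     0 < \<mu> \<longrightarrow> \<mu> < \<mu>2 \<longrightarrow> noisy_run M F N ws B w s \<longrightarrow>
     (\<forall>k<N. \<forall>i. \<forall>\<omega>\<in>space M. w k (Suc i) \<omega> = (\<Sum>l<N. a l k *\<^sub>R
        (w l i \<omega> - (\<mu> * \<tau> l) *\<^sub>R (grad l (w l i \<omega>) + s l i \<omega>)))) \<longrightarrow>
     (\<forall>k<NgS. eventually (\<lambda>i. norm (\<integral>\<omega>. ws k - w k i \<omega> \<partial>M) \<le> C0 * \<mu>
        \<and> (\<integral>\<omega>. norm (ws k - w k i \<omega>) ^ 4 \<partial>M) \<le> C0 * \<mu>\<^sup>2) sequentially) \<longrightarrow>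
     (\<forall>k\<in>{NgS..<N}. eventually (\<lambda>i. norm (\<integral>\<omega>. ws k - w k i \<omega> \<partial>M) \<le> C2 * \<mu>
        \<and> (\<integral>\<omega>. norm (ws k - w k i \<omega>) ^ 4 \<partial>M) \<le> C2 * \<mu>\<^sup>2) sequentially)"
    by (elim exE conjE) (rule that)
  have goodR: "moments_le C2 \<mu> M w k" if "0 < \<mu>" "\<mu> < \<mu>2" "network_run B \<mu> M F w n"
      "\<forall>k<NgS. moments_le C0 \<mu> M w k" "k \<in> {NgS..<N}" for \<mu> and M :: "'w measure" and F w n k
    using D[THEN spec, of \<mu>, THEN spec, of M, THEN spec, of F, THEN spec, of w, THEN spec, of n,
        THEN mp, OF that(1), THEN mp, OF that(2)] that(3-)
    unfolding network_run_def moments_le_def by simp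
  have "moments_le (C0 + C2) \<mu> M w k" if "0 < \<mu>" "\<mu> < min \<mu>1 \<mu>2" "network_run B \<mu> M F w n" "k < N"
    for \<mu> and M :: "'w measure" and F w n k
  proof (cases "k < NgS")
    case True
    then show ?thesis using moments_le_mono[OF goodS[of \<mu> M F w n k]] that C2 by simp
  next
    case False
    have "moments_le C2 \<mu> M w k" by (rule goodR[of \<mu> M F w n]) (use that goodS False in auto)
    then show ?thesis by (rule moments_le_mono) (use C0 that in auto)
  qed
  note main = this
  show ?thesis
  proof (rule exI[of _ "C0 + C2"], rule exI[of _ "min \<mu>1 \<mu>2"], intro conjI, goal_cases)
    case 1 show ?case using C0 C2 by simp
  next
    case 2 show ?case using \<mu>1 C2 by simp
  next
    case 3 show ?case by (intro allI impI) (rule main)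
  qed
qed

end

theorem theorem2:
  fixes N S R :: nat and sub :: "nat \<Rightarrow> nat" and A :: "real mat"
    and \<tau> :: "nat \<Rightarrow> real"
    and J :: "nat \<Rightarrow> 'a::euclidean_space \<Rightarrow> real" and grad :: "nat \<Rightarrow> 'a \<Rightarrow> 'a"
    and hess :: "nat \<Rightarrow> 'a \<Rightarrow> 'a \<Rightarrow>\<^sub>L 'a" and \<delta> :: real
    and \<beta> \<sigma> \<beta>4 \<sigma>4 :: "nat \<Rightarrow> real" and \<epsilon> \<kappa> :: real
  assumes S_pos: "1 \<le> S"
    and sub_range: "\<forall>k<N. 1 \<le> sub k \<and> sub k \<le> S + R"
    and sub_nonempty: "\<forall>s\<in>{1..S+R}. \<exists>k<N. sub k = s"
    and sub_ordered: "\<forall>k l. k \<le> l \<and> l < N \<longrightarrow> sub k \<le> sub l"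
    and A_dim: "A \<in> carrier_mat N N"
    and A_nonneg: "\<forall>l<N. \<forall>k<N. 0 \<le> A $$ (l,k)"
    and A_left_stoch: "\<forall>k<N. (\<Sum>l<N. A $$ (l,k)) = 1"
    and A_block: "\<forall>l<N. \<forall>k<N. A $$ (l,k) \<noteq> 0 \<longrightarrow> sub l \<le> sub k \<and> (sub k \<le> S \<longrightarrow> sub l = sub k)"
    and A_S_prim: "\<forall>s\<in>{1..S}. primitive_mat (blk A sub N s)"
    and A_R_irred: "\<forall>r\<in>{S+1..S+R}. irreducible_mat (blk A sub N r) \<and>
          (\<exists>j<dim_col (blk A sub N r). (\<Sum>i<dim_row (blk A sub N r). blk A sub N r $$ (i,j)) < 1)"
    and tau: "\<forall>k<N. 0 < \<tau> k \<and> \<tau> k \<le> 1"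
    and J_convex: "\<forall>k<N. convex_on UNIV (J k)"
    and J_grad: "\<forall>k<N. \<forall>x. (J k has_derivative (\<lambda>h. grad k x \<bullet> h)) (at x)"
    and J_hess: "\<forall>k<N. \<forall>x. (grad k has_derivative blinfun_apply (hess k x)) (at x)"
    and hess_bdd: "\<forall>k<N. \<forall>x. norm (hess k x) \<le> \<delta>"
    and strong: "\<forall>s\<in>{1..S}. \<exists>k<N. sub k = s \<and> strongly_convex (J k)"
    and noise_consts: "\<forall>k<N. 0 \<le> \<beta> k \<and> 0 \<le> \<sigma> k \<and> 0 \<le> \<beta>4 k \<and> 0 \<le> \<sigma>4 k"
    and eps: "0 < \<epsilon>" and kap: "0 \<le> \<kappa>"
  shows "\<exists>c \<mu>bar. 0 < c \<and> 0 < \<mu>bar \<and>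
    (\<forall>\<mu>max (M :: 'w measure) w gh.
       0 < \<mu>max \<and> \<mu>max < \<mu>bar \<and>
       (\<forall>k<N. \<forall>\<Delta>. norm \<Delta> \<le> \<epsilon> \<longrightarrow>
          norm (hess k (lim_pt A sub N S (\<lambda>l. \<tau> l * \<mu>max) grad k + \<Delta>)
                - hess k (lim_pt A sub N S (\<lambda>l. \<tau> l * \<mu>max) grad k)) \<le> \<kappa> * norm \<Delta>) \<and>
       atc_run N A (\<lambda>l. \<tau> l * \<mu>max) grad (lim_pt A sub N S (\<lambda>l. \<tau> l * \<mu>max) grad)
               \<beta> \<sigma> \<beta>4 \<sigma>4 M w gh
       \<longrightarrow> (\<forall>k<N.
             limsup (\<lambda>i. ereal (norm (integral\<^sup>L M (\<lambda>\<omega>.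
                lim_pt A sub N S (\<lambda>l. \<tau> l * \<mu>max) grad k - w k i \<omega>)))) \<le> ereal (c * \<mu>max)
           \<and> limsup (\<lambda>i. \<integral>\<^sup>+\<omega>. ennreal (norm (lim_pt A sub N S (\<lambda>l. \<tau> l * \<mu>max) grad k - w k i \<omega>) ^ 4) \<partial>M)
                \<le> ennreal (c * \<mu>max\<^sup>2)))"

proof -
  let ?ws = "lim_pt A sub N S \<tau> grad"
  interpret diffusion_network N S R sub A \<tau> J grad hess \<delta>
    using assms by unfold_locales auto
  define B where "B = (\<Sum>k<N. (\<beta> k)\<^sup>2 + (\<sigma> k)\<^sup>2 + (\<beta>4 k)\<^sup>2 + (\<sigma>4 k)\<^sup>2)"
  have B0: "0 \<le> B" unfolding B_def by (intro sum_nonneg) auto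
  have B: "(\<beta> k)\<^sup>2 \<le> B \<and> (\<sigma> k)\<^sup>2 \<le> B \<and> (\<beta>4 k)\<^sup>2 \<le> B \<and> (\<sigma>4 k)\<^sup>2 \<le> B" if "k < N" for k
  proof -
    have "(\<beta> k)\<^sup>2 + (\<sigma> k)\<^sup>2 + (\<beta>4 k)\<^sup>2 + (\<sigma>4 k)\<^sup>2 \<le> B"
      unfolding B_def using that
      by (intro member_le_sum[where f = "\<lambda>k. (\<beta> k)\<^sup>2 + (\<sigma> k)\<^sup>2 + (\<beta>4 k)\<^sup>2 + (\<sigma>4 k)\<^sup>2"]) auto
    moreover have "0 \<le> (\<beta> k)\<^sup>2" "0 \<le> (\<sigma> k)\<^sup>2" "0 \<le> (\<beta>4 k)\<^sup>2" "0 \<le> (\<sigma>4 k)\<^sup>2" by simp_all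
    ultimately show ?thesis by linarith
  qed
  \<comment> \<open>The smoothness condition stands inside the quantifier over the step-size,
    whereas the constants have to be chosen outside. As the limit points do not vary with the
    step-size, the condition holds for all positive values or for none, and in the latter case any
    constants will do.\<close>
  show ?thesis
  proof (cases "\<forall>k<N. \<forall>\<Delta>. norm \<Delta> \<le> \<epsilon> \<longrightarrow> norm (hess k (?ws k + \<Delta>) - hess k (?ws k)) \<le> \<kappa> * norm \<Delta>")
    case True
    then have sm: "norm (hess k (?ws k + \<Delta>) - hess k (?ws k)) \<le> \<kappa> * norm \<Delta>"
      if "k < N" "norm \<Delta> \<le> \<epsilon>" for k \<Delta> using that by blast
    have "\<exists>C \<mu>0. 0 < C \<and> 0 < \<mu>0 \<and> (\<forall>\<mu> (M :: 'w measure) F w n k.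
        0 < \<mu> \<longrightarrow> \<mu> < \<mu>0 \<longrightarrow> network_run B \<mu> M F w n \<longrightarrow> k < N \<longrightarrow> moments_le C \<mu> M w k)"
      by (rule network_convergence[OF eps kap B0]) (rule sm)
    then obtain C \<mu>0 where C: "0 < C" "0 < \<mu>0" and main: "\<forall>\<mu> (M :: 'w measure) F w n k.
        0 < \<mu> \<longrightarrow> \<mu> < \<mu>0 \<longrightarrow> network_run B \<mu> M F w n \<longrightarrow> k < N \<longrightarrow> moments_le C \<mu> M w k"
      by (elim exE conjE) (rule that)
    show ?thesis
    proof (rule exI[of _ C], rule exI[of _ \<mu>0], intro conjI C, intro allI impI, elim conjE)
      fix \<mu> and M :: "'w measure" and w gh k
      assume \<mu>: "0 < \<mu>" "\<mu> < \<mu>0" and k: "k < N"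
        and run: "atc_run N A (\<lambda>l. \<tau> l * \<mu>) grad (lim_pt A sub N S (\<lambda>l. \<tau> l * \<mu>) grad)
               \<beta> \<sigma> \<beta>4 \<sigma>4 M w gh"
      have ws: "lim_pt A sub N S (\<lambda>l. \<tau> l * \<mu>) grad = ?ws" by (rule lim_pt_scale[OF \<mu>(1)])
      define n where "n l i \<omega> = gh l i \<omega> - grad l (w l i \<omega>)" for l i \<omega>
      have noisy: "noisy_run M (hist M w N) N ?ws B w n"
        using atc_run_noisy_run[OF run grad_lip B] unfolding ws n_def .
      have rec: "\<forall>k<N. \<forall>i. \<forall>\<omega>\<in>space M. w k (Suc i) \<omega> = (\<Sum>l<N. A $$ (l, k) *\<^sub>R
          (w l i \<omega> - (\<mu> * \<tau> l) *\<^sub>R (grad l (w l i \<omega>) + n l i \<omega>)))"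
        using run by (simp add: atc_run_def n_def mult.commute)
      have ev: "eventually (\<lambda>i. norm (\<integral>\<omega>. ?ws k - w k i \<omega> \<partial>M) \<le> C * \<mu>
          \<and> (\<integral>\<omega>. norm (?ws k - w k i \<omega>) ^ 4 \<partial>M) \<le> C * \<mu>\<^sup>2) sequentially"
        using main[rule_format, of \<mu> M "hist M w N" w n k] \<mu> noisy rec k
        unfolding network_run_def moments_le_def by blast
      have ps: "prob_space M" using noisy by (simp add: noisy_run_def)
      have fm: "fourth_moment M (\<lambda>\<omega>. ?ws k - w k i \<omega>)" for i
        using noisy k by (intro fourth_moment_diff fourth_moment_const ps) (simp add: noisy_run_def noisy_agent_def)
      \<comment> \<open>The nonnegative integral of the statement agrees with the Bochner integral
        because the fourth moment is finite.\<close>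
      have nn: "(\<integral>\<^sup>+\<omega>. ennreal (norm (?ws k - w k i \<omega>) ^ 4) \<partial>M)
          = ennreal (\<integral>\<omega>. norm (?ws k - w k i \<omega>) ^ 4 \<partial>M)" for i
        using fourth_momentD(2)[OF fm] by (intro nn_integral_eq_integral) auto
      have "limsup (\<lambda>i. ereal (norm (\<integral>\<omega>. ?ws k - w k i \<omega> \<partial>M))) \<le> ereal (C * \<mu>)"
        by (rule Limsup_bounded) (use ev in eventually_elim, simp)
      moreover have "limsup (\<lambda>i. \<integral>\<^sup>+\<omega>. ennreal (norm (?ws k - w k i \<omega>) ^ 4) \<partial>M) \<le> ennreal (C * \<mu>\<^sup>2)"
        unfolding nn by (rule Limsup_bounded) (use ev in eventually_elim, simp add: ennreal_leI)
      ultimately show "limsup (\<lambda>i. ereal (norm (integral\<^sup>L M (\<lambda>\<omega>.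
                lim_pt A sub N S (\<lambda>l. \<tau> l * \<mu>) grad k - w k i \<omega>)))) \<le> ereal (C * \<mu>)
           \<and> limsup (\<lambda>i. \<integral>\<^sup>+\<omega>. ennreal (norm (lim_pt A sub N S (\<lambda>l. \<tau> l * \<mu>) grad k - w k i \<omega>) ^ 4) \<partial>M)
                \<le> ennreal (C * \<mu>\<^sup>2)"
        unfolding ws by blast
    qed
  next
    case False
    have no: "\<not> (\<forall>k<N. \<forall>\<Delta>. norm \<Delta> \<le> \<epsilon> \<longrightarrow>
          norm (hess k (lim_pt A sub N S (\<lambda>l. \<tau> l * \<mu>) grad k + \<Delta>)
                - hess k (lim_pt A sub N S (\<lambda>l. \<tau> l * \<mu>) grad k)) \<le> \<kappa> * norm \<Delta>)"
      if "0 < \<mu>" for \<mu> using False by (simp only: lim_pt_scale[OF that] not_False_eq_True)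
    show ?thesis
    proof (rule exI[of _ "1 :: real"], rule exI[of _ "1 :: real"], intro conjI, goal_cases)
      case 3
      show ?case by (intro allI, rule impI, elim conjE, erule notE[OF no, rotated])
    qed simp_all
  qed
qed

end
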